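(* Let $f$ be a reducible, nonsquare quadratic polynomial with integer coefficients, and let $D$ be its discriminant. For all real numbers $y\ge 3$ and every integer $h\ne0$, \[ R_f(h,y) \ll \sqrt{D}\, \prod_{p\mid h}\bigg(1+\frac{7}{\sqrt p}\bigg)\cdot y\,(\log y)^{\sqrt2-1}(\log\log y)^{5/2}, \] where the product is over primes $p$ dividing $h$ and the implied constant is absolute.
   Context: For a polynomial $f$ with integer coefficients, an integer $h$ and a real number $y$, \[ R_f(h,y) = \sum_{k\le y}\ \sum_{\substack{0<\nu\le k\\ f(\nu)\equiv 0 \ (\mathrm{mod}\ k)}} e^{2\pi i h\nu/k}, \] where $k$ runs over positive integers and $\nu$ over integers. "Reducible" means that $f$ can be written as $f(t)=W(at+b)(ct+d)$ with integers $W,a,b,c,d$ (and $W,a,c$ nonzero, since $f$ has degree $2$). "Nonsquare" means that $f$ is not a constant multiple of the square of a linear polynomial; equivalently $D\neq0$. *)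

theory Defs
  imports Complex_Main
    "HOL-Computational_Algebra.Polynomial"
    "HOL-Computational_Algebra.Primes"
    "HOL-Number_Theory.Cong"
begin

definition root_exp_sum :: "int poly \<Rightarrow> int \<Rightarrow> real \<Rightarrow> complex" where
  "root_exp_sum f h y =
     (\<Sum>k | 0 < k \<and> real k \<le> y.
        \<Sum>\<nu> | 0 < \<nu> \<and> \<nu> \<le> int k \<and> [poly f \<nu> = 0] (mod int k).
          exp (2 * of_real pi * \<i> * of_int h * of_int \<nu> / of_nat k))"

definition reducible_quadratic :: "int poly \<Rightarrow> bool" where
  "reducible_quadratic f \<longleftrightarrow>
     degree f = 2 \<and>
     (\<exists>W a b c d. W \<noteq> 0 \<and> a \<noteq> 0 \<and> c \<noteq> 0 \<and> f = smult W ([:b, a:] * [:d, c:]))"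

text \<open>
  The constant and the linear polynomial are taken over the rationals, but for integer
  polynomials every choice of coefficients between the integers and the complex numbers
  gives the same notion.
\<close>

definition nonsquare :: "int poly \<Rightarrow> bool" where
  "nonsquare f \<longleftrightarrow>
     \<not> (\<exists>(u :: rat) (l :: rat poly). degree l = 1 \<and> map_poly of_int f = smult u (l ^ 2))"

definition quadratic_discriminant :: "int poly \<Rightarrow> int" where
  "quadratic_discriminant f = (coeff f 1)\<^sup>2 - 4 * coeff f 2 * coeff f 0"

end

(*
  Hooley's method.  Write f = W (a t + b) (c t + d) with coprime coefficients in each factor, so that
  the square root of the discriminant is |N| with N = W (a d - b c), and let rho(k) be the number of
  roots of f modulo k.  Factor each k as q u v, where q is composed of primes dividing N h, and the
  remaining primes are split at z = y^(1/(192 log log y)) into those of u (at most z) and those of v.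
  The Chinese remainder theorem bounds the inner sum of modulus k by rho(q) rho(v) |S(h b, u)| with
  b the inverse of q v modulo u, so the size of h compared with y plays no role.  Brun's pure sieve
  bounds the sum of rho(v) over v <= X in any residue class modulo u by about X / u times
  (log log y)^2 / log y, and by orthogonality the mean square of S(h b, u) over all b modulo u is
  rho(u).  Summing sqrt(rho(u)) / u over u then gives (log y)^(sqrt 2).  The terms with q or u larger than
  y^(1/8) are negligible by Rankin's trick, and the sum of rho(q) / sqrt q over all q is at most a
  constant times |N| times the product over the primes dividing h.
*)
theory Submission
  imports Defs "HOL-Analysis.Analysis" "HOL-Real_Asymp.Real_Asymp"
begin

section \<open>Primes\<close>

text \<open>Bounding every inner sum by rho(k) would only give about y log y, since rho(p) is 2 for
  most p. The gain comes from u alone: averaged over b, |S(h b, u)| is at most sqrt(rho(u)), so a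
  prime up to z has weight sqrt 2 instead of 2, while sieving v saves a factor log y. Averaging over
  b requires the weights rho(v) to be bounded uniformly in each residue class modulo u, which is why
  q and u must be small powers of y. Those weights are removed by rho(v) <= d(v) and by switching to
  divisors d <= sqrt v, which leaves a long range for the cofactor v / d, and this is what is
  sieved. The primes of N h are set aside because orthogonality needs u coprime to h, and rho(p^j)
  <= 2 needs p not to divide N. One factor log log y is lost because z is below every fixed power of
  y; the other is log y / log z, which bounds the sum of 1 / d over the divisors d free of primes up
  to z. The constant 192 is both 6 * 32 and 8 * 24. With L = log y, truncating the sieve at r <= 6
  ln L gives z^r <= y^(1/32); and u > y^(1/8) gives u^(1 / ln z) > L^24, which cancels the L^20 and
  L^4 lost in Rankin's trick.\<close>

lemma finite_primes_le: "finite {p::nat. prime p \<and> real p \<le> x}"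
proof (rule finite_subset)
  show "{p::nat. prime p \<and> real p \<le> x} \<subseteq> {..nat \<lfloor>x\<rfloor>}"
    by (auto simp: le_nat_floor)
qed simp

lemma prod_coprime_dvd:
  fixes f :: "'a \<Rightarrow> nat"
  assumes "finite A" "\<And>i j. i \<in> A \<Longrightarrow> j \<in> A \<Longrightarrow> i \<noteq> j \<Longrightarrow> coprime (f i) (f j)"
    "\<And>i. i \<in> A \<Longrightarrow> f i dvd x"
  shows "prod f A dvd x"
  using assms
proof (induction A rule: finite_induct)
  case (insert a A)
  have "coprime (f a) (prod f A)"
    using insert by (intro prod_coprime_right) auto
  then show ?case using insert by (simp add: divides_mult)
qed simp

section \<open>Upper bounds of Chebyshev and Mertens for sums over primes\<close>

text \<open>Strong induction. An even n > 2 is not prime and reduces to n - 1. For n = 2m + 1 the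
  primes in (m + 1, n] all divide the binomial coefficient (n choose m), which is at most 2^n; the
  base 16 leaves enough room for this crude bound to close the induction.\<close>

lemma primorial_le: "(\<Prod>p | prime p \<and> p \<le> (n::nat). p) \<le> 16 ^ n"
proof (induction n rule: less_induct)
  case (less n)
  show ?case
  proof (cases "n < 3")
    case True
    then consider "n = 0" | "n = 1" | "n = 2" by linarith
    then show ?thesis
    proof cases
      case 1
      then have "{p. prime p \<and> p \<le> n} = {}" by (auto dest: prime_gt_0_nat)
      then show ?thesis by (simp only: prod.empty) simp
    next
      case 2
      then have "{p. prime p \<and> p \<le> n} = {}" by (auto dest: prime_gt_1_nat)
      then show ?thesis by (simp only: prod.empty) simp
    next
      case 3
      then have "{p. prime p \<and> p \<le> n} = {2}"
        using prime_ge_2_nat by (auto intro: antisym)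
      then show ?thesis using 3 by simp
    qed
  next
    case False
    show ?thesis
    proof (cases "even n")
      case True
      then have "\<not> prime n" using False prime_odd_nat[of n] by auto
      then have "{p. prime p \<and> p \<le> n} = {p. prime p \<and> p \<le> n - 1}"
        using le_Suc_eq[of _ "n-1"] False by auto
      moreover have "(\<Prod>p | prime p \<and> p \<le> n - 1. p) \<le> 16 ^ (n - 1)"
        using less[of "n-1"] False by simp
      moreover have "(16::nat) ^ (n-1) \<le> 16 ^ n" by (rule power_increasing) auto
      ultimately show ?thesis by (metis le_trans)
    next
      case odd: False
      then obtain m where n: "n = 2*m+1" by (metis oddE)
      with False have m: "m \<ge> 1" by auto
      let ?A = "{p. prime p \<and> p \<le> m+1}" and ?B = "{p. prime p \<and> m+1 < p \<and> p \<le> n}"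
      have fin: "finite ?A" "finite ?B"
        by (auto intro: finite_subset[of _ "{..m+1}"] finite_subset[of _ "{..n}"])
      have eq: "{p. prime p \<and> p \<le> n} = ?A \<union> ?B" using n by auto
      have "\<Prod>?B dvd (n choose m)"
      proof (rule prod_coprime_dvd)
        fix p assume "p \<in> ?B"
        then have p: "prime p" "m + 1 < p" "p \<le> n" by auto
        have "p dvd fact n" using p by (simp add: prime_dvd_fact_iff)
        also have "fact n = fact m * fact (n - m) * (n choose m)"
          using binomial_fact_lemma[of m n] n by simp
        finally have "p dvd fact m * fact (n - m) * (n choose m)" .
        moreover have "\<not> p dvd fact m" "\<not> p dvd fact (n-m)"
          using p n by (simp_all add: prime_dvd_fact_iff del: fact_Suc)
        ultimately show "p dvd (n choose m)"
          using p by (simp add: prime_dvd_mult_iff)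
      qed (use fin in \<open>auto simp: primes_coprime\<close>)
      then have "\<Prod>?B \<le> (n choose m)" using n by (intro dvd_imp_le) auto
      also have "\<dots> \<le> 2 ^ n" by (rule binomial_le_pow2)
      finally have B: "\<Prod>?B \<le> 2 ^ n" .
      have A: "\<Prod>?A \<le> 16 ^ (m+1)" using less[of "m+1"] n m by simp
      have "(\<Prod>p | prime p \<and> p \<le> n. p) = \<Prod>?A * \<Prod>?B"
        unfolding eq using fin by (intro prod.union_disjoint) auto
      also have "\<dots> \<le> 16 ^ (m+1) * 2 ^ n" using A B by (rule mult_mono) auto
      also have "(16::nat) ^ (m+1) * 2 ^ n = 2 ^ (4 * (m+1) + n)"
        by (simp add: power_add power_mult)
      also have "\<dots> \<le> 2 ^ (4 * n)" using n m by (intro power_increasing) auto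
      finally show ?thesis by (simp add: power_mult)
    qed
  qed
qed

lemma sum_ln_prime_le: "(\<Sum>p | prime p \<and> p \<le> (n::nat). ln (real p)) \<le> real n * ln 16"
proof -
  have "(\<Sum>p | prime p \<and> p \<le> n. ln (real p)) = ln (\<Prod>p | prime p \<and> p \<le> n. real p)"
    by (subst ln_prod) (auto dest: prime_gt_0_nat)
  also have "\<dots> = ln (real (\<Prod>p | prime p \<and> p \<le> n. p))" by simp
  also have "\<dots> \<le> ln (real (16 ^ n))"
  proof -
    have "(\<Prod>p | prime p \<and> p \<le> n. p) > 0" by (auto intro!: prod_pos dest: prime_gt_0_nat)
    then show ?thesis
      using primorial_le[of n] by (subst ln_le_cancel_iff) (simp_all del: of_nat_prod of_nat_power add: )
  qed
  finally show ?thesis by (simp add: ln_realpow)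
qed

text \<open>The first term of Legendre's formula: each block of p consecutive factors ending at a
  multiple of p contributes one factor p.\<close>

lemma prime_power_dvd_fact:
  fixes p n :: nat
  assumes "p > 0" shows "p ^ (n div p) dvd fact n"
proof -
  have "p ^ k dvd fact (p * k)" for k
  proof (induction k)
    case (Suc k)
    have "fact (p * k) * (p * Suc k) dvd fact (p * Suc k)"
    proof -
      obtain r where r: "p * Suc k = Suc r" using assms by (metis Suc_pred nat_0_less_mult_iff zero_less_Suc)
      have "p * k \<le> r" using r assms by simp
      then have "fact (p*k) dvd (fact r :: nat)" by (rule fact_dvd)
      then have "fact (p * k) * Suc r dvd fact r * Suc r" by (rule mult_dvd_mono) simp
      then show ?thesis unfolding r by (simp add: mult.commute)
    qed
    moreover have "p ^ k * p dvd fact (p * k) * (p * Suc k)"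
      using Suc by (intro mult_dvd_mono) auto
    ultimately show ?case by (metis dvd_trans power_Suc2)
  qed simp
  from this[of "n div p"] show ?thesis
    by (meson dvd_trans fact_dvd times_div_less_eq_dividend)
qed

text \<open>The coprime powers \<open>p ^ (n div p)\<close> all divide n!, which is at most n^n;
  take logarithms. Replacing \<open>n div p\<close> by n / p costs at most ln p for each prime, and
  Chebyshev's bound controls the total.\<close>

lemma mertens_first_upper:
  assumes "n \<ge> (1::nat)"
  shows "(\<Sum>p | prime p \<and> p \<le> n. ln (real p) / real p) \<le> ln (real n) + ln 16"
proof -
  let ?P = "{p. prime p \<and> p \<le> n}"
  have fin: "finite ?P" by (rule finite_subset[of _ "{..n}"]) auto
  have "(\<Prod>p\<in>?P. p ^ (n div p)) dvd fact n"
    by (rule prod_coprime_dvd[OF fin]) (auto simp: primes_coprime prime_gt_0_nat intro: prime_power_dvd_fact)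
  then have "(\<Prod>p\<in>?P. p ^ (n div p)) \<le> fact n" by (rule dvd_imp_le) simp
  also have "\<dots> \<le> n ^ n" using fact_le_power[of n, where 'a = nat] by simp
  finally have "real (\<Prod>p\<in>?P. p ^ (n div p)) \<le> real (n ^ n)" by (simp only: of_nat_le_iff)
  moreover have "(\<Prod>p\<in>?P. p ^ (n div p)) > 0" by (intro prod_pos) (auto dest: prime_gt_0_nat)
  ultimately have "ln (real (\<Prod>p\<in>?P. p ^ (n div p))) \<le> ln (real (n ^ n))"
    using assms by (subst ln_le_cancel_iff) (simp_all del: of_nat_prod of_nat_power)
  also have "ln (real (\<Prod>p\<in>?P. p ^ (n div p))) = (\<Sum>p\<in>?P. real (n div p) * ln (real p))"
  proof -
    have "ln (real (\<Prod>p\<in>?P. p ^ (n div p))) = ln (\<Prod>p\<in>?P. real p ^ (n div p))" by simp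
    also have "\<dots> = (\<Sum>p\<in>?P. ln (real p ^ (n div p)))"
      using fin by (subst ln_prod) (auto dest: prime_gt_0_nat)
    also have "\<dots> = (\<Sum>p\<in>?P. real (n div p) * ln (real p))"
      by (intro sum.cong refl ln_realpow)
    finally show ?thesis .
  qed
  also have "ln (real (n ^ n)) = real n * ln (real n)"
    using assms by (simp add: ln_realpow)
  finally have 1: "(\<Sum>p\<in>?P. real (n div p) * ln (real p)) \<le> real n * ln (real n)" .
  have "real n * (\<Sum>p\<in>?P. ln (real p) / real p) = (\<Sum>p\<in>?P. (real n / real p) * ln (real p))"
    by (simp add: sum_distrib_left)
  also have "\<dots> \<le> (\<Sum>p\<in>?P. (real (n div p) + 1) * ln (real p))"
  proof (intro sum_mono mult_right_mono)
    fix p assume "p \<in> ?P"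
    then have "p > 0" by (auto dest: prime_gt_0_nat)
    then show "real n / real p \<le> real (n div p) + 1"
    proof -
      have "n < p * (n div p) + p" using \<open>p > 0\<close> dividend_less_times_div[of p n] by (simp add: mult.commute add.commute)
      then have "real n < real p * real (n div p) + real p" by (metis of_nat_add of_nat_less_iff of_nat_mult)
      then show ?thesis using \<open>p > 0\<close> by (simp add: field_simps)
    qed
    show "0 \<le> ln (real p)" using \<open>p > 0\<close> by simp
  qed
  also have "\<dots> = (\<Sum>p\<in>?P. real (n div p) * ln (real p)) + (\<Sum>p\<in>?P. ln (real p))"
    by (simp add: ring_distribs sum.distrib)
  also have "\<dots> \<le> real n * ln (real n) + real n * ln 16"
    using 1 sum_ln_prime_le[of n] by simp
  also have "\<dots> = real n * (ln (real n) + ln 16)" by (simp add: ring_distribs)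
  finally show ?thesis using assms by simp
qed

text \<open>Summation by parts carried out as an induction. With x = ln n and z = ln (n + 1), the
  step reduces to (S - C) (1/x - 1/z) <= ln z - ln x, which follows from S - C <= x and 1 - x/z <=
  ln (z/x). The last two terms on the right make the case n = 2 an equality.\<close>

lemma sum_weighted_div_ln_le:
  fixes a :: "nat \<Rightarrow> real"
  assumes "\<And>n. n \<ge> 1 \<Longrightarrow> sum a {1..n} \<le> ln (real n) + C" and "n \<ge> 2"
  shows "(\<Sum>m = 2..n. a m / ln (real m)) \<le>
    (sum a {1..n} - C) / ln (real n) + ln (ln (real n)) - (a 1 - C) / ln 2 - ln (ln 2)"
  using assms(2)
proof (induction n rule: dec_induct)
  case base
  have "{1..2::nat} = {1,2}" by auto
  then show ?case by (simp add: field_simps)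
next
  case (step n)
  define x z S where "x = ln (real n)" and "z = ln (real (Suc n))" and "S = sum a {1..n}"
  have x: "x > 0" and z: "z > x" unfolding x_def z_def using step by auto
  have S: "S - C \<le> x" using assms(1)[of n] step unfolding S_def x_def by simp
  have "(S - C) * (1 / x - 1 / z) \<le> x * (1 / x - 1 / z)"
    using S x z by (intro mult_right_mono) (auto simp: field_simps)
  also have "\<dots> = 1 - x / z" using x by (simp add: field_simps)
  also have "\<dots> \<le> ln (z / x)"
  proof -
    have "ln (x / z) \<le> x / z - 1" using x z by (intro ln_le_minus_one) auto
    moreover have "ln (x / z) = - ln (z / x)" using x z by (simp add: ln_div)
    ultimately show ?thesis by linarith
  qed
  also have "ln (z / x) = ln z - ln x" using x z by (simp add: ln_div)
  finally have *: "(S - C) / x - (S - C) / z \<le> ln z - ln x"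
    by (simp add: algebra_simps)
  have "(\<Sum>m = 2..Suc n. a m / ln (real m)) = (\<Sum>m = 2..n. a m / ln (real m)) + a (Suc n) / z"
    using step unfolding z_def by simp
  moreover have "sum a {1..Suc n} = S + a (Suc n)" unfolding S_def using step by simp
  ultimately show ?case
    using step.IH * unfolding x_def[symmetric] z_def[symmetric] S_def[symmetric]
    by (simp add: add_divide_distrib diff_divide_distrib)
qed

text \<open>Summation by parts turns the weights ln p / p of the first Mertens bound into 1 /
  p.\<close>

theorem mertens_second_upper:
  "\<exists>K\<ge>0. \<forall>y\<ge>2. (\<Sum>p | prime p \<and> real p \<le> y. 1 / real p) \<le> ln (ln y) + K"
proof -
  define a where "a = (\<lambda>n::nat. if prime n then ln (real n) / real n else 0)"
  define K where "K = 1 + ln 16 / ln 2 + \<bar>ln (ln (2::real))\<bar>"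
  have sa: "sum a {1..n} = (\<Sum>p | prime p \<and> p \<le> n. ln (real p) / real p)" for n
  proof -
    have "{p. prime p \<and> p \<le> n} = {p \<in> {1..n}. prime p}" by (auto dest: prime_ge_1_nat)
    then show ?thesis unfolding a_def by (simp add: sum.If_cases Int_def)
  qed
  have a1: "a 1 = 0" by (simp add: a_def)
  have "(\<Sum>p | prime p \<and> real p \<le> y. 1 / real p) \<le> ln (ln y) + K" if y: "y \<ge> 2" for y :: real
  proof -
    define n where "n = nat \<lfloor>y\<rfloor>"
    have n: "n \<ge> 2" "real n \<le> y" using y unfolding n_def by (auto simp: le_nat_floor)
    have le: "real p \<le> y \<longleftrightarrow> p \<le> n" for p
      using y unfolding n_def by (simp add: le_nat_floor nat_le_iff le_nat_iff le_floor_iff)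
    have "(\<Sum>p | prime p \<and> real p \<le> y. 1 / real p) = (\<Sum>p | prime p \<and> p \<le> n. 1 / real p)"
      unfolding le ..
    also have "\<dots> = (\<Sum>m = 2..n. a m / ln (real m))"
    proof -
      have "{p. prime p \<and> p \<le> n} = {p \<in> {2..n}. prime p}" by (auto dest: prime_ge_2_nat)
      then have "(\<Sum>p | prime p \<and> p \<le> n. 1 / real p) = (\<Sum>m = 2..n. if prime m then 1 / real m else 0)"
        by (simp add: sum.If_cases Int_def)
      also have "\<dots> = (\<Sum>m = 2..n. a m / ln (real m))"
        by (intro sum.cong refl) (auto simp: a_def)
      finally show ?thesis .
    qed
    also have "\<dots> \<le> (sum a {1..n} - ln 16) / ln (real n) + ln (ln (real n)) - (a 1 - ln 16) / ln 2 - ln (ln 2)"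
      by (rule sum_weighted_div_ln_le[OF _ n(1)]) (unfold sa, rule mertens_first_upper)
    also have "\<dots> \<le> ln (real n) / ln (real n) + ln (ln y) + ln 16 / ln 2 - ln (ln 2)"
    proof -
      have "(sum a {1..n} - ln 16) / ln (real n) \<le> ln (real n) / ln (real n)"
        using mertens_first_upper[of n] n by (intro divide_right_mono) (auto simp: sa simp del: One_nat_def)
      moreover have "ln (ln (real n)) \<le> ln (ln y)" using n by (subst ln_le_cancel_iff) auto
      ultimately show ?thesis using a1 by simp
    qed
    also have "\<dots> \<le> ln (ln y) + K" using n unfolding K_def by simp
    finally show ?thesis .
  qed
  moreover have "K \<ge> 0" unfolding K_def by simp
  ultimately show ?thesis by blast
qed

section \<open>Integers with prescribed prime factors and Euler products\<close>

definition smooth_over :: "nat set \<Rightarrow> nat set" where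
  "smooth_over P = {n. n > 0 \<and> (\<forall>p. prime p \<longrightarrow> p dvd n \<longrightarrow> p \<in> P)}"

lemma one_in_smooth_over [simp]: "Suc 0 \<in> smooth_over P"
  by (auto simp: smooth_over_def)

lemma smooth_over_mono: "P \<subseteq> Q \<Longrightarrow> smooth_over P \<subseteq> smooth_over Q"
  by (auto simp: smooth_over_def)

lemma smooth_over_dvd: "n \<in> smooth_over P \<Longrightarrow> d dvd n \<Longrightarrow> d \<in> smooth_over P"
  by (auto simp: smooth_over_def intro: dvd_trans dvd_pos_nat)

lemma smooth_over_empty: "n \<in> smooth_over {} \<Longrightarrow> n = 1"
  using prime_factor_nat by (auto simp: smooth_over_def)

lemma smooth_over_coprime:
  assumes "m \<in> smooth_over P" "n \<in> smooth_over Q" "P \<inter> Q = {}"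
  shows "coprime m n"
proof (rule ccontr)
  assume "\<not> coprime m n"
  then have "gcd m n \<noteq> 1" by (simp only: coprime_iff_gcd_eq_1 not_False_eq_True)
  then obtain p where "prime p" "p dvd gcd m n" using prime_factor_nat by blast
  then have "p \<in> P" "p \<in> Q" using assms(1,2) by (simp_all add: smooth_over_def)
  then show False using assms(3) by blast
qed

lemma smooth_over_split:
  assumes "n \<in> smooth_over (P \<union> Q)"
  obtains a b where "n = a * b" "a \<in> smooth_over P" "b \<in> smooth_over Q"
proof -
  have "n \<in> smooth_over (P \<union> Q) \<Longrightarrow> \<exists>a b. n = a * b \<and> a \<in> smooth_over P \<and> b \<in> smooth_over Q"
  proof (induction n rule: less_induct)
    case (less n)
    show ?case
    proof (cases "n = 1")
      case True
      then show ?thesis by (intro exI[of _ 1]) simp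
    next
      case False
      then obtain p where p: "prime p" "p dvd n" using prime_factor_nat by blast
      then obtain m where m: "n = p * m" by (auto elim: dvdE)
      have "n > 0" using less.prems by (simp add: smooth_over_def)
      then have "m < n" using m prime_gt_1_nat[OF p(1)] by simp
      moreover have "m \<in> smooth_over (P \<union> Q)" using less.prems m by (auto intro: smooth_over_dvd)
      ultimately obtain a b where ab: "m = a * b" "a \<in> smooth_over P" "b \<in> smooth_over Q"
        using less.IH by blast
      have pos: "p > 0" using p prime_gt_0_nat by blast
      have "p \<in> P \<or> p \<in> Q" using less.prems p by (auto simp: smooth_over_def)
      then show ?thesis
      proof
        assume "p \<in> P"
        then have "p * a \<in> smooth_over P" using ab(2) p(1) pos
          by (auto simp: smooth_over_def prime_dvd_mult_iff dest: primes_dvd_imp_eq)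
        then show ?thesis using ab m by (intro exI[of _ "p * a"] exI[of _ b]) simp
      next
        assume "p \<in> Q"
        then have "p * b \<in> smooth_over Q" using ab(3) p(1) pos
          by (auto simp: smooth_over_def prime_dvd_mult_iff dest: primes_dvd_imp_eq)
        then show ?thesis using ab m by (intro exI[of _ a] exI[of _ "p * b"]) simp
      qed
    qed
  qed
  then show ?thesis using assms that by blast
qed

lemma smooth_over_prime_power:
  assumes "prime p" "n \<in> smooth_over {p}"
  shows "\<exists>j. n = p ^ j"
proof -
  have "n > 0" using assms by (auto simp: smooth_over_def)
  then obtain m where m: "n = p ^ multiplicity p n * m" "\<not> p dvd m"
    using assms by (metis multiplicity_decompose' not_prime_unit not_gr_zero)
  have "m \<in> smooth_over {p}" using assms(2) m(1) by (metis dvd_triv_right smooth_over_dvd)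
  then have "m = 1"
    using m(2) prime_factor_nat[of m] unfolding smooth_over_def by blast
  then show ?thesis using m by auto
qed

text \<open>An Euler product bound for nonnegative submultiplicative g, stated for finite sums only:
  the local bound is assumed for every truncation J, so no question of convergence arises. Induction
  on P separates the power of one prime from the rest of n.\<close>

lemma sum_smooth_le_prod:
  fixes g :: "nat \<Rightarrow> real"
  assumes "finite P" "\<And>p. p \<in> P \<Longrightarrow> prime p"
    and nonneg: "\<And>n. g n \<ge> 0" and one: "g (Suc 0) \<le> 1"
    and mult: "\<And>m n. m > 0 \<Longrightarrow> n > 0 \<Longrightarrow> coprime m n \<Longrightarrow> g (m * n) \<le> g m * g n"
    and local: "\<And>p J. p \<in> P \<Longrightarrow> (\<Sum>j\<le>J. g (p ^ j)) \<le> c p"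
    and "finite A" "A \<subseteq> smooth_over P"
  shows "sum g A \<le> prod c P"
  using assms(1,2,6-)
proof (induction P arbitrary: A rule: finite_induct)
  case empty
  then have "A \<subseteq> {Suc 0}" using smooth_over_empty by fastforce
  then have "sum g A \<le> sum g {Suc 0}" by (intro sum_mono2) (auto simp: nonneg)
  then show ?case using one by simp
next
  case (insert p P)
  have p: "prime p" using insert by auto
  have "\<exists>j m. n = p ^ j * m \<and> m \<in> smooth_over P" if "n \<in> A" for n
  proof -
    have "n \<in> smooth_over ({p} \<union> P)" using that insert.prems(4) by auto
    then obtain a b where ab: "n = a * b" "a \<in> smooth_over {p}" "b \<in> smooth_over P"
      by (rule smooth_over_split)
    with smooth_over_prime_power[OF p ab(2)] show ?thesis by auto
  qed
  then obtain j m where jm: "\<And>n. n \<in> A \<Longrightarrow> n = p ^ j n * m n \<and> m n \<in> smooth_over P" by metis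
  define J where "J = Max (j ` A)"
  have J: "j n \<le> J" if "n \<in> A" for n unfolding J_def using that insert by (intro Max_ge) auto
  \<comment> \<open>The products of this rectangle cover A and may include more integers; since g is
    nonnegative, enlarging A is harmless and the sum factors.\<close>
  let ?B = "{..J} \<times> m ` A" and ?f = "\<lambda>(i,k). p ^ i * k"
  have "A \<subseteq> ?f ` ?B"
  proof
    fix n assume n: "n \<in> A"
    have "n = ?f (j n, m n)" using jm[OF n] by simp
    then show "n \<in> ?f ` ?B" using n J by blast
  qed
  then have "sum g A \<le> sum g (?f ` ?B)"
    using insert by (intro sum_mono2) (auto simp: nonneg)
  also have "\<dots> \<le> sum (g \<circ> ?f) ?B" using insert by (intro sum_image_le) (auto simp: nonneg)
  also have "\<dots> \<le> (\<Sum>(i,k)\<in>?B. g (p ^ i) * g k)"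
  proof (intro sum_mono, clarsimp)
    fix i n assume n: "n \<in> A"
    have m: "m n \<in> smooth_over P" using jm n by blast
    have "coprime (p ^ i) (m n)"
    proof -
      have "\<not> p dvd m n" using m \<open>p \<notin> P\<close> p by (auto simp: smooth_over_def)
      then show ?thesis using prime_imp_coprime[OF p] by simp
    qed
    then show "g (p ^ i * m n) \<le> g (p ^ i) * g (m n)"
      using m p by (intro mult) (auto simp: smooth_over_def prime_gt_0_nat)
  qed
  also have "\<dots> = (\<Sum>i\<le>J. g (p ^ i)) * sum g (m ` A)"
    by (simp add: sum_product sum.cartesian_product)
  also have "\<dots> \<le> c p * prod c P"
  proof (intro mult_mono)
    show "sum g (m ` A) \<le> prod c P"
    proof (rule insert.IH)
      show "m ` A \<subseteq> smooth_over P" using jm by blast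
      show "finite (m ` A)" using insert.prems(3) by simp
    qed (use insert.prems(1,2) in blast)+
    show "(\<Sum>i\<le>J. g (p ^ i)) \<le> c p" by (rule insert.prems(2)) simp
    have "0 \<le> (\<Sum>i\<le>0. g (p ^ i))" by (simp add: nonneg)
    also have "\<dots> \<le> c p" by (rule insert.prems(2)) simp
    finally show "0 \<le> c p" .
  qed (auto intro: sum_nonneg nonneg)
  finally show ?case using insert.hyps by simp
qed

lemma sum_power_le:
  fixes x :: real
  assumes "0 \<le> x" "x < 1" shows "(\<Sum>j\<le>J. x ^ j) \<le> 1 / (1 - x)"
proof -
  have "(\<Sum>j\<le>J. x ^ j) = (1 - x ^ Suc J) / (1 - x)"
    using assms by (simp add: sum_gp0)
  also have "\<dots> \<le> 1 / (1 - x)" using assms by (intro divide_right_mono) auto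
  finally show ?thesis .
qed

lemma sum_smooth_inverse_le:
  assumes "finite P" "\<And>p. p \<in> P \<Longrightarrow> prime p" "finite A" "A \<subseteq> smooth_over P"
  shows "(\<Sum>n\<in>A. 1 / real n) \<le> (\<Prod>p\<in>P. 1 / (1 - 1 / real p))"
proof (rule sum_smooth_le_prod[OF assms(1,2) _ _ _ _ assms(3,4)])
  fix p J assume "p \<in> P"
  then have "real p > 1" using assms(2) prime_gt_1_nat by simp
  then show "(\<Sum>j\<le>J. 1 / real (p ^ j)) \<le> 1 / (1 - 1 / real p)"
    using sum_power_le[of "1 / real p" J] by (simp add: power_one_over)
qed auto

text \<open>Every integer up to z has only prime factors up to z, so the Euler product over those
  primes is at least a harmonic sum, hence at least ln z.\<close>

lemma prod_one_minus_inverse_prime_le: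
  assumes "z > 1"
  shows "(\<Prod>p | prime p \<and> real p \<le> z. 1 - 1 / real p) \<le> 1 / ln z"
proof -
  let ?P = "{p::nat. prime p \<and> real p \<le> z}"
  define n where "n = nat \<lfloor>z\<rfloor>"
  have n: "real n \<le> z" "z \<le> real n + 1" using assms unfolding n_def by linarith+
  have "ln z \<le> ln (real n + 1)" using assms n by simp
  also have "\<dots> \<le> harm n" by (rule harm_ge_ln)
  also have "\<dots> = (\<Sum>k\<in>{1..n}. 1 / real k)" by (simp add: harm_def inverse_eq_divide)
  also have "\<dots> \<le> (\<Prod>p\<in>?P. 1 / (1 - 1 / real p))"
  proof (rule sum_smooth_inverse_le)
    show "{1..n} \<subseteq> smooth_over ?P"
    proof
      fix k assume k: "k \<in> {1..n}"
      have "real p \<le> z" if "p dvd k" for p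
      proof -
        have "p \<le> n" using k that dvd_imp_le[of p k] by auto
        then show ?thesis using n by linarith
      qed
      then show "k \<in> smooth_over ?P" using k by (auto simp: smooth_over_def)
    qed
  qed (auto simp: finite_primes_le)
  also have "\<dots> = 1 / (\<Prod>p\<in>?P. 1 - 1 / real p)" by (simp add: prod_dividef)
  finally have *: "ln z \<le> 1 / (\<Prod>p\<in>?P. 1 - 1 / real p)" .
  have "(\<Prod>p\<in>?P. 1 - 1 / real p) > 0" by (intro prod_pos) (auto dest: prime_gt_1_nat)
  with * assms show ?thesis by (simp add: field_simps)
qed

section \<open>Sieving by the small primes\<close>

text \<open>With r in 1..u, each of the T = floor (Y / u) complete blocks of length u contains
  exactly one element, and the incomplete block at the end adds at most one.\<close>

lemma card_arith_progression_bounds: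
  fixes u r :: nat and Y :: real
  assumes "u > 0" "1 \<le> r" "r \<le> u" "Y \<ge> 0"
  shows "\<bar>real (card {e. 0 < e \<and> real e \<le> Y \<and> [e = r] (mod u)}) - Y / real u\<bar> \<le> 1"
proof -
  define T where "T = nat \<lfloor>Y / real u\<rfloor>"
  have T: "real T \<le> Y / real u" "Y / real u < real T + 1"
    using assms unfolding T_def by (auto simp: of_nat_nat intro: floor_correct)
  let ?E = "{e. 0 < e \<and> real e \<le> Y \<and> [e = r] (mod u)}" and ?f = "\<lambda>t. r + u * t"
  have inj: "inj_on ?f A" for A using assms by (auto simp: inj_on_def)
  have "?E \<subseteq> {..nat \<lfloor>Y\<rfloor>}" by (auto simp: le_nat_floor)
  then have fin: "finite ?E" by (rule finite_subset) simp
  have "?f ` {..<T} \<subseteq> ?E"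
  proof (rule image_subsetI)
    fix t assume "t \<in> {..<T}"
    then have "t + 1 \<le> T" by simp
    then have "u * (t + 1) \<le> u * T" by (rule mult_le_mono2)
    then have "r + u * t \<le> u * T" using assms by simp
    then have "real (r + u * t) \<le> real (u * T)" by (simp only: of_nat_le_iff)
    also have "\<dots> \<le> Y" using T assms by (simp add: field_simps)
    finally show "r + u * t \<in> ?E"
      using assms by (simp add: unique_euclidean_semiring_class.cong_def)
  qed
  then have "card (?f ` {..<T}) \<le> card ?E" by (rule card_mono[OF fin])
  then have lo: "T \<le> card ?E" by (simp add: card_image[OF inj])
  have "?E \<subseteq> ?f ` {..T}"
  proof
    fix e assume "e \<in> ?E"
    then have e: "0 < e" "real e \<le> Y" "[e = r] (mod u)" by auto
    have "r \<le> e"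
    proof (rule ccontr)
      assume "\<not> r \<le> e"
      then have "u dvd r - e" using e(3) cong_altdef_nat[of e r u] by (metis cong_sym cong_altdef_nat nat_le_linear)
      then show False using \<open>\<not> r \<le> e\<close> e(1) assms by (auto dest: dvd_imp_le)
    qed
    then have "u dvd e - r" using e(3) by (simp add: cong_altdef_nat)
    then obtain t where t: "e - r = u * t" by (auto elim: dvdE)
    then have et: "e = r + u * t" using \<open>r \<le> e\<close> by simp
    then have "real u * real t \<le> Y" using e(2) by simp
    then have "real t \<le> Y / real u" using assms by (simp add: field_simps)
    then have "t \<le> T" using T by linarith
    then show "e \<in> ?f ` {..T}" using et by blast
  qed
  then have "card ?E \<le> card (?f ` {..T})" by (intro card_mono) auto
  also have "\<dots> = T + 1" by (simp add: card_image[OF inj])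
  finally show ?thesis using lo T by linarith
qed

text \<open>The class is written as e c = 1 because the Chinese remainder theorem singles out
  integers with a given inverse modulo u. Substituting e = D e' leaves an ordinary progression
  modulo u up to Y / D.\<close>

lemma card_inverse_class_bounds:
  fixes u D :: nat and c :: int and Y :: real
  assumes u: "u > 0" and c: "coprime c (int u)" and D: "D > 0" "coprime D u" and Y: "Y \<ge> 0"
  shows "\<bar>real (card {e. 0 < e \<and> real e \<le> Y \<and> D dvd e \<and> [int e * c = 1] (mod int u)}) - Y / (real u * real D)\<bar> \<le> 1"
proof -
  have cD: "coprime (c * int D) (int u)" using c D by simp
  then obtain x where x: "[c * int D * x = 1] (mod int u)"
    using cong_solve_coprime_int[of "c * int D" "int u"] by blast
  \<comment> \<open>The representative is taken in 1..u rather than 0..u-1, matching the range over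
    which the progression is counted.\<close>
  define r where "r = (if x mod int u = 0 then u else nat (x mod int u))"
  have r: "1 \<le> r" "r \<le> u" "[int r = x] (mod int u)"
  proof -
    have *: "0 \<le> x mod int u" "x mod int u < int u" using u by auto
    show "1 \<le> r"
    proof (cases "x mod int u = 0")
      case False
      then have "1 \<le> x mod int u" using * by linarith
      then show ?thesis unfolding r_def by simp
    qed (use u in \<open>simp add: r_def\<close>)
    have "nat (x mod int u) \<le> u" using *(2) by linarith
    then show "r \<le> u" unfolding r_def by simp
    show "[int r = x] (mod int u)"
      using * unfolding r_def by (auto simp: unique_euclidean_semiring_class.cong_def)
  qed
  have iff: "[int (D * e) * c = 1] (mod int u) \<longleftrightarrow> [e = r] (mod u)" for e
  proof -
    have "[c * int D * int r = 1] (mod int u)" using x r(3) by (meson cong_scalar_left cong_trans)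
    then have "[int (D * e) * c = 1] (mod int u) \<longleftrightarrow> [c * int D * int e = c * int D * int r] (mod int u)"
      by (auto simp: mult_ac intro: cong_trans cong_sym)
    also have "\<dots> \<longleftrightarrow> [int e = int r] (mod int u)" using cD by (rule cong_mult_lcancel)
    also have "\<dots> \<longleftrightarrow> [e = r] (mod u)" by (rule cong_int_iff)
    finally show ?thesis .
  qed
  have "{e. 0 < e \<and> real e \<le> Y \<and> D dvd e \<and> [int e * c = 1] (mod int u)}
      = (\<lambda>e. D * e) ` {e. 0 < e \<and> real e \<le> Y / real D \<and> [e = r] (mod u)}"
  proof (intro equalityI subsetI)
    fix e assume e: "e \<in> {e. 0 < e \<and> real e \<le> Y \<and> D dvd e \<and> [int e * c = 1] (mod int u)}"
    then obtain e' where e': "e = D * e'" by (auto elim: dvdE)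
    then have "real e' \<le> Y / real D" using e D by (simp add: field_simps)
    moreover have "e' > 0" using e e' by simp
    moreover have "[e' = r] (mod u)" using e iff e' by blast
    ultimately show "e \<in> (\<lambda>e. D * e) ` {e. 0 < e \<and> real e \<le> Y / real D \<and> [e = r] (mod u)}"
      using e' by blast
  next
    fix e assume "e \<in> (\<lambda>e. D * e) ` {e. 0 < e \<and> real e \<le> Y / real D \<and> [e = r] (mod u)}"
    then obtain e' where e': "e = D * e'" "0 < e'" "real e' \<le> Y / real D" "[e' = r] (mod u)" by blast
    then show "e \<in> {e. 0 < e \<and> real e \<le> Y \<and> D dvd e \<and> [int e * c = 1] (mod int u)}"
      using D iff[of e'] by (auto simp: field_simps)
  qed
  then have "card {e. 0 < e \<and> real e \<le> Y \<and> D dvd e \<and> [int e * c = 1] (mod int u)}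
      = card {e. 0 < e \<and> real e \<le> Y / real D \<and> [e = r] (mod u)}"
    using D by (simp add: card_image inj_on_def)
  moreover have "Y / real D \<ge> 0" using Y by simp
  ultimately show ?thesis
    using card_arith_progression_bounds[OF u r(1,2), of "Y / real D"] by (simp add: mult.commute)
qed

section \<open>Brun's pure sieve\<close>

lemma alternating_binomial_partial_sum:
  "(\<Sum>k\<le>r. (-1) ^ k * real (Suc n choose k)) = (-1) ^ r * real (n choose r)"
  by (induction r) (auto simp: algebra_simps)

text \<open>For nonempty T the truncated alternating sum collapses to the binomial coefficient (card
  T - 1 choose r) with sign (-1)^r, which is nonnegative for even r.\<close>

lemma bonferroni_even:
  assumes "finite T" "even r"
  shows "(if T = {} then 1 else 0 :: real) \<le> (\<Sum>D | D \<subseteq> T \<and> card D \<le> r. (-1) ^ card D)"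
proof (cases "T = {}")
  case True
  then have "{D. D \<subseteq> T \<and> card D \<le> r} = {{}}" by auto
  then show ?thesis using True by simp
next
  case False
  then obtain n where n: "card T = Suc n" using assms(1) by (metis card_eq_0_iff not0_implies_Suc)
  have fin: "finite {D. D \<subseteq> T \<and> card D \<le> r}"
    using assms(1) by (auto intro: finite_subset[of _ "Pow T"])
  have "(\<Sum>D | D \<subseteq> T \<and> card D \<le> r. (-1::real) ^ card D)
      = (\<Sum>k\<le>r. \<Sum>D | D \<in> {D. D \<subseteq> T \<and> card D \<le> r} \<and> card D = k. (-1) ^ card D)"
    by (rule sum.group[symmetric]) (use fin in auto)
  also have "\<dots> = (\<Sum>k\<le>r. (-1) ^ k * real (card T choose k))"
  proof (rule sum.cong[OF refl])
    fix k assume "k \<in> {..r}"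
    then have "{D. D \<in> {D. D \<subseteq> T \<and> card D \<le> r} \<and> card D = k} = {D. D \<subseteq> T \<and> card D = k}" by auto
    then show "(\<Sum>D | D \<in> {D. D \<subseteq> T \<and> card D \<le> r} \<and> card D = k. (-1) ^ card D) = (-1) ^ k * real (card T choose k)"
      using n_subsets[OF assms(1), of k] by simp
  qed
  also have "\<dots> = (-1) ^ r * real (n choose r)" unfolding n by (rule alternating_binomial_partial_sum)
  finally show ?thesis using False assms(2) by simp
qed

lemma prod_one_plus_eq_sum_Pow:
  fixes g :: "'a \<Rightarrow> real"
  assumes "finite P"
  shows "(\<Prod>p\<in>P. 1 + g p) = (\<Sum>D\<in>Pow P. prod g D)"
  using prod_add[OF assms, of g "\<lambda>_. 1"] by (simp add: add.commute)

text \<open>The condition that no prime of P divides e is majorized by the truncated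
  inclusion-exclusion sum over the set of primes of P dividing e. After exchanging the sums, each D
  counts multiples of its product in a residue class, with an error of at most 1; the last term of
  the bound adds up these errors.\<close>

lemma brun_pure_sieve:
  fixes u :: nat and c :: int and Y :: real
  assumes P: "finite P" "\<And>p. p \<in> P \<Longrightarrow> prime p" "\<And>p. p \<in> P \<Longrightarrow> \<not> p dvd u"
    and u: "u > 0" and c: "coprime c (int u)" and Y: "Y \<ge> 0" and r: "even r"
  shows "real (card {e. 0 < e \<and> real e \<le> Y \<and> [int e * c = 1] (mod int u) \<and> (\<forall>p\<in>P. \<not> p dvd e)})
    \<le> Y / real u * (\<Sum>D | D \<subseteq> P \<and> card D \<le> r. (-1) ^ card D / real (\<Prod>D)) + real (card {D. D \<subseteq> P \<and> card D \<le> r})"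
proof -
  define E where "E = {e. 0 < e \<and> real e \<le> Y \<and> [int e * c = 1] (mod int u)}"
  define \<D> where "\<D> = {D. D \<subseteq> P \<and> card D \<le> r}"
  have "E \<subseteq> {..nat \<lfloor>Y\<rfloor>}" unfolding E_def by (auto simp: le_nat_floor)
  then have finE: "finite E" by (rule finite_subset) simp
  have finD: "finite \<D>" unfolding \<D>_def using P(1) by (auto intro: finite_subset[of _ "Pow P"])
  have dvd: "\<Prod>D dvd e \<longleftrightarrow> D \<subseteq> {p \<in> P. p dvd e}" if "D \<in> \<D>" for D e
  proof
    have fD: "finite D" and DP: "D \<subseteq> P" using that P(1) unfolding \<D>_def by (auto intro: finite_subset)
    show "D \<subseteq> {p \<in> P. p dvd e}" if "\<Prod>D dvd e"
      using that fD DP dvd_prodI[OF fD, of _ id] by (auto intro: dvd_trans)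
    show "\<Prod>D dvd e" if "D \<subseteq> {p \<in> P. p dvd e}"
      using prod_coprime_dvd[OF fD, of id e] that P(2) DP by (auto simp: primes_coprime subset_iff)
  qed
  have "real (card {e. 0 < e \<and> real e \<le> Y \<and> [int e * c = 1] (mod int u) \<and> (\<forall>p\<in>P. \<not> p dvd e)})
      = (\<Sum>e\<in>E. if {p \<in> P. p dvd e} = {} then 1 else 0)"
  proof -
    have "{e. 0 < e \<and> real e \<le> Y \<and> [int e * c = 1] (mod int u) \<and> (\<forall>p\<in>P. \<not> p dvd e)}
        = {e \<in> E. {p \<in> P. p dvd e} = {}}" unfolding E_def by auto
    then show ?thesis using finE by (simp add: sum.If_cases Int_def)
  qed
  also have "\<dots> \<le> (\<Sum>e\<in>E. \<Sum>D | D \<subseteq> {p \<in> P. p dvd e} \<and> card D \<le> r. (-1) ^ card D)"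
    using P(1) r by (intro sum_mono bonferroni_even) auto
  also have "\<dots> = (\<Sum>e\<in>E. \<Sum>D\<in>\<D>. if \<Prod>D dvd e then (-1) ^ card D else 0)"
  proof (rule sum.cong[OF refl])
    fix e
    have "{D. D \<subseteq> {p \<in> P. p dvd e} \<and> card D \<le> r} = {D \<in> \<D>. \<Prod>D dvd e}"
      using dvd unfolding \<D>_def by blast
    then show "(\<Sum>D | D \<subseteq> {p \<in> P. p dvd e} \<and> card D \<le> r. (-1::real) ^ card D)
       = (\<Sum>D\<in>\<D>. if \<Prod>D dvd e then (-1) ^ card D else 0)"
      using finD by (simp add: sum.If_cases Int_def)
  qed
  also have "\<dots> = (\<Sum>D\<in>\<D>. (-1) ^ card D * real (card {e \<in> E. \<Prod>D dvd e}))"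
    using finE by (subst sum.swap) (simp add: sum.If_cases Int_def mult.commute)
  also have "\<dots> \<le> (\<Sum>D\<in>\<D>. (-1) ^ card D * (Y / (real u * real (\<Prod>D))) + 1)"
  proof (rule sum_mono)
    fix D assume D: "D \<in> \<D>"
    then have "D \<subseteq> P" unfolding \<D>_def by auto
    then have pr: "\<And>p. p \<in> D \<Longrightarrow> prime p \<and> coprime p u" using P prime_imp_coprime by (metis subsetD)
    have "\<Prod>D > 0" using pr by (auto intro!: prod_pos simp: prime_gt_0_nat)
    moreover have "coprime (\<Prod>D) u" using pr by (intro prod_coprime_left) auto
    ultimately have "\<bar>real (card {e. 0 < e \<and> real e \<le> Y \<and> \<Prod>D dvd e \<and> [int e * c = 1] (mod int u)}) - Y / (real u * real (\<Prod>D))\<bar> \<le> 1"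
      by (intro card_inverse_class_bounds u c Y)
    moreover have "{e \<in> E. \<Prod>D dvd e} = {e. 0 < e \<and> real e \<le> Y \<and> \<Prod>D dvd e \<and> [int e * c = 1] (mod int u)}"
      unfolding E_def by auto
    ultimately have "\<bar>real (card {e \<in> E. \<Prod>D dvd e}) - Y / (real u * real (\<Prod>D))\<bar> \<le> 1" by simp
    then show "(-1) ^ card D * real (card {e \<in> E. \<Prod>D dvd e}) \<le> (-1) ^ card D * (Y / (real u * real (\<Prod>D))) + 1"
      by (cases "even (card D)") (simp_all only: power_minus_even power_minus_odd abs_le_iff, auto)
  qed
  also have "\<dots> = Y / real u * (\<Sum>D\<in>\<D>. (-1) ^ card D / real (\<Prod>D)) + real (card \<D>)"
    by (simp add: sum.distrib sum_distrib_left mult_ac del: of_nat_prod)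
  finally show ?thesis unfolding \<D>_def .
qed

text \<open>The complete sum over all subsets is the Euler product. In the omitted tail card D > r,
  so each term may be multiplied by exp (card D - r) >= 1; the tail is then dominated by another
  complete product.\<close>

lemma truncated_moebius_sum_le:
  assumes P: "finite P" "\<And>p. p \<in> P \<Longrightarrow> prime p"
  shows "(\<Sum>D | D \<subseteq> P \<and> card D \<le> r. (-1) ^ card D / real (\<Prod>D))
    \<le> (\<Prod>p\<in>P. 1 - 1 / real p) + exp (- real r) * (\<Prod>p\<in>P. 1 + exp 1 / real p)"
proof -
  let ?A = "{D. D \<subseteq> P \<and> card D \<le> r}" and ?B = "{D. D \<subseteq> P \<and> \<not> card D \<le> r}"
  have fin: "finite (Pow P)" using P by simp
  have un: "Pow P = ?A \<union> ?B" by auto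
  have "(\<Prod>p\<in>P. 1 - 1 / real p) = (\<Sum>D\<in>Pow P. \<Prod>p\<in>D. - (1 / real p))"
    using prod_one_plus_eq_sum_Pow[OF P(1), of "\<lambda>p. - (1 / real p)"] by simp
  also have "\<dots> = (\<Sum>D\<in>Pow P. (-1) ^ card D / real (\<Prod>D))"
    by (intro sum.cong refl) (simp add: prod_uminus prod_dividef power_divide flip: prod_inversef)
  also have "\<dots> = (\<Sum>D\<in>?A. (-1) ^ card D / real (\<Prod>D)) + (\<Sum>D\<in>?B. (-1) ^ card D / real (\<Prod>D))"
    unfolding un by (rule sum.union_disjoint) (use P in auto)
  finally have "(\<Sum>D\<in>?A. (-1) ^ card D / real (\<Prod>D)) = (\<Prod>p\<in>P. 1 - 1 / real p) + (\<Sum>D\<in>?B. - ((-1) ^ card D / real (\<Prod>D)))"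
    by (simp add: sum_negf)
  also have "(\<Sum>D\<in>?B. - ((-1) ^ card D / real (\<Prod>D))) \<le> (\<Sum>D\<in>?B. exp (- real r) * (\<Prod>p\<in>D. exp 1 / real p))"
  proof (rule sum_mono)
    fix D assume D: "D \<in> ?B"
    have "- ((-1) ^ card D / real (\<Prod>D)) \<le> \<bar>(-1) ^ card D / real (\<Prod>D)\<bar>" by linarith
    also have "\<dots> = 1 / real (\<Prod>D)" by (simp add: abs_divide power_abs del: of_nat_prod)
    also have "\<dots> \<le> exp (real (card D) - real r) / real (\<Prod>D)"
      using D by (intro divide_right_mono) (auto simp del: of_nat_prod)
    also have "\<dots> = exp (- real r) * (\<Prod>p\<in>D. exp 1 / real p)"
      by (simp add: prod_dividef exp_diff exp_minus field_simps flip: exp_of_nat_mult)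
    finally show "- ((-1) ^ card D / real (\<Prod>D)) \<le> exp (- real r) * (\<Prod>p\<in>D. exp 1 / real p)" .
  qed
  also have "\<dots> \<le> (\<Sum>D\<in>Pow P. exp (- real r) * (\<Prod>p\<in>D. exp 1 / real p))"
    using fin by (intro sum_mono2) (auto intro!: mult_nonneg_nonneg prod_nonneg)
  also have "\<dots> = exp (- real r) * (\<Prod>p\<in>P. 1 + exp 1 / real p)"
    using prod_one_plus_eq_sum_Pow[OF P(1), of "\<lambda>p. exp 1 / real p"] by (simp add: sum_distrib_left)
  finally show ?thesis by simp
qed

text \<open>Each counted set has weight M^(r - card D) >= 1. Summing this weight over all subsets
  gives M^r (1 + 1/M)^(card P), and the last factor is at most e.\<close>

lemma card_small_subsets_le:
  assumes "finite P" "real (card P) \<le> M" "M \<ge> 1"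
  shows "real (card {D. D \<subseteq> P \<and> card D \<le> r}) \<le> exp 1 * M ^ r"
proof -
  have fin: "finite (Pow P)" using assms by simp
  have "real (card {D. D \<subseteq> P \<and> card D \<le> r}) = (\<Sum>D | D \<subseteq> P \<and> card D \<le> r. 1)" by simp
  also have "\<dots> \<le> (\<Sum>D | D \<subseteq> P \<and> card D \<le> r. M ^ r * (\<Prod>p\<in>D. 1 / M))"
  proof (rule sum_mono)
    fix D assume "D \<in> {D. D \<subseteq> P \<and> card D \<le> r}"
    then have "M ^ card D \<le> M ^ r" using assms by (intro power_increasing) auto
    then show "1 \<le> M ^ r * (\<Prod>p\<in>D. 1 / M)" using assms by (simp add: field_simps)
  qed
  also have "\<dots> \<le> (\<Sum>D\<in>Pow P. M ^ r * (\<Prod>p\<in>D. 1 / M))"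
    using fin assms by (intro sum_mono2) auto
  also have "\<dots> = M ^ r * (1 + 1 / M) ^ card P"
    using prod_one_plus_eq_sum_Pow[OF assms(1), of "\<lambda>_. 1 / M"] by (simp add: sum_distrib_left)
  also have "(1 + 1 / M) ^ card P \<le> exp (1 / M) ^ card P"
    using assms by (intro power_mono) auto
  also have "\<dots> = exp (real (card P) / M)" by (simp flip: exp_of_nat_mult)
  also have "\<dots> \<le> exp 1" using assms by simp
  finally show ?thesis using assms by (simp add: mult.commute mult_left_mono)
qed

text \<open>For u > 0 this is u / phi(u). Primes dividing u cannot be used for sieving inside a
  residue class modulo u, and this factor measures the loss.\<close>

definition euler_weight :: "nat \<Rightarrow> real" where
  "euler_weight u = (\<Prod>p\<in>prime_factors u. 1 / (1 - 1 / real p))"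

lemma inverse_one_minus_prime_ge_1:
  assumes "prime (p::nat)" shows "1 / (1 - 1 / real p) \<ge> 1"
  using prime_gt_1_nat[OF assms] by (simp add: field_simps)

lemma euler_weight_ge_1: "euler_weight u \<ge> 1"
  unfolding euler_weight_def by (intro prod_ge_1 inverse_one_minus_prime_ge_1) auto

lemma prod_one_minus_inverse_prime_coprime_le:
  assumes "z > 1" "u > 0"
  shows "(\<Prod>p | prime p \<and> real p \<le> z \<and> \<not> p dvd u. 1 - 1 / real p) \<le> euler_weight u / ln z"
proof -
  let ?A = "{p. prime p \<and> real p \<le> z \<and> \<not> p dvd u}" and ?B = "{p. prime p \<and> real p \<le> z \<and> p dvd u}"
  have fin: "finite ?A" "finite ?B" by (auto intro: finite_subset[OF _ finite_primes_le[of z]])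
  have "{p. prime p \<and> real p \<le> z} = ?A \<union> ?B" by auto
  then have "(\<Prod>p | prime p \<and> real p \<le> z. 1 - 1 / real p) = (\<Prod>p\<in>?A. 1 - 1 / real p) * (\<Prod>p\<in>?B. 1 - 1 / real p)"
    using fin by (simp add: prod.union_disjoint disjoint_iff)
  moreover have pos: "(\<Prod>p\<in>?B. 1 - 1 / real p) > 0"
    by (intro prod_pos) (auto dest: prime_gt_1_nat)
  ultimately have "(\<Prod>p\<in>?A. 1 - 1 / real p) = (\<Prod>p | prime p \<and> real p \<le> z. 1 - 1 / real p) * (\<Prod>p\<in>?B. 1 / (1 - 1 / real p))"
    by (simp add: prod_dividef)
  also have "\<dots> \<le> (1 / ln z) * euler_weight u"
  proof (intro mult_mono)
    show "(\<Prod>p\<in>?B. 1 / (1 - 1 / real p)) \<le> euler_weight u"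
      unfolding euler_weight_def
    proof (rule prod_mono2)
      show "?B \<subseteq> prime_factors u" using assms by (auto simp: prime_factors_dvd)
    qed (simp_all only: mem_Collect_eq Diff_iff in_prime_factors_iff inverse_one_minus_prime_ge_1
      order_trans[OF zero_le_one inverse_one_minus_prime_ge_1] finite_set_mset)
    show "0 \<le> (\<Prod>p\<in>?B. 1 / (1 - 1 / real p))"
      by (intro prod_nonneg) (simp only: mem_Collect_eq order_trans[OF zero_le_one inverse_one_minus_prime_ge_1])
  qed (use assms prod_one_minus_inverse_prime_le[of z] in auto)
  finally show ?thesis by simp
qed

lemma prod_le_exp_sum:
  fixes g :: "'a \<Rightarrow> real"
  assumes "\<And>p. p \<in> P \<Longrightarrow> g p \<ge> 0"
  shows "(\<Prod>p\<in>P. 1 + g p) \<le> exp (sum g P)"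
proof (cases "finite P")
  case True
  have "(\<Prod>p\<in>P. 1 + g p) \<le> (\<Prod>p\<in>P. exp (g p))"
    using assms by (intro prod_mono) (auto intro: add_nonneg_nonneg)
  then show ?thesis using True by (simp add: exp_sum)
qed simp

text \<open>With \<open>L = ln y\<close>, the sieving limit is \<open>z = y powr (1 / (192 ln L))\<close>.  It is small enough
  for the truncation at \<open>4 ln L\<close> prime factors to leave an error term \<open>z ^ r \<le> y powr (1/32)\<close>.\<close>

lemma card_rough_inverse_class_le:
  "\<exists>K>0. \<forall>L u c Y. ln L \<ge> 1 \<longrightarrow> L \<le> exp (L / 5) \<longrightarrow> L / (192 * ln L) \<ge> 1 \<longrightarrow> u > 0 \<longrightarrow> Y / real u \<ge> exp (L / 4) \<longrightarrow>
     real (card {e. 0 < e \<and> real e \<le> Y \<and> [int e * c = 1] (mod int u) \<and>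
        (\<forall>p. prime p \<longrightarrow> real p \<le> exp (L / (192 * ln L)) \<longrightarrow> \<not> p dvd e)})
      \<le> K * (Y / real u) * euler_weight u * (ln L / L)"
proof -
  obtain K0 where K0: "K0 \<ge> 0" "\<And>y. y \<ge> 2 \<Longrightarrow> (\<Sum>p | prime p \<and> real p \<le> y. 1 / real p) \<le> ln (ln y) + K0"
    using mertens_second_upper by blast
  have "real (card {e. 0 < e \<and> real e \<le> Y \<and> [int e * c = 1] (mod int u) \<and>
        (\<forall>p. prime p \<longrightarrow> real p \<le> exp (L / (192 * ln L)) \<longrightarrow> \<not> p dvd e)})
      \<le> (192 + exp (3 * K0) + exp 1) * (Y / real u) * euler_weight u * (ln L / L)"
    if L: "ln L \<ge> 1" "L \<le> exp (L / 5)" "L / (192 * ln L) \<ge> 1" and u: "u > 0" and Yu: "Y / real u \<ge> exp (L / 4)"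
    for L Y :: real and u :: nat and c :: int
  proof -
    define z where "z = exp (L / (192 * ln L))"
    define P where "P = {p. prime p \<and> real p \<le> z \<and> \<not> p dvd u}"
    \<comment> \<open>An even number between 4 ln L and 6 ln L. The lower bound makes the truncation
      error O(1 / L), the upper bound keeps z^r below exp (L / 32).\<close>
    define r where "r = 2 * nat \<lceil>2 * ln L\<rceil>"
    let ?S = "{e. 0 < e \<and> real e \<le> Y \<and> [int e * c = 1] (mod int u) \<and> (\<forall>p. prime p \<longrightarrow> real p \<le> z \<longrightarrow> \<not> p dvd e)}"
    let ?S' = "{e. 0 < e \<and> real e \<le> Y \<and> [int e * c = 1] (mod int u) \<and> (\<forall>p\<in>P. \<not> p dvd e)}"
    have Lpos: "L > 0"
    proof -
      have "0 < L / (192 * ln L)" "0 < 192 * ln L" using L by linarith+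
      then show ?thesis by (simp only: zero_less_divide_iff) linarith
    qed
    have L1: "L > 1" "L \<ge> 1" using ln_le_minus_one[OF Lpos] L(1) by linarith+
    have z: "z \<ge> exp 1" "ln z = L / (192 * ln L)" using L unfolding z_def by auto
    have z2: "z \<ge> 2" using z(1) exp_ge_add_one_self[of 1] by linarith
    have lnz: "1 \<le> ln z" "ln z \<le> L"
    proof -
      show "1 \<le> ln z" using z L by simp
      have "L / (192 * ln L) \<le> L / 1" using L Lpos L1 by (intro divide_left_mono) auto
      then show "ln z \<le> L" using z by simp
    qed
    have Ypos: "Y \<ge> 0"
    proof -
      have "Y / real u > 0" using Yu exp_gt_zero less_le_trans by blast
      then show ?thesis using u by (simp add: zero_less_divide_iff)
    qed
    have finP: "finite P" unfolding P_def by (auto intro: finite_subset[OF _ finite_primes_le[of z]])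
    have w: "euler_weight u \<ge> 1" by (rule euler_weight_ge_1)
    show ?thesis
    proof (cases "coprime c (int u)")
      \<comment> \<open>If e c = 1 modulo u has a solution, then c is coprime to u; otherwise
        nothing is counted.\<close>
      case False
      have "?S = {}"
      proof -
        have "coprime c (int u)" if "[int e * c = 1] (mod int u)" for e
          using that by (metis coprime_iff_invertible_int mult.commute)
        then show ?thesis using False by auto
      qed
      then have "card ?S = 0" by (simp only: card.empty)
      then show ?thesis unfolding z_def[symmetric]
        using Ypos w L Lpos L1 by (simp only:) (auto intro!: mult_nonneg_nonneg add_nonneg_nonneg divide_nonneg_nonneg)
    next
      case c: True
      have r: "even r" "real r \<ge> 4 * ln L" "real r \<le> 6 * ln L"
        using L unfolding r_def by (auto; linarith)+
      have "?S' \<subseteq> {..nat \<lfloor>Y\<rfloor>}" by (auto simp: le_nat_floor)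
      then have "finite ?S'" by (rule finite_subset) simp
      moreover have "?S \<subseteq> ?S'" unfolding P_def by auto
      ultimately have "real (card ?S) \<le> real (card ?S')" by (simp add: card_mono)
      also have "\<dots> \<le> Y / real u * (\<Sum>D | D \<subseteq> P \<and> card D \<le> r. (-1) ^ card D / real (\<Prod>D)) + real (card {D. D \<subseteq> P \<and> card D \<le> r})"
        by (rule brun_pure_sieve) (use finP u c Ypos r in \<open>auto simp: P_def\<close>)
      also have "\<dots> \<le> Y / real u * (euler_weight u * (192 * (ln L / L)) + exp (3 * K0) / L) + Y / real u * (exp 1 / L)"
      proof (intro add_mono mult_left_mono)
        have "(\<Sum>D | D \<subseteq> P \<and> card D \<le> r. (-1) ^ card D / real (\<Prod>D))
            \<le> (\<Prod>p\<in>P. 1 - 1 / real p) + exp (- real r) * (\<Prod>p\<in>P. 1 + exp 1 / real p)"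
          by (rule truncated_moebius_sum_le) (use finP in \<open>auto simp: P_def\<close>)
        also have "(\<Prod>p\<in>P. 1 - 1 / real p) \<le> euler_weight u / ln z"
          unfolding P_def using z2 u by (intro prod_one_minus_inverse_prime_coprime_le) auto
        also have "euler_weight u / ln z = euler_weight u * (192 * (ln L / L))" using z by simp
        \<comment> \<open>Since e <= 3, Mertens' bound makes the product at most L^3 times a
          constant; the factor exp (-r) <= L^(-4) leaves a saving of 1 / L.\<close>
        also have "exp (- real r) * (\<Prod>p\<in>P. 1 + exp 1 / real p) \<le> exp (- (4 * ln L)) * exp (3 * (ln L + K0))"
        proof (intro mult_mono)
          have "(\<Prod>p\<in>P. 1 + exp 1 / real p) \<le> exp (\<Sum>p\<in>P. exp 1 / real p)"
            by (rule prod_le_exp_sum) simp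
          also have "(\<Sum>p\<in>P. exp 1 / real p) \<le> (\<Sum>p | prime p \<and> real p \<le> z. exp 1 / real p)"
            unfolding P_def by (intro sum_mono2 finite_primes_le) auto
          also have "\<dots> = exp 1 * (\<Sum>p | prime p \<and> real p \<le> z. 1 / real p)"
            by (simp add: sum_distrib_left)
          also have "\<dots> \<le> 3 * (ln L + K0)"
          proof (intro mult_mono)
            show "exp 1 \<le> (3::real)" by (rule exp_le)
            have "ln (ln z) \<le> ln L" using lnz Lpos by simp
            then show "(\<Sum>p | prime p \<and> real p \<le> z. 1 / real p) \<le> ln L + K0"
              using K0(2)[OF z2] by linarith
          qed (auto intro: sum_nonneg)
          finally show "(\<Prod>p\<in>P. 1 + exp 1 / real p) \<le> exp (3 * (ln L + K0))" by simp
        qed (use r in \<open>auto intro!: prod_nonneg\<close>)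
        also have "exp (- (4 * ln L)) * exp (3 * (ln L + K0)) = exp (3 * K0) / L"
        proof -
          have "exp (- (4 * ln L)) * exp (3 * (ln L + K0)) = exp (3 * K0 - ln L)"
            by (simp flip: exp_add)
          then show ?thesis using Lpos by (simp add: exp_diff)
        qed
        finally show "(\<Sum>D | D \<subseteq> P \<and> card D \<le> r. (-1) ^ card D / real (\<Prod>D))
           \<le> euler_weight u * (192 * (ln L / L)) + exp (3 * K0) / L" by simp
        have "P \<subseteq> {1..nat \<lfloor>z\<rfloor>}" unfolding P_def by (auto simp: le_nat_floor dest: prime_ge_1_nat)
        then have "card P \<le> nat \<lfloor>z\<rfloor>" using card_mono[of "{1..nat \<lfloor>z\<rfloor>}" P] by simp
        then have cP: "real (card P) \<le> z" using z2 by linarith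
        have "real (card {D. D \<subseteq> P \<and> card D \<le> r}) \<le> exp 1 * z ^ r"
          using finP cP z2 by (intro card_small_subsets_le) auto
        also have "z ^ r = exp (real r * (L / (192 * ln L)))" unfolding z_def by (simp flip: exp_of_nat_mult)
        also have "\<dots> \<le> exp (L / 32)"
        proof -
          have "real r * (L / (192 * ln L)) \<le> 6 * ln L * (L / (192 * ln L))"
            using r L Lpos by (intro mult_right_mono) auto
          also have "\<dots> = L / 32" using L by simp
          finally show ?thesis by simp
        qed
        also have "exp (L / 32) \<le> (Y / real u) / L"
        proof -
          \<comment> \<open>The hypothesis L <= exp (L / 5) suffices because 1/32 + 1/5 <
            1/4.\<close>
          have "exp (L / 32) * L \<le> exp (L / 32) * exp (L / 5)" using L by simp
          also have "\<dots> = exp (L / 32 + L / 5)" by (rule exp_add[symmetric])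
          also have "\<dots> \<le> exp (L / 4)" using Lpos by simp
          also note Yu
          finally show ?thesis using Lpos by (simp only: pos_le_divide_eq)
        qed
        finally show "real (card {D. D \<subseteq> P \<and> card D \<le> r}) \<le> Y / real u * (exp 1 / L)"
          by (simp add: mult_ac)
      qed (use Ypos in auto)
      also have "\<dots> = Y / real u * (euler_weight u * (192 * (ln L / L)) + (exp (3 * K0) + exp 1) * (1 / L))"
        by (simp add: ring_distribs add_divide_distrib)
      also have "\<dots> \<le> Y / real u * (euler_weight u * (192 * (ln L / L)) + (exp (3 * K0) + exp 1) * (euler_weight u * (ln L / L)))"
      proof (intro mult_left_mono add_left_mono)
        have "1 * (1 / L) \<le> euler_weight u * (ln L / L)"
          using w L Lpos by (intro mult_mono divide_right_mono) auto
        then show "1 / L \<le> euler_weight u * (ln L / L)" by simp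
      qed (use Ypos in \<open>auto intro: add_nonneg_nonneg\<close>)
      also have "\<dots> = (192 + exp (3 * K0) + exp 1) * (Y / real u) * euler_weight u * (ln L / L)"
      proof -
        have "q * (w * (192 * l) + (E + F) * (w * l)) = (192 + E + F) * q * w * l" for q w l E F :: real
          by (simp add: algebra_simps)
        then show ?thesis .
      qed
      finally show ?thesis unfolding z_def .
    qed
  qed
  moreover have "192 + exp (3 * K0) + exp 1 > 0" by (intro add_pos_pos) auto
  ultimately show ?thesis by (intro exI[of _ "192 + exp (3 * K0) + exp 1"]) simp
qed

section \<open>Exponential sums over roots\<close>

definition e_mod :: "nat \<Rightarrow> int \<Rightarrow> complex" where
  "e_mod k a = cis (2 * pi * real_of_int a / real k)"

lemma norm_e_mod [simp]: "norm (e_mod k a) = 1"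
  by (simp add: e_mod_def)

lemma e_mod_add: "e_mod k (a + b) = e_mod k a * e_mod k b"
  by (simp add: e_mod_def cis_mult ring_distribs add_divide_distrib)

lemma e_mod_0 [simp]: "e_mod k 0 = 1"
  by (simp add: e_mod_def)

lemma cnj_e_mod: "cnj (e_mod k a) = e_mod k (- a)"
  by (simp add: e_mod_def cis_cnj)

lemma e_mod_power: "e_mod k a ^ n = e_mod k (int n * a)"
  unfolding e_mod_def Complex.DeMoivre by (simp add: mult_ac)

lemma e_mod_eq_1_iff:
  assumes "k > 0" shows "e_mod k a = 1 \<longleftrightarrow> int k dvd a"
proof -
  have "e_mod k a = 1 \<longleftrightarrow> (\<exists>n::int. 2 * pi * real_of_int a / real k = of_int (2 * n) * pi)"
    unfolding e_mod_def cis_conv_exp exp_eq_1 by simp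
  also have "\<dots> \<longleftrightarrow> (\<exists>n::int. real_of_int a = real_of_int (int k * n))"
    using assms by (simp add: field_simps)
  also have "\<dots> \<longleftrightarrow> int k dvd a" unfolding of_int_eq_iff by (auto simp: dvd_def)
  finally show ?thesis .
qed

lemma e_mod_cong:
  assumes "k > 0" "[a = b] (mod int k)" shows "e_mod k a = e_mod k b"
proof -
  have "e_mod k (a - b) = 1" using assms by (simp add: e_mod_eq_1_iff cong_iff_dvd_diff)
  then show ?thesis using e_mod_add[of k "a - b" b] by simp
qed

lemma sum_e_mod:
  assumes "k > 0"
  shows "(\<Sum>b<k. e_mod k (int b * c)) = (if int k dvd c then of_nat k else 0)"
proof (cases "int k dvd c")
  case True
  then have "e_mod k (int b * c) = 1" for b using assms by (simp add: e_mod_eq_1_iff)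
  then show ?thesis using True by simp
next
  case False
  then have ne: "e_mod k c \<noteq> 1" using assms by (simp add: e_mod_eq_1_iff)
  have "(\<Sum>b<k. e_mod k (int b * c)) = (\<Sum>b<k. e_mod k c ^ b)" by (simp add: e_mod_power)
  also have "\<dots> = (e_mod k c ^ k - 1) / (e_mod k c - 1)" using ne by (rule geometric_sum)
  also have "e_mod k c ^ k = 1" using assms by (simp add: e_mod_power e_mod_eq_1_iff)
  finally show ?thesis using False by simp
qed

section \<open>Root sums, twisted multiplicativity and the mean square\<close>

definition roots_mod :: "int poly \<Rightarrow> nat \<Rightarrow> nat set" where
  "roots_mod f k = {\<nu>. \<nu> < k \<and> [poly f (int \<nu>) = 0] (mod int k)}"

definition root_sum :: "int poly \<Rightarrow> int \<Rightarrow> nat \<Rightarrow> complex" where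
  "root_sum f x k = (\<Sum>\<nu>\<in>roots_mod f k. e_mod k (x * int \<nu>))"

abbreviation num_roots :: "int poly \<Rightarrow> nat \<Rightarrow> real" where
  "num_roots f k \<equiv> real (card (roots_mod f k))"

lemma finite_roots_mod [simp]: "finite (roots_mod f k)"
  by (rule finite_subset[of _ "{..<k}"]) (auto simp: roots_mod_def)

lemma card_roots_mod_le: "card (roots_mod f k) \<le> k"
  using card_mono[of "{..<k}" "roots_mod f k"] by (auto simp: roots_mod_def)

lemma norm_root_sum_le: "norm (root_sum f x k) \<le> num_roots f k"
proof -
  have "norm (root_sum f x k) \<le> (\<Sum>\<nu>\<in>roots_mod f k. norm (e_mod k (x * int \<nu>)))"
    unfolding root_sum_def by (rule norm_sum)
  then show ?thesis by simp
qed

lemma poly_cong: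
  fixes f :: "int poly"
  assumes "[a = b] (mod m)" shows "[poly f a = poly f b] (mod m)"
  by (induction f) (auto intro!: cong_add cong_mult assms)

lemma root_exp_sum_eq: "root_exp_sum f h y = (\<Sum>k | 0 < k \<and> real k \<le> y. root_sum f h k)"
  unfolding root_exp_sum_def
proof (rule sum.cong[OF refl])
  fix k assume "k \<in> {k. 0 < k \<and> real k \<le> y}"
  then have k: "k > 0" by simp
  let ?A = "{\<nu>. 0 < \<nu> \<and> \<nu> \<le> int k \<and> [poly f \<nu> = 0] (mod int k)}"
  have "(\<Sum>\<nu>\<in>?A. e_mod k (h * \<nu>)) = root_sum f h k"
    unfolding root_sum_def
  \<comment> \<open>The only discrepancy is the class of 0: it is represented by k in
    \<open>root_exp_sum\<close> and by 0 in \<open>roots_mod\<close>.\<close>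
  proof (rule sum.reindex_bij_witness[where i = "\<lambda>\<mu>. if \<mu> = 0 then int k else int \<mu>" and j = "\<lambda>\<nu>. nat (\<nu> mod int k)"])
    fix \<nu> assume "\<nu> \<in> ?A"
    then have \<nu>: "0 < \<nu>" "\<nu> \<le> int k" "[poly f \<nu> = 0] (mod int k)" by auto
    have m: "int (nat (\<nu> mod int k)) = \<nu> mod int k" using k by simp
    show "(if nat (\<nu> mod int k) = 0 then int k else int (nat (\<nu> mod int k))) = \<nu>"
    proof (cases "\<nu> = int k")
      case False
      then have "\<nu> mod int k = \<nu>" using \<nu> by (intro mod_pos_pos_trivial) auto
      then show ?thesis using \<nu> by simp
    qed simp
    have "[poly f (\<nu> mod int k) = 0] (mod int k)"
      using \<nu>(3) poly_cong[of "\<nu> mod int k" \<nu> "int k" f] by (metis cong_mod_left cong_refl cong_trans)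
    moreover have "nat (\<nu> mod int k) < k" using k by (simp add: nat_less_iff)
    ultimately show "nat (\<nu> mod int k) \<in> roots_mod f k"
      unfolding roots_mod_def using m by simp
    show "e_mod k (h * int (nat (\<nu> mod int k))) = e_mod k (h * \<nu>)"
      unfolding m using k by (intro e_mod_cong cong_scalar_left) (simp_all add: unique_euclidean_semiring_class.cong_def)
  next
    fix \<mu> assume "\<mu> \<in> roots_mod f k"
    then have \<mu>: "\<mu> < k" "[poly f (int \<mu>) = 0] (mod int k)" by (auto simp: roots_mod_def)
    show "nat ((if \<mu> = 0 then int k else int \<mu>) mod int k) = \<mu>" using \<mu> by (auto simp: nat_mod_as_int)
    have "[poly f (int k) = poly f 0] (mod int k)" by (rule poly_cong) (simp add: unique_euclidean_semiring_class.cong_def)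
    then show "(if \<mu> = 0 then int k else int \<mu>) \<in> ?A" using \<mu> k by (auto intro: cong_trans)
  qed
  moreover have "exp (2 * of_real pi * \<i> * of_int h * of_int \<nu> / of_nat k) = e_mod k (h * \<nu>)" for \<nu>
    unfolding e_mod_def cis_conv_exp by (simp add: mult_ac)
  ultimately show "(\<Sum>\<nu>\<in>?A. exp (2 * of_real pi * \<i> * of_int h * of_int \<nu> / of_nat k)) = root_sum f h k"
    by simp
qed

lemma bij_betw_roots_mod_mult:
  assumes "n > 0" "u > 0" "coprime n u"
  shows "bij_betw (\<lambda>\<nu>. (\<nu> mod n, \<nu> mod u)) (roots_mod f (n * u)) (roots_mod f n \<times> roots_mod f u)"
proof -
  have cong: "[poly f (int \<nu>) = poly f (int (\<nu> mod m))] (mod int m)" for \<nu> m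
    by (rule poly_cong) (simp add: unique_euclidean_semiring_class.cong_def zmod_int)
  have iff: "[poly f (int \<nu>) = 0] (mod int (n * u)) \<longleftrightarrow>
      [poly f (int (\<nu> mod n)) = 0] (mod int n) \<and> [poly f (int (\<nu> mod u)) = 0] (mod int u)" for \<nu>
  proof -
    have "[poly f (int \<nu>) = 0] (mod int (n * u)) \<longleftrightarrow>
        [poly f (int \<nu>) = 0] (mod int n) \<and> [poly f (int \<nu>) = 0] (mod int u)"
      using assms(3) by (auto simp: cong_0_iff intro: divides_mult dvd_mult_left dvd_mult_right)
    also have "\<dots> \<longleftrightarrow> [poly f (int (\<nu> mod n)) = 0] (mod int n) \<and> [poly f (int (\<nu> mod u)) = 0] (mod int u)"
      using cong[of \<nu> n] cong[of \<nu> u] by (meson cong_sym cong_trans)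
    finally show ?thesis .
  qed
  show ?thesis unfolding bij_betw_def
  proof
    show "inj_on (\<lambda>\<nu>. (\<nu> mod n, \<nu> mod u)) (roots_mod f (n * u))"
    proof (rule inj_onI)
      fix x y assume xy: "x \<in> roots_mod f (n * u)" "y \<in> roots_mod f (n * u)"
        "(x mod n, x mod u) = (y mod n, y mod u)"
      then have "[x = y] (mod n * u)"
        using assms(3) by (intro coprime_cong_mult_nat) (simp_all add: unique_euclidean_semiring_class.cong_def)
      then show "x = y" using xy by (auto simp: roots_mod_def unique_euclidean_semiring_class.cong_def)
    qed
    show "(\<lambda>\<nu>. (\<nu> mod n, \<nu> mod u)) ` roots_mod f (n * u) = roots_mod f n \<times> roots_mod f u"
    proof
      show "(\<lambda>\<nu>. (\<nu> mod n, \<nu> mod u)) ` roots_mod f (n * u) \<subseteq> roots_mod f n \<times> roots_mod f u"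
        using iff assms by (auto simp: roots_mod_def)
      show "roots_mod f n \<times> roots_mod f u \<subseteq> (\<lambda>\<nu>. (\<nu> mod n, \<nu> mod u)) ` roots_mod f (n * u)"
      proof clarify
        fix a b assume ab: "a \<in> roots_mod f n" "b \<in> roots_mod f u"
        obtain x where x: "x < n * u" "[x = a] (mod n)" "[x = b] (mod u)"
          using binary_chinese_remainder_unique_nat[OF assms(3), of a b] assms by auto
        then have xm: "x mod n = a" "x mod u = b" using ab by (auto simp: unique_euclidean_semiring_class.cong_def roots_mod_def)
        then have "x \<in> roots_mod f (n * u)" using ab x iff[of x] by (auto simp: roots_mod_def)
        then show "(a, b) \<in> (\<lambda>\<nu>. (\<nu> mod n, \<nu> mod u)) ` roots_mod f (n * u)" using xm by auto
      qed
    qed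
  qed
qed

lemma card_roots_mod_mult:
  assumes "n > 0" "u > 0" "coprime n u"
  shows "card (roots_mod f (n * u)) = card (roots_mod f n) * card (roots_mod f u)"
  using bij_betw_same_card[OF bij_betw_roots_mod_mult[OF assms]] by (simp add: card_cartesian_product)

text \<open>Dividing n n' + u u' = 1 by n u gives 1 / (n u) = u' / n + n' / u. So the phase splits
  into one modulo n and one modulo u, and the roots modulo n u correspond to pairs of roots.\<close>

lemma root_sum_mult:
  assumes "n > 0" "u > 0" and inv: "int n * n' + int u * u' = 1"
  shows "root_sum f h (n * u) = root_sum f (h * u') n * root_sum f (h * n') u"
proof -
  have cop: "coprime n u"
  proof (rule coprimeI)
    fix d assume "d dvd n" "d dvd u"
    then have "int d dvd int n * n' + int u * u'" by (intro dvd_add dvd_mult2) auto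
    then show "is_unit d" using inv by simp
  qed
  have "root_sum f (h * u') n * root_sum f (h * n') u =
      (\<Sum>(\<alpha>,\<beta>)\<in>roots_mod f n \<times> roots_mod f u. e_mod n (h * u' * int \<alpha>) * e_mod u (h * n' * int \<beta>))"
    unfolding root_sum_def by (simp add: sum_product sum.cartesian_product)
  also have "\<dots> = (\<Sum>\<nu>\<in>roots_mod f (n * u).
      e_mod n (h * u' * int (\<nu> mod n)) * e_mod u (h * n' * int (\<nu> mod u)))"
    by (subst sum.reindex_bij_betw[OF bij_betw_roots_mod_mult[OF assms(1,2) cop], symmetric]) simp
  also have "\<dots> = root_sum f h (n * u)"
    unfolding root_sum_def
  proof (rule sum.cong[OF refl])
    fix \<nu>
    have "e_mod n (h * u' * int (\<nu> mod n)) = e_mod n (h * u' * int \<nu>)"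
      using assms(1,2) by (intro e_mod_cong cong_scalar_left) (simp_all add: unique_euclidean_semiring_class.cong_def zmod_int)
    moreover have "e_mod u (h * n' * int (\<nu> mod u)) = e_mod u (h * n' * int \<nu>)"
      using assms(1,2) by (intro e_mod_cong cong_scalar_left) (simp_all add: unique_euclidean_semiring_class.cong_def zmod_int)
    moreover have "2 * pi * real_of_int (h * u' * int \<nu>) / real n + 2 * pi * real_of_int (h * n' * int \<nu>) / real u
        = 2 * pi * real_of_int (h * int \<nu>) / real (n * u)"
    proof -
      have "2 * pi * real_of_int (h * u' * int \<nu>) / real n + 2 * pi * real_of_int (h * n' * int \<nu>) / real u
        = 2 * pi * real_of_int (h * int \<nu> * (int n * n' + int u * u')) / real (n * u)"
        using assms(1,2) by (simp add: field_simps)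
      then show ?thesis using inv by simp
    qed
    ultimately show "e_mod n (h * u' * int (\<nu> mod n)) * e_mod u (h * n' * int (\<nu> mod u)) = e_mod (n * u) (h * int \<nu>)"
      by (simp add: e_mod_def cis_mult)
  qed
  finally show ?thesis ..
qed

text \<open>Only the factor modulo u keeps its cancellation. It depends on n solely through the
  inverse b of n modulo u, so all n in the same class share it.\<close>

lemma norm_root_sum_mult_le:
  assumes "n > 0" "u > 0" "[b * int n = 1] (mod int u)"
  shows "norm (root_sum f h (n * u)) \<le> num_roots f n * norm (root_sum f (h * b) u)"
proof -
  obtain u' where "int n * b + int u * u' = 1"
    using assms(3) by (metis cong_iff_lin mult.commute)
  from root_sum_mult[OF assms(1,2) this, of f h]
  have "norm (root_sum f h (n * u)) = norm (root_sum f (h * u') n) * norm (root_sum f (h * b) u)"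
    by (simp add: norm_mult)
  also have "\<dots> \<le> num_roots f n * norm (root_sum f (h * b) u)"
    by (intro mult_right_mono norm_root_sum_le) simp
  finally show ?thesis .
qed

text \<open>Expanding the square and summing over b leaves the pairs of roots with u dividing h
  (\<nu> - \<mu>). As h is coprime to u and the roots lie in 0..u-1, these are the diagonal
  pairs.\<close>

lemma root_sum_second_moment:
  assumes "u > 0" "coprime h (int u)"
  shows "(\<Sum>b<u. (norm (root_sum f (h * int b) u))\<^sup>2) = real u * num_roots f u"
proof -
  let ?R = "roots_mod f u"
  have "complex_of_real (\<Sum>b<u. (norm (root_sum f (h * int b) u))\<^sup>2)
      = (\<Sum>b<u. root_sum f (h * int b) u * cnj (root_sum f (h * int b) u))"
    by (simp only: of_real_sum complex_norm_square)
  also have "\<dots> = (\<Sum>b<u. \<Sum>\<nu>\<in>?R. \<Sum>\<mu>\<in>?R. e_mod u (int b * (h * (int \<nu> - int \<mu>))))"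
  proof (rule sum.cong[OF refl])
    fix b
    have "e_mod u (h * int b * int \<nu>) * cnj (e_mod u (h * int b * int \<mu>)) = e_mod u (int b * (h * (int \<nu> - int \<mu>)))" for \<nu> \<mu>
      unfolding cnj_e_mod e_mod_add[symmetric] by (simp add: algebra_simps)
    then show "root_sum f (h * int b) u * cnj (root_sum f (h * int b) u)
       = (\<Sum>\<nu>\<in>?R. \<Sum>\<mu>\<in>?R. e_mod u (int b * (h * (int \<nu> - int \<mu>))))"
      unfolding root_sum_def by (simp add: sum_product)
  qed
  also have "\<dots> = (\<Sum>\<nu>\<in>?R. \<Sum>\<mu>\<in>?R. \<Sum>b<u. e_mod u (int b * (h * (int \<nu> - int \<mu>))))"
    by (subst sum.swap, rule sum.cong[OF refl], rule sum.swap)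
  also have "\<dots> = (\<Sum>\<nu>\<in>?R. \<Sum>\<mu>\<in>?R. if \<mu> = \<nu> then of_nat u else 0)"
  proof (intro sum.cong refl)
    fix \<nu> \<mu> assume "\<nu> \<in> ?R" "\<mu> \<in> ?R"
    then have lt: "\<nu> < u" "\<mu> < u" by (auto simp: roots_mod_def)
    have "int u dvd h * (int \<nu> - int \<mu>) \<longleftrightarrow> int u dvd int \<nu> - int \<mu>"
      using assms(2) by (simp add: coprime_dvd_mult_right_iff coprime_commute)
    also have "\<dots> \<longleftrightarrow> \<mu> = \<nu>"
      using lt by (auto simp flip: cong_iff_dvd_diff simp: cong_int_iff unique_euclidean_semiring_class.cong_def)
    finally show "(\<Sum>b<u. e_mod u (int b * (h * (int \<nu> - int \<mu>)))) = (if \<mu> = \<nu> then of_nat u else 0)"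
      using sum_e_mod[OF assms(1)] by simp
  qed
  also have "\<dots> = complex_of_real (real u * num_roots f u)" by simp
  finally show ?thesis using of_real_eq_iff by blast
qed

text \<open>Cauchy-Schwarz turns the mean square rho(u) into the mean sqrt(rho(u)); this is where
  the exponent sqrt 2 originates.\<close>

lemma sum_norm_root_sum_le:
  assumes "u > 0" "coprime h (int u)"
  shows "(\<Sum>b<u. norm (root_sum f (h * int b) u)) \<le> real u * sqrt (num_roots f u)"
proof -
  have "(\<Sum>b<u. norm (root_sum f (h * int b) u) * 1)\<^sup>2 \<le>
      (\<Sum>b<u. (norm (root_sum f (h * int b) u))\<^sup>2) * (\<Sum>b<u. 1\<^sup>2)"
    by (rule Cauchy_Schwarz_ineq_sum)
  also have "\<dots> = (real u * sqrt (num_roots f u))\<^sup>2"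
    unfolding root_sum_second_moment[OF assms] by (simp add: power2_eq_square)
  finally have "(\<Sum>b<u. norm (root_sum f (h * int b) u) * 1) \<le> real u * sqrt (num_roots f u)"
    by (rule power2_le_imp_le) simp
  then show ?thesis by simp
qed

section \<open>The number of roots of a product of two linear factors\<close>

lemma card_congruent_le:
  fixes i j :: nat and p :: nat
  assumes "p > 0" "i \<le> j" "S \<subseteq> {..<p ^ j}" and cong: "\<And>x y. x \<in> S \<Longrightarrow> y \<in> S \<Longrightarrow> [x = y] (mod p ^ i)"
  shows "card S \<le> p ^ (j - i)"
proof -
  have "inj_on (\<lambda>x. x div p ^ i) S"
  proof (rule inj_onI)
    fix x y assume "x \<in> S" "y \<in> S" "x div p ^ i = y div p ^ i"
    then show "x = y" using cong[of x y] by (metis unique_euclidean_semiring_class.cong_def div_mult_mod_eq)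
  qed
  moreover have "(\<lambda>x. x div p ^ i) ` S \<subseteq> {..<p ^ (j - i)}"
  proof (rule image_subsetI)
    fix x assume "x \<in> S"
    then have "x < p ^ (j - i) * p ^ i" using assms by (auto simp flip: power_add)
    then show "x div p ^ i \<in> {..<p ^ (j - i)}" by (simp add: less_mult_imp_div_less)
  qed
  ultimately show ?thesis by (metis card_inj_on_le card_lessThan finite_lessThan)
qed

text \<open>If there is a solution, p cannot divide a, for it would then divide b as well (here i >
  0 matters). So a is invertible and any two solutions agree modulo p^i.\<close>

lemma card_linear_roots_prime_power_le:
  assumes p: "prime p" and ab: "coprime a (b::int)" and "0 < i" "i \<le> j"
  shows "card {\<nu>. \<nu> < p ^ j \<and> int p ^ i dvd a * int \<nu> + b} \<le> p ^ (j - i)"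
proof (rule card_congruent_le)
  fix x y assume xy: "x \<in> {\<nu>. \<nu> < p ^ j \<and> int p ^ i dvd a * int \<nu> + b}"
    "y \<in> {\<nu>. \<nu> < p ^ j \<and> int p ^ i dvd a * int \<nu> + b}"
  have pa: "\<not> int p dvd a"
  proof
    assume "int p dvd a"
    moreover have "int p dvd a * int x + b"
      using xy \<open>0 < i\<close> by (auto intro: dvd_trans[OF dvd_power])
    ultimately have "int p dvd b" by (simp add: dvd_add_right_iff)
    with ab \<open>int p dvd a\<close> have "is_unit (int p)" by (rule coprime_common_divisor)
    then show False using p by simp
  qed
  then have "coprime (int p ^ i) a" using p by (simp add: prime_imp_coprime)
  moreover have "int p ^ i dvd a * (int x - int y)"
    using xy dvd_diff[of "int p ^ i" "a * int x + b" "a * int y + b"] by (simp add: algebra_simps)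
  ultimately have "int p ^ i dvd int x - int y" by (simp add: coprime_dvd_mult_right_iff)
  then show "[x = y] (mod p ^ i)" by (simp add: cong_iff_dvd_diff flip: cong_int_iff)
qed (use assms prime_gt_0_nat in auto)

text \<open>Let x and y be the values of the two linear factors at a root. From a y - c x = a d - b
  c, the smaller of their p-adic valuations is at most that of a d - b c. Since p^j divides W x y,
  the larger one is at least i = j - n, where n is the valuation of W (a d - b c). So p^i divides x
  or y, and each alternative allows at most p^n residues. For j <= n the trivial bound p^j is
  enough.\<close>

lemma card_roots_mod_prime_power_le:
  assumes f: "f = smult W ([:b, a:] * [:d, c:])" and ab: "coprime a b" and cd: "coprime c d"
    and N: "W * (a * d - b * c) \<noteq> 0" and p: "prime p"
  shows "card (roots_mod f (p ^ j)) \<le> 2 * p ^ multiplicity (int p) (W * (a * d - b * c))"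
proof -
  define n where "n = multiplicity (int p) (W * (a * d - b * c))"
  have p0: "p > 0" using p prime_gt_0_nat by blast
  have pi: "prime (int p)" "\<not> is_unit (int p)" using p by auto
  show ?thesis
  proof (cases "j \<le> n")
    case True
    then have "p ^ j \<le> p ^ n" using p0 by (intro power_increasing) auto
    then show ?thesis using card_roots_mod_le[of f "p ^ j"] unfolding n_def by linarith
  next
    case False
    define i where "i = j - n"
    have i: "0 < i" "i \<le> j" "j - i = n" using False unfolding i_def by auto
    let ?A = "\<lambda>a b. {\<nu>. \<nu> < p ^ j \<and> int p ^ i dvd a * int \<nu> + b}"
    have "roots_mod f (p ^ j) \<subseteq> ?A a b \<union> ?A c d"
    proof
      fix \<nu> assume \<nu>: "\<nu> \<in> roots_mod f (p ^ j)"
      define x y where "x = a * int \<nu> + b" and "y = c * int \<nu> + d"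
      have "poly f (int \<nu>) = W * (x * y)" unfolding f x_def y_def by (simp add: algebra_simps)
      then have dv: "int p ^ j dvd W * (x * y)" using \<nu> by (simp add: roots_mod_def cong_0_iff)
      have "int p ^ i dvd x \<or> int p ^ i dvd y"
      proof (rule ccontr)
        assume "\<not> ?thesis"
        then have nd: "\<not> int p ^ i dvd x" "\<not> int p ^ i dvd y" by auto
        then have nz: "x \<noteq> 0" "y \<noteq> 0" by auto
        define \<alpha> \<beta> where "\<alpha> = multiplicity (int p) x" and "\<beta> = multiplicity (int p) y"
        have lt: "\<alpha> < i" "\<beta> < i"
          using nd nz pi unfolding \<alpha>_def \<beta>_def by (auto simp: power_dvd_iff_le_multiplicity not_le)
        have W: "W \<noteq> 0" and D: "a * d - b * c \<noteq> 0" using N by auto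
        have n: "n = multiplicity (int p) W + multiplicity (int p) (a * d - b * c)"
          unfolding n_def using W D pi by (intro prime_elem_multiplicity_mult_distrib) auto
        have "j \<le> multiplicity (int p) (W * (x * y))"
          using dv nz W pi by (intro multiplicity_geI) auto
        also have "\<dots> = multiplicity (int p) W + (\<alpha> + \<beta>)"
          unfolding \<alpha>_def \<beta>_def using W nz pi by (simp add: prime_elem_multiplicity_mult_distrib)
        finally have j: "j \<le> multiplicity (int p) W + (\<alpha> + \<beta>)" .
        have "int p ^ min \<alpha> \<beta> dvd x" "int p ^ min \<alpha> \<beta> dvd y"
          unfolding \<alpha>_def \<beta>_def by (auto intro!: multiplicity_dvd')
        then have "int p ^ min \<alpha> \<beta> dvd a * y - c * x" by (intro dvd_diff dvd_mult)
        also have "a * y - c * x = a * d - b * c" unfolding x_def y_def by (simp add: algebra_simps)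
        finally have "min \<alpha> \<beta> \<le> multiplicity (int p) (a * d - b * c)"
          using D pi by (intro multiplicity_geI) auto
        with j lt n i show False by (auto simp: min_def split: if_splits)
      qed
      then show "\<nu> \<in> ?A a b \<union> ?A c d" using \<nu> unfolding x_def y_def by (auto simp: roots_mod_def)
    qed
    then have "card (roots_mod f (p ^ j)) \<le> card (?A a b \<union> ?A c d)"
      by (intro card_mono) auto
    also have "\<dots> \<le> card (?A a b) + card (?A c d)" by (rule card_Un_le)
    also have "\<dots> \<le> p ^ n + p ^ n"
      using card_linear_roots_prime_power_le[OF p ab i(1,2)] card_linear_roots_prime_power_le[OF p cd i(1,2)] i(3)
      by (intro add_mono) auto
    finally show ?thesis unfolding n_def by simp
  qed
qed

text \<open>The map sending a root \<nu> to g = gcd (a \<nu> + b, m) is injective. Indeed m / g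
  divides c \<nu> + d; a common divisor of g and m / g would divide a d - b c, so the two are
  coprime; and \<nu> is determined modulo g by the first factor and modulo m / g by the
  second.\<close>

lemma card_roots_mod_le_divisors:
  assumes f: "f = smult W ([:b, a:] * [:d, c:])" and ab: "coprime a b" and cd: "coprime c d"
    and m: "m > 0" "coprime (int m) (W * (a * d - b * c))"
  shows "card (roots_mod f m) \<le> card {e. e dvd m}"
proof -
  define x y where "x = (\<lambda>\<nu>::nat. a * int \<nu> + b)" and "y = (\<lambda>\<nu>::nat. c * int \<nu> + d)"
  define g where "g = (\<lambda>\<nu>. nat (gcd (x \<nu>) (int m)))"
  have mW: "coprime (int m) W" and mD: "coprime (int m) (a * d - b * c)" using m by auto
  have gm: "g \<nu> dvd m" and gx: "int (g \<nu>) dvd x \<nu>" for \<nu>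
  proof -
    have "int (g \<nu>) = gcd (x \<nu>) (int m)" unfolding g_def by simp
    then show "g \<nu> dvd m" "int (g \<nu>) dvd x \<nu>" by (metis gcd_dvd2 int_dvd_int_iff, metis gcd_dvd1)
  qed
  have root: "int (m div g \<nu>) dvd y \<nu>" if "\<nu> \<in> roots_mod f m" for \<nu>
  proof -
    have "poly f (int \<nu>) = W * (x \<nu> * y \<nu>)" unfolding f x_def y_def by (simp add: algebra_simps)
    then have "int m dvd W * (x \<nu> * y \<nu>)" using that by (simp add: roots_mod_def cong_0_iff)
    then have dv: "int m dvd x \<nu> * y \<nu>" using mW by (simp add: coprime_dvd_mult_right_iff)
    have g: "int (g \<nu>) = gcd (x \<nu>) (int m)" unfolding g_def by simp
    have gpos: "g \<nu> > 0" using gm m by (metis dvd_pos_nat)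
    have mg: "int m = int (g \<nu>) * int (m div g \<nu>)" using gm by (simp flip: of_nat_mult)
    obtain x' where x': "x \<nu> = int (g \<nu>) * x'" using gx by (auto elim: dvdE)
    have "int (g \<nu>) * int (m div g \<nu>) dvd int (g \<nu>) * (x' * y \<nu>)"
      using dv unfolding x' mg[symmetric] by (simp add: mult_ac)
    then have "int (m div g \<nu>) dvd x' * y \<nu>" using gpos by simp
    moreover have "coprime (int (m div g \<nu>)) x'"
    proof -
      have "int (g \<nu>) = int (g \<nu>) * gcd x' (int (m div g \<nu>))"
        using g unfolding x' by (subst (asm) mg) (simp add: gcd_mult_left)
      then show ?thesis using gpos by (simp add: coprime_iff_gcd_eq_1 gcd.commute)
    qed
    ultimately show ?thesis by (simp add: coprime_dvd_mult_right_iff)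
  qed
  have "inj_on g (roots_mod f m)"
  proof (rule inj_onI)
    fix \<nu> \<mu> assume \<nu>: "\<nu> \<in> roots_mod f m" and \<mu>: "\<mu> \<in> roots_mod f m" and eq: "g \<nu> = g \<mu>"
    have mg: "int m = int (g \<nu>) * int (m div g \<nu>)" using gm by (simp flip: of_nat_mult)
    have "int (g \<nu>) dvd x \<nu> - x \<mu>" using gx[of \<nu>] gx[of \<mu>] eq by (intro dvd_diff) simp_all
    then have 1: "int (g \<nu>) dvd a * (int \<nu> - int \<mu>)" unfolding x_def by (simp add: algebra_simps)
    have "int (m div g \<nu>) dvd y \<nu> - y \<mu>" using root[OF \<nu>] root[OF \<mu>] eq by (intro dvd_diff) simp_all
    then have 2: "int (m div g \<nu>) dvd c * (int \<nu> - int \<mu>)" unfolding y_def by (simp add: algebra_simps)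
    have "coprime (int (g \<nu>)) a"
    proof (rule coprimeI)
      fix e assume e: "e dvd int (g \<nu>)" "e dvd a"
      then have "e dvd x \<nu> - a * int \<nu>" using gx by (meson dvd_diff dvd_mult2 dvd_trans)
      then have "e dvd b" unfolding x_def by simp
      with e ab show "is_unit e" by (meson coprime_common_divisor)
    qed
    with 1 have d1: "int (g \<nu>) dvd int \<nu> - int \<mu>" by (simp add: coprime_dvd_mult_right_iff)
    have "coprime (int (m div g \<nu>)) c"
    proof (rule coprimeI)
      fix e assume e: "e dvd int (m div g \<nu>)" "e dvd c"
      then have "e dvd y \<nu> - c * int \<nu>" using root[OF \<nu>] by (meson dvd_diff dvd_mult2 dvd_trans)
      then have "e dvd d" unfolding y_def by simp
      with e cd show "is_unit e" by (meson coprime_common_divisor)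
    qed
    with 2 have d2: "int (m div g \<nu>) dvd int \<nu> - int \<mu>" by (simp add: coprime_dvd_mult_right_iff)
    have "coprime (int (g \<nu>)) (int (m div g \<nu>))"
    proof (rule coprimeI)
      fix e assume e: "e dvd int (g \<nu>)" "e dvd int (m div g \<nu>)"
      then have "e dvd x \<nu>" "e dvd y \<nu>" using gx root[OF \<nu>] by (meson dvd_trans)+
      then have "e dvd a * y \<nu> - c * x \<nu>" by (intro dvd_diff dvd_mult)
      also have "a * y \<nu> - c * x \<nu> = a * d - b * c" unfolding x_def y_def by (simp add: algebra_simps)
      finally have "e dvd a * d - b * c" .
      moreover have "e dvd int m" using e(1) unfolding mg by (rule dvd_mult2)
      ultimately show "is_unit e" using mD by (meson coprime_common_divisor)
    qed
    then have "int m dvd int \<nu> - int \<mu>" unfolding mg using d1 d2 by (intro divides_mult)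
    then show "\<nu> = \<mu>" using \<nu> \<mu>
      by (auto simp flip: cong_iff_dvd_diff simp: cong_int_iff unique_euclidean_semiring_class.cong_def roots_mod_def)
  qed
  moreover have "g ` roots_mod f m \<subseteq> {e. e dvd m}" using gm by auto
  moreover have "finite {e. e dvd m}" using m by simp
  ultimately show ?thesis by (rule card_inj_on_le)
qed

section \<open>Primitive factors and the discriminant\<close>

lemma reducible_quadratic_primitive:
  assumes "reducible_quadratic f"
  obtains W a b c d where "W \<noteq> 0" "a \<noteq> 0" "c \<noteq> 0" "coprime a b" "coprime c d"
    "f = smult W ([:b, a:] * [:d, c:])"
proof -
  obtain W a b c d where f: "W \<noteq> 0" "a \<noteq> 0" "c \<noteq> 0" "f = smult W ([:b, a:] * [:d, c:])"
    using assms unfolding reducible_quadratic_def by blast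
  obtain a' b' where a': "a = gcd a b * a'" "b = gcd a b * b'" "coprime a' b'"
    using gcd_coprime_exists[of a b] f by (metis gcd_eq_0_iff mult.commute)
  obtain c' d' where c': "c = gcd c d * c'" "d = gcd c d * d'" "coprime c' d'"
    using gcd_coprime_exists[of c d] f by (metis gcd_eq_0_iff mult.commute)
  have "[:b, a:] = smult (gcd a b) [:b', a':]" using a' by simp
  moreover have "[:d, c:] = smult (gcd c d) [:d', c':]" using c' by simp
  ultimately have "f = smult (W * gcd a b * gcd c d) ([:b', a':] * [:d', c':])"
    using f(4) by (simp only: mult_smult_left mult_smult_right smult_smult mult_ac)
  moreover have "a' \<noteq> 0" "c' \<noteq> 0" using f a'(1) c'(1) by auto
  moreover have "W * gcd a b * gcd c d \<noteq> 0" using f by simp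
  ultimately show ?thesis using that a'(3) c'(3) by blast
qed

lemma discriminant_factored:
  assumes "f = smult W ([:b, a:] * [:d, c:])"
  shows "quadratic_discriminant f = (W * (a * d - b * c))\<^sup>2"
  unfolding quadratic_discriminant_def assms
  by (simp add: numeral_2_eq_2 algebra_simps power2_eq_square)

text \<open>If a d = b c, then c t + d is c / a times a t + b, so f is a rational multiple of the
  square of a t + b.\<close>

lemma nonsquare_factored:
  assumes "f = smult W ([:b, a:] * [:d, c:])" "nonsquare f" "a \<noteq> 0"
  shows "a * d - b * c \<noteq> 0"
proof
  assume "a * d - b * c = 0"
  then have eq: "a * d = b * c" by simp
  have "map_poly of_int f = smult (of_int (W * c) / of_int a :: rat) ([:of_int b, of_int a:] ^ 2)"
  proof -
    have "(of_int (a * d) :: rat) = of_int (b * c)" using eq by simp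
    then have d: "of_int d = of_int b * of_int c / (of_int a :: rat)" using assms(3) by (simp add: field_simps)
    have "f = [:W * b * d, W * (a * d + b * c), W * a * c:]" unfolding assms(1) by (simp add: algebra_simps)
    then have "map_poly of_int f = [:of_int (W * b * d), of_int (W * (a * d + b * c)), of_int (W * a * c):: rat:]"
      by (simp add: map_poly_pCons)
    also have "\<dots> = smult (of_int (W * c) / of_int a) ([:of_int b, of_int a:] ^ 2)"
      using assms(3) by (simp add: d power2_eq_square field_simps)
    finally show ?thesis .
  qed
  moreover have "degree [:of_int b, of_int a :: rat:] = 1" using assms(3) by simp
  ultimately show False using assms(2) unfolding nonsquare_def by blast
qed

section \<open>Weighted sums over the parts of a modulus\<close>

text \<open>The term j = 0 is kept apart so that the bound is 1 + O(M x), the shape of a local Euler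
  factor, and not a multiple of M.\<close>

lemma sum_power_weighted_le:
  fixes x :: real
  assumes "0 \<le> x" "x < 1" "r 0 \<le> 1" "\<And>j. j > 0 \<Longrightarrow> r j \<le> M" "M \<ge> 0"
  shows "(\<Sum>j\<le>J. r j * x ^ j) \<le> 1 + M * (x / (1 - x))"
proof -
  have "(\<Sum>j\<le>J. r j * x ^ j) \<le> 1 + M * ((\<Sum>j\<le>J. x ^ j) - 1)"
  proof (induction J)
    case (Suc J)
    have "r (Suc J) * x ^ Suc J \<le> M * x ^ Suc J" using assms by (intro mult_right_mono) auto
    with Suc show ?case by (simp add: ring_distribs)
  qed (use assms in simp)
  also have "\<dots> \<le> 1 + M * (1 / (1 - x) - 1)"
    using sum_power_le[OF assms(1,2), of J] assms(5) by (intro add_left_mono mult_left_mono) auto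
  also have "1 / (1 - x) - 1 = x / (1 - x)" using assms(2) by (simp add: field_simps)
  finally show ?thesis .
qed

lemma sum_inverse_squares_le:
  assumes "finite P" "0 \<notin> P"
  shows "(\<Sum>p\<in>P. 1 / (real p)\<^sup>2) \<le> 2"
proof -
  have *: "(\<Sum>p=1..Suc n. 1 / (real p)\<^sup>2) \<le> 2 - 1 / real (Suc n)" for n
  proof (induction n)
    case (Suc n)
    define t where "t = real n"
    have t: "t \<ge> 0" by (simp add: t_def)
    have "1 / (t + 2)\<^sup>2 \<le> 1 / ((t + 1) * (t + 2))"
      unfolding power2_eq_square using t by (intro divide_left_mono mult_right_mono mult_pos_pos) auto
    also have "\<dots> = 1 / (t + 1) - 1 / (t + 2)" using t by (simp add: field_simps)
    finally have "1 / (t + 2)\<^sup>2 \<le> 1 / (t + 1) - 1 / (t + 2)" .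
    moreover have "(\<Sum>p=1..Suc (Suc n). 1 / (real p)\<^sup>2) = (\<Sum>p=1..Suc n. 1 / (real p)\<^sup>2) + 1 / (t + 2)\<^sup>2"
      by (simp add: t_def add.commute)
    ultimately show ?case using Suc by (simp add: t_def add.commute)
  qed simp
  have "P \<subseteq> {1..Suc (Max P)}"
  proof
    fix p assume p: "p \<in> P"
    then have "p \<noteq> 0" "p \<le> Max P" using assms by (metis, simp)
    then show "p \<in> {1..Suc (Max P)}" by auto
  qed
  then have "(\<Sum>p\<in>P. 1 / (real p)\<^sup>2) \<le> (\<Sum>p=1..Suc (Max P). 1 / (real p)\<^sup>2)"
    by (intro sum_mono2) auto
  also have "\<dots> \<le> 2 - 1 / real (Suc (Max P))" by (rule *)
  also have "\<dots> \<le> 2" by simp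
  finally show ?thesis .
qed

text \<open>Pairing d with v / d puts one member of each pair below sqrt v. The small divisor leaves
  a cofactor v / d in a range long enough to be sieved.\<close>

lemma card_divisors_le:
  assumes "v > (0::nat)"
  shows "card {e. e dvd v} \<le> 2 * card {d. d dvd v \<and> d * d \<le> v}"
proof -
  let ?A = "{d. d dvd v \<and> d * d \<le> v}"
  have fin: "finite {e. e dvd v}" using assms by simp
  then have finA: "finite ?A" by (rule rev_finite_subset) auto
  have "{e. e dvd v} \<subseteq> ?A \<union> (\<lambda>d. v div d) ` ?A"
  proof
    fix e assume "e \<in> {e. e dvd v}"
    then obtain k where k: "v = e * k" by (auto elim: dvdE)
    show "e \<in> ?A \<union> (\<lambda>d. v div d) ` ?A"
    proof (cases "e \<le> k")
      case False
      then have "k * k \<le> v" unfolding k by simp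
      moreover have "v div k = e" using k assms by simp
      moreover have "k dvd v" using k by simp
      ultimately show ?thesis by (metis (mono_tags, lifting) UnI2 imageI mem_Collect_eq)
    qed (use k in simp)
  qed
  then have "card {e. e dvd v} \<le> card (?A \<union> (\<lambda>d. v div d) ` ?A)"
    using finA by (intro card_mono) auto
  also have "\<dots> \<le> card ?A + card ((\<lambda>d. v div d) ` ?A)" by (rule card_Un_le)
  also have "\<dots> \<le> card ?A + card ?A" using finA by (intro add_left_mono card_image_le)
  finally show ?thesis by simp
qed

lemma euler_weight_mult:
  assumes "m > 0" "n > 0" "coprime m n"
  shows "euler_weight (m * n) = euler_weight m * euler_weight n"
proof -
  have "prime_factors m \<inter> prime_factors n = {}"
    using assms(3) by (auto simp: in_prime_factors_iff) (metis coprime_common_divisor not_prime_unit)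
  then show ?thesis unfolding euler_weight_def using assms
    by (simp add: prime_factors_product prod.union_disjoint)
qed

lemma euler_weight_prime_power:
  assumes "prime p" "j > 0"
  shows "euler_weight (p ^ j) = 1 / (1 - 1 / real p)"
proof -
  have "prime_factors (p ^ j) = {p}"
    using assms by (auto simp: in_prime_factors_iff prime_dvd_power_iff primes_dvd_imp_eq)
  then show ?thesis by (simp add: euler_weight_def)
qed

lemma euler_weight_1 [simp]: "euler_weight (Suc 0) = 1"
  by (simp add: euler_weight_def)

lemma roots_mod_1 [simp]: "roots_mod f (Suc 0) = {0}"
  by (auto simp: roots_mod_def)

lemma num_roots_mult:
  "m > 0 \<Longrightarrow> n > 0 \<Longrightarrow> coprime m n \<Longrightarrow> num_roots f (m * n) = num_roots f m * num_roots f n"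
  by (simp add: card_roots_mod_mult)

section \<open>Euler product bounds for the parts of a modulus\<close>

text \<open>\<open>K0\<close> and \<open>K1\<close> are parameters whose properties are assumed.
  They are obtained before f and h are chosen, so a constant built from them alone is visibly
  absolute.\<close>

locale hooley =
  fixes f :: "int poly" and W a b c d h :: int and K0 K1 :: real
  assumes f_eq: "f = smult W ([:b, a:] * [:d, c:])" and ab: "coprime a b" and cd: "coprime c d"
    and N_nz: "W * (a * d - b * c) \<noteq> 0" and h_nz: "h \<noteq> 0"
    and K0: "K0 \<ge> 0" "\<And>y. y \<ge> 2 \<Longrightarrow> (\<Sum>p | prime p \<and> real p \<le> y. 1 / real p) \<le> ln (ln y) + K0"
    and K1: "K1 > 0" "\<And>L u c Y. ln L \<ge> 1 \<Longrightarrow> L \<le> exp (L / 5) \<Longrightarrow> L / (192 * ln L) \<ge> 1 \<Longrightarrow> u > 0 \<Longrightarrow>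
      Y / real u \<ge> exp (L / 4) \<Longrightarrow>
      real (card {e. 0 < e \<and> real e \<le> Y \<and> [int e * c = 1] (mod int u) \<and>
        (\<forall>p. prime p \<longrightarrow> real p \<le> exp (L / (192 * ln L)) \<longrightarrow> \<not> p dvd e)})
      \<le> K1 * (Y / real u) * euler_weight u * (ln L / L)"
begin

definition N :: int where "N = W * (a * d - b * c)"

definition B :: "nat set" where "B = {p. prime p \<and> int p dvd N * h}"

definition H :: real where "H = (\<Prod>p | prime p \<and> int p dvd h. 1 + 7 / sqrt (real p))"

definition G :: "real \<Rightarrow> nat set" where "G z = {p. prime p \<and> real p \<le> z \<and> p \<notin> B}"

lemma finite_prime_divisors: "x \<noteq> 0 \<Longrightarrow> finite {p::nat. prime p \<and> int p dvd x}"
proof -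
  assume "x \<noteq> 0"
  then have "finite {p. p dvd nat \<bar>x\<bar>}" by (intro finite_divisors_nat) simp
  then show ?thesis by (rule rev_finite_subset) (auto simp: dvd_nat_abs_iff)
qed

lemma finite_B: "finite B"
  unfolding B_def using N_nz h_nz by (intro finite_prime_divisors) (simp add: N_def)

lemma finite_G: "finite (G z)"
  unfolding G_def by (auto intro: finite_subset[OF _ finite_primes_le[of z]])

lemma H_ge_1: "H \<ge> 1"
  unfolding H_def by (intro prod_ge_1) auto

lemma num_roots_prime_power_le:
  "prime p \<Longrightarrow> num_roots f (p ^ j) \<le> 2 * real p ^ multiplicity (int p) N"
  using card_roots_mod_prime_power_le[OF f_eq ab cd N_nz, of p j] unfolding N_def
  by (metis of_nat_le_iff of_nat_mult of_nat_numeral of_nat_power)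

lemma num_roots_prime_power_le_2:
  assumes "p \<in> G z" shows "num_roots f (p ^ j) \<le> 2"
proof -
  have "prime p" "\<not> int p dvd N" using assms by (auto simp: G_def B_def)
  then show ?thesis using num_roots_prime_power_le[of p j] by (simp add: not_dvd_imp_multiplicity_0)
qed

lemma num_roots_le_divisors:
  assumes "m > 0" "\<And>p. prime p \<Longrightarrow> p dvd m \<Longrightarrow> p \<notin> B"
  shows "num_roots f m \<le> real (card {e. e dvd m})"
proof -
  have "coprime (int m) N"
  proof (rule ccontr)
    assume "\<not> coprime (int m) N"
    moreover have "gcd (int m) N = int (gcd m (nat \<bar>N\<bar>))" by (simp flip: gcd_int_int_eq)
    ultimately have "gcd m (nat \<bar>N\<bar>) \<noteq> 1" by (auto simp only: coprime_iff_gcd_eq_1 of_nat_1)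
    then obtain p where p: "prime p" "p dvd gcd m (nat \<bar>N\<bar>)" using prime_factor_nat by blast
    from p(2) have "p dvd m" "p dvd nat \<bar>N\<bar>" by (meson dvd_trans gcd_dvd1 gcd_dvd2)+
    then have "int p dvd N" by (simp only: dvd_nat_abs_iff)
    then have "p \<in> B" using p by (simp add: B_def)
    then show False using assms(2) p \<open>p dvd m\<close> by blast
  qed
  then show ?thesis using card_roots_mod_le_divisors[OF f_eq ab cd assms(1)] by (simp add: N_def)
qed

text \<open>With s = sqrt p and P the exact power of p in N, the left side is 1 + 2 P / (s - 1). If
  p does not divide N, it divides h and P = 1; the required 2 / (s - 1) <= 7 / s is equivalent to s
  >= 7/5, which holds already at p = 2, and this is the 7 of the theorem. If p divides N and p >=
  11, then s >= 33/10 and P >= 11 give a bound P without any constant. The finitely many p < 11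
  dividing N cost a factor 7 each.\<close>

lemma local_factor_le:
  assumes "p \<in> B"
  shows "1 + 2 * real p ^ multiplicity (int p) N * (1 / sqrt p / (1 - 1 / sqrt p))
    \<le> (if p < 11 then 7 else 1) * real p ^ multiplicity (int p) N * (if int p dvd h then 1 + 7 / sqrt (real p) else 1)"
proof -
  define s where "s = sqrt (real p)"
  define P where "P = real p ^ multiplicity (int p) N"
  have p: "prime p" "p \<ge> 2" using assms prime_ge_2_nat by (auto simp: B_def)
  have s: "s \<ge> 7 / 5" unfolding s_def using p by (intro real_le_rsqrt) (simp add: power2_eq_square)
  have x: "1 / s / (1 - 1 / s) = 1 / (s - 1)" using s by (simp add: field_simps)
  have P1: "P \<ge> 1" unfolding P_def using p by (intro one_le_power) auto
  have t: "1 \<le> (if int p dvd h then 1 + 7 / s else 1)" using s by auto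
  have le5: "2 * P * (1 / (s - 1)) \<le> 5 * P"
  proof -
    have "1 / (s - 1) \<le> 5 / 2" using s by (simp add: field_simps)
    then have "2 * P * (1 / (s - 1)) \<le> 2 * P * (5 / 2)" using P1 by (intro mult_left_mono) auto
    then show ?thesis by simp
  qed
  have "1 + 2 * P * (1 / (s - 1)) \<le> (if p < 11 then 7 else 1) * P * (if int p dvd h then 1 + 7 / s else 1)"
  proof (cases "int p dvd N")
    case True
    then have n: "multiplicity (int p) N > 0" using p N_nz by (simp add: N_def multiplicity_gt_zero_iff)
    have "1 + 2 * P * (1 / (s - 1)) \<le> (if p < 11 then 7 else 1) * P"
    proof (cases "p < 11")
      case False
      then have "s \<ge> 33 / 10" unfolding s_def by (intro real_le_rsqrt) (simp add: power2_eq_square)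
      then have "1 / (s - 1) \<le> 10 / 23" by (simp add: field_simps)
      then have "2 * P * (1 / (s - 1)) \<le> 2 * P * (10 / 23)" using P1 by (intro mult_left_mono) auto
      moreover have "real p ^ 1 \<le> P" unfolding P_def using p n by (intro power_increasing) auto
      then have "P \<ge> 11" using False by simp
      ultimately show ?thesis using False by simp
    qed (use le5 P1 in simp)
    also have "\<dots> \<le> (if p < 11 then 7 else 1) * P * (if int p dvd h then 1 + 7 / s else 1)"
      using t P1 by (intro mult_le_cancel_left1[THEN iffD2]) auto
    finally show ?thesis .
  next
    case False
    then have "P = 1" unfolding P_def by (simp add: not_dvd_imp_multiplicity_0)
    have "int p dvd h" using assms False p by (auto simp: B_def prime_dvd_mult_iff)
    have "2 * (1 / (s - 1)) \<le> 7 / s" using s by (simp add: field_simps)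
    then have "1 + 2 * P * (1 / (s - 1)) \<le> 1 * P * (1 + 7 / s)" using \<open>P = 1\<close> by simp
    also have "\<dots> \<le> (if p < 11 then 7 else 1) * P * (1 + 7 / s)"
      using P1 s by (intro mult_right_mono) auto
    finally show ?thesis using \<open>int p dvd h\<close> by simp
  qed
  then show ?thesis unfolding s_def[symmetric] P_def[symmetric] x .
qed

text \<open>The weight 1 / sqrt q instead of 1 / q leaves a spare factor sqrt q, which disposes of
  large q later. The factor |N| appears because the powers of p dividing N exactly, multiplied over
  all p in \<open>B\<close>, give a divisor of N.\<close>

lemma sum_bad_part_le:
  assumes "finite A" "A \<subseteq> smooth_over B"
  shows "(\<Sum>q\<in>A. num_roots f q / sqrt (real q)) \<le> 7 ^ 11 * \<bar>real_of_int N\<bar> * H"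
proof -
  let ?n = "\<lambda>p. multiplicity (int p) N"
  have "(\<Sum>q\<in>A. num_roots f q / sqrt (real q))
      \<le> (\<Prod>p\<in>B. 1 + 2 * real p ^ ?n p * (1 / sqrt p / (1 - 1 / sqrt p)))"
  proof (rule sum_smooth_le_prod[OF finite_B _ _ _ _ _ assms])
    fix m n :: nat assume "m > 0" "n > 0" "coprime m n"
    then show "num_roots f (m * n) / sqrt (real (m * n)) \<le> num_roots f m / sqrt (real m) * (num_roots f n / sqrt (real n))"
      by (simp add: num_roots_mult real_sqrt_mult)
  next
    fix p J assume "p \<in> B"
    then have p: "prime p" by (simp add: B_def)
    then have "real p > 1" using prime_gt_1_nat by simp
    then have x: "0 \<le> 1 / sqrt p" "1 / sqrt p < 1" by simp_all
    have "(\<Sum>j\<le>J. num_roots f (p ^ j) / sqrt (real (p ^ j))) = (\<Sum>j\<le>J. num_roots f (p ^ j) * (1 / sqrt p) ^ j)"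
      by (simp add: real_sqrt_power power_divide)
    also have "\<dots> \<le> 1 + 2 * real p ^ ?n p * (1 / sqrt p / (1 - 1 / sqrt p))"
      by (rule sum_power_weighted_le[OF x]) (use num_roots_prime_power_le[OF p] in auto)
    finally show "(\<Sum>j\<le>J. num_roots f (p ^ j) / sqrt (real (p ^ j))) \<le> 1 + 2 * real p ^ ?n p * (1 / sqrt p / (1 - 1 / sqrt p))" .
  qed (auto simp: B_def)
  also have "\<dots> \<le> (\<Prod>p\<in>B. (if p < 11 then 7 else 1) * real p ^ ?n p * (if int p dvd h then 1 + 7 / sqrt (real p) else 1))"
  proof (rule prod_mono)
    fix p assume p: "p \<in> B"
    then have "prime p" by (simp add: B_def)
    then have "sqrt p > 1" using prime_gt_1_nat by simp
    then have "0 \<le> 1 + 2 * real p ^ ?n p * (1 / sqrt p / (1 - 1 / sqrt p))"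
      by (intro add_nonneg_nonneg mult_nonneg_nonneg divide_nonneg_nonneg) auto
    with local_factor_le[OF p]
    show "0 \<le> 1 + 2 * real p ^ ?n p * (1 / sqrt p / (1 - 1 / sqrt p)) \<and>
      1 + 2 * real p ^ ?n p * (1 / sqrt p / (1 - 1 / sqrt p)) \<le>
      (if p < 11 then 7 else 1) * real p ^ ?n p * (if int p dvd h then 1 + 7 / sqrt (real p) else 1)" by blast
  qed
  also have "\<dots> = (\<Prod>p\<in>B. if p < 11 then 7 else 1) * (\<Prod>p\<in>B. real p ^ ?n p) * (\<Prod>p\<in>B. if int p dvd h then 1 + 7 / sqrt (real p) else 1)"
    by (simp add: prod.distrib)
  also have "\<dots> \<le> 7 ^ 11 * \<bar>real_of_int N\<bar> * H"
  proof (intro mult_mono)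
    have "(\<Prod>p\<in>B. if p < 11 then 7 else 1 :: real) = (\<Prod>p\<in>B \<inter> {..<11}. 7)"
      using finite_B by (simp add: prod.If_cases lessThan_def)
    also have "\<dots> = 7 ^ card (B \<inter> {..<11})" by simp
    \<comment> \<open>There are at most 11 primes below 11; this crude count is all that the
      constant records.\<close>
    also have "\<dots> \<le> 7 ^ 11" using card_mono[of "{..<11}" "B \<inter> {..<11}"] by (intro power_increasing) auto
    finally show "(\<Prod>p\<in>B. if p < 11 then 7 else 1 :: real) \<le> 7 ^ 11" .
    have "(\<Prod>p\<in>B. p ^ ?n p) dvd nat \<bar>N\<bar>"
    proof (rule prod_coprime_dvd[OF finite_B])
      fix p assume "p \<in> B"
      have "int p ^ ?n p dvd N" by (rule multiplicity_dvd)
      then show "p ^ ?n p dvd nat \<bar>N\<bar>" by (simp add: dvd_nat_abs_iff)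
    qed (auto simp: B_def primes_coprime)
    then have "(\<Prod>p\<in>B. p ^ ?n p) \<le> nat \<bar>N\<bar>" using N_nz by (intro dvd_imp_le) (auto simp: N_def)
    then have "real (\<Prod>p\<in>B. p ^ ?n p) \<le> real (nat \<bar>N\<bar>)" by (simp only: of_nat_le_iff)
    then show "(\<Prod>p\<in>B. real p ^ ?n p) \<le> \<bar>real_of_int N\<bar>" by simp
    have "{p. prime p \<and> int p dvd h} = B \<inter> {p. int p dvd h}" by (auto simp: B_def)
    then show "(\<Prod>p\<in>B. if int p dvd h then 1 + 7 / sqrt (real p) else 1) \<le> H"
      unfolding H_def using finite_B by (simp add: prod.If_cases)
  qed (auto intro!: prod_nonneg mult_nonneg_nonneg)
  finally show ?thesis .
qed

lemma sum_bad_part_inverse_le: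
  assumes "finite A" "A \<subseteq> smooth_over B"
  shows "(\<Sum>q\<in>A. num_roots f q / real q) \<le> 7 ^ 11 * \<bar>real_of_int N\<bar> * H"
proof -
  have "(\<Sum>q\<in>A. num_roots f q / real q) \<le> (\<Sum>q\<in>A. num_roots f q / sqrt (real q))"
  proof (intro sum_mono divide_left_mono)
    fix q assume "q \<in> A"
    then have q: "real q \<ge> 1" using assms(2) by (auto simp: smooth_over_def)
    have "sqrt (real q) * 1 \<le> sqrt (real q) * sqrt (real q)" using q by (intro mult_left_mono) auto
    then show "sqrt (real q) \<le> real q" by simp
    show "0 < real q * sqrt (real q)" using q by simp
  qed simp
  also have "\<dots> \<le> 7 ^ 11 * \<bar>real_of_int N\<bar> * H" by (rule sum_bad_part_le[OF assms])
  finally show ?thesis .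
qed

lemma sum_good_inverse_prime_le:
  assumes "y \<ge> 2" shows "(\<Sum>p\<in>G y. 1 / real p) \<le> ln (ln y) + K0"
proof -
  have "(\<Sum>p\<in>G y. 1 / real p) \<le> (\<Sum>p | prime p \<and> real p \<le> y. 1 / real p)"
    by (rule sum_mono2[OF finite_primes_le]) (auto simp: G_def)
  then show ?thesis using K0(2)[OF assms] by linarith
qed

lemma prod_good_le:
  assumes "y \<ge> 2" "t \<ge> 0" and g: "\<And>p. p \<in> G y \<Longrightarrow> 0 \<le> g p \<and> g p \<le> t / real p"
  shows "(\<Prod>p\<in>G y. 1 + g p) \<le> exp (t * (ln (ln y) + K0))"
proof -
  have "(\<Prod>p\<in>G y. 1 + g p) \<le> exp (sum g (G y))" using g by (intro prod_le_exp_sum) auto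
  also have "sum g (G y) \<le> (\<Sum>p\<in>G y. t / real p)" using g by (intro sum_mono) auto
  also have "\<dots> = t * (\<Sum>p\<in>G y. 1 / real p)" by (simp add: sum_distrib_left)
  also have "\<dots> \<le> t * (ln (ln y) + K0)"
    using assms(2) sum_good_inverse_prime_le[OF assms(1)] by (intro mult_left_mono)
  finally show ?thesis by simp
qed

text \<open>A generous power (ln y)^4: the local factor 2 / (p - 1) is replaced by 4 / p. The bound
  is applied only where a saving that outweighs these powers is available.\<close>

lemma sum_good_le:
  assumes "finite A" "A \<subseteq> smooth_over (G y)" "y \<ge> 2"
  shows "(\<Sum>m\<in>A. num_roots f m / real m) \<le> exp (4 * (ln (ln y) + K0))"
proof -
  have "(\<Sum>m\<in>A. num_roots f m / real m) \<le> (\<Prod>p\<in>G y. 1 + 2 * (1 / real p / (1 - 1 / real p)))"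
  proof (rule sum_smooth_le_prod[OF finite_G _ _ _ _ _ assms(1,2)])
    fix p J assume G: "p \<in> G y"
    then have "real p > 1" using prime_gt_1_nat by (simp add: G_def)
    then have x: "0 \<le> 1 / real p" "1 / real p < 1" by simp_all
    have "(\<Sum>j\<le>J. num_roots f (p ^ j) / real (p ^ j)) = (\<Sum>j\<le>J. num_roots f (p ^ j) * (1 / real p) ^ j)"
      by (simp add: power_divide)
    also have "\<dots> \<le> 1 + 2 * (1 / real p / (1 - 1 / real p))"
      by (rule sum_power_weighted_le[OF x]) (use num_roots_prime_power_le_2[OF G] in auto)
    finally show "(\<Sum>j\<le>J. num_roots f (p ^ j) / real (p ^ j)) \<le> 1 + 2 * (1 / real p / (1 - 1 / real p))" .
  qed (auto simp: G_def num_roots_mult)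
  also have "\<dots> \<le> exp (4 * (ln (ln y) + K0))"
  proof (rule prod_good_le[OF assms(3)])
    fix p assume "p \<in> G y"
    then have "real p \<ge> 2" using prime_ge_2_nat by (auto simp: G_def)
    then show "0 \<le> 2 * (1 / real p / (1 - 1 / real p)) \<and> 2 * (1 / real p / (1 - 1 / real p)) \<le> 4 / real p"
      by (auto simp: field_simps)
  qed simp
  finally show ?thesis .
qed

text \<open>With \<delta> = 1 / ln z, every prime p <= z has p^\<delta> <= e, so the twist by
  m^\<delta> only changes constants. Write t for p^(\<delta> - 1). Then \<delta> <= 1/2 gives t <= 1
  / sqrt 2 <= 5/7, hence 2 t / (1 - t) <= 7 t, and e <= 20/7 turns 7 t into at most 20 / p.\<close>

lemma sum_smooth_rankin_le:
  assumes "finite A" "A \<subseteq> smooth_over (G z)" "ln z \<ge> 2" and z0: "z > 0"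
  shows "(\<Sum>m\<in>A. num_roots f m * real m powr (1 / ln z - 1)) \<le> exp (20 * (ln (ln z) + K0))"
proof -
  define \<delta> where "\<delta> = 1 / ln z"
  have \<delta>: "0 < \<delta>" "\<delta> \<le> 1 / 2" using assms(3) unfolding \<delta>_def by (auto simp: field_simps)
  have z2: "z \<ge> 2"
  proof -
    have "exp 2 \<le> z" using assms(3) z0 by (metis exp_le_cancel_iff exp_ln)
    then show ?thesis using exp_ge_add_one_self[of 2] by linarith
  qed
  have x: "0 \<le> real p powr (\<delta> - 1)" "real p powr (\<delta> - 1) \<le> 5 / 7" "real p powr (\<delta> - 1) \<le> 20 / 7 / real p" if "p \<in> G z" for p
  proof -
    have p: "real p \<ge> 2" "real p \<le> z" using that prime_ge_2_nat by (auto simp: G_def)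
    show "0 \<le> real p powr (\<delta> - 1)" by simp
    have "real p powr (\<delta> - 1) \<le> real p powr (- (1 / 2))" using \<delta> p by (intro powr_mono) auto
    also have "\<dots> \<le> 2 powr (- (1 / 2))" using p by (intro powr_mono2') auto
    also have "\<dots> = 1 / sqrt 2" by (simp add: powr_minus powr_half_sqrt inverse_eq_divide)
    also have "\<dots> \<le> 5 / 7"
    proof -
      have "7 / 5 \<le> sqrt 2" by (intro real_le_rsqrt) (simp add: power2_eq_square)
      then show ?thesis by (simp add: field_simps)
    qed
    finally show "real p powr (\<delta> - 1) \<le> 5 / 7" .
    have "real p powr (\<delta> - 1) = real p powr \<delta> / real p" using p by (simp add: powr_diff)
    also have "real p powr \<delta> \<le> z powr \<delta>" using p \<delta> by (intro powr_mono2) auto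
    also have "z powr \<delta> = exp 1" using z2 assms(3) unfolding \<delta>_def by (simp add: powr_def)
    also have "exp 1 \<le> 20 / (7::real)" using e_less_272 by linarith
    finally show "real p powr (\<delta> - 1) \<le> 20 / 7 / real p" using p by (simp add: divide_right_mono)
  qed
  have "(\<Sum>m\<in>A. num_roots f m * real m powr (\<delta> - 1)) \<le> (\<Prod>p\<in>G z. 1 + 2 * (real p powr (\<delta> - 1) / (1 - real p powr (\<delta> - 1))))"
  proof (rule sum_smooth_le_prod[OF finite_G _ _ _ _ _ assms(1,2)])
    fix m n :: nat assume "m > 0" "n > 0" "coprime m n"
    then show "num_roots f (m * n) * real (m * n) powr (\<delta> - 1) \<le> num_roots f m * real m powr (\<delta> - 1) * (num_roots f n * real n powr (\<delta> - 1))"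
      by (simp add: num_roots_mult powr_mult)
  next
    fix p J assume G: "p \<in> G z"
    then have p0: "real p > 0" using prime_gt_0_nat by (simp add: G_def)
    have "(\<Sum>j\<le>J. num_roots f (p ^ j) * real (p ^ j) powr (\<delta> - 1)) = (\<Sum>j\<le>J. num_roots f (p ^ j) * (real p powr (\<delta> - 1)) ^ j)"
    proof (intro sum.cong refl)
      fix j
      have "real (p ^ j) powr (\<delta> - 1) = (real p powr real j) powr (\<delta> - 1)" using p0 by (simp add: powr_realpow)
      also have "\<dots> = (real p powr (\<delta> - 1)) powr real j" by (simp add: powr_powr mult.commute)
      also have "\<dots> = (real p powr (\<delta> - 1)) ^ j" using p0 by (simp add: powr_realpow)
      finally show "num_roots f (p ^ j) * real (p ^ j) powr (\<delta> - 1) = num_roots f (p ^ j) * (real p powr (\<delta> - 1)) ^ j" by simp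
    qed
    also have "\<dots> \<le> 1 + 2 * (real p powr (\<delta> - 1) / (1 - real p powr (\<delta> - 1)))"
      by (rule sum_power_weighted_le) (use num_roots_prime_power_le_2[OF G] x(2)[OF G] in auto)
    finally show "(\<Sum>j\<le>J. num_roots f (p ^ j) * real (p ^ j) powr (\<delta> - 1)) \<le> 1 + 2 * (real p powr (\<delta> - 1) / (1 - real p powr (\<delta> - 1)))" .
  qed (auto simp: G_def)
  also have "\<dots> \<le> exp (20 * (ln (ln z) + K0))"
  proof (rule prod_good_le[OF z2])
    fix p assume G: "p \<in> G z"
    define t where "t = real p powr (\<delta> - 1)"
    have t: "0 \<le> t" "t \<le> 5 / 7" "t \<le> 20 / 7 / real p" unfolding t_def using x[OF G] by auto
    have "2 * (t / (1 - t)) \<le> 7 * t"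
    proof -
      have "t / (1 - t) \<le> t / (2 / 7)" using t by (intro divide_left_mono) auto
      then have "t / (1 - t) \<le> 7 / 2 * t" by simp
      then show ?thesis by linarith
    qed
    also have "\<dots> \<le> 20 / real p" using t(3) by simp
    finally show "0 \<le> 2 * (real p powr (\<delta> - 1) / (1 - real p powr (\<delta> - 1))) \<and>
      2 * (real p powr (\<delta> - 1) / (1 - real p powr (\<delta> - 1))) \<le> 20 / real p"
      using t unfolding t_def[symmetric] by simp
  qed simp
  finally show ?thesis unfolding \<delta>_def .
qed

text \<open>Here the exponent of the logarithm must be sharp, so the coefficient sqrt 2 of 1 / p is
  kept exactly. The rest of the local factor, including the effect of \<open>euler_weight\<close>,
  is at most 8 sqrt 2 / p^2 and sums to the constant 16 sqrt 2.\<close>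

lemma sum_weighted_sqrt_le:
  assumes "finite A" "A \<subseteq> smooth_over (G y)" "y \<ge> 2"
  shows "(\<Sum>m\<in>A. euler_weight m * sqrt (num_roots f m) / real m) \<le> exp (sqrt 2 * (ln (ln y) + K0) + 16 * sqrt 2)"
proof -
  let ?g = "\<lambda>p. sqrt 2 / (1 - 1 / real p) * (1 / real p / (1 - 1 / real p))"
  have w0: "0 \<le> euler_weight m" for m using euler_weight_ge_1[of m] by linarith
  have "(\<Sum>m\<in>A. euler_weight m * sqrt (num_roots f m) / real m) \<le> (\<Prod>p\<in>G y. 1 + ?g p)"
  proof (rule sum_smooth_le_prod[OF finite_G _ _ _ _ _ assms(1,2)])
    fix p J assume G: "p \<in> G y"
    then have p: "prime p" by (simp add: G_def)
    then have "real p > 1" using prime_gt_1_nat by simp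
    then have x: "0 \<le> 1 / real p" "1 / real p < 1" by simp_all
    have "(\<Sum>j\<le>J. euler_weight (p ^ j) * sqrt (num_roots f (p ^ j)) / real (p ^ j))
        = (\<Sum>j\<le>J. (euler_weight (p ^ j) * sqrt (num_roots f (p ^ j))) * (1 / real p) ^ j)"
      by (simp add: power_divide)
    also have "\<dots> \<le> 1 + ?g p"
    proof (rule sum_power_weighted_le[OF x])
      fix j :: nat assume "j > 0"
      then show "euler_weight (p ^ j) * sqrt (num_roots f (p ^ j)) \<le> sqrt 2 / (1 - 1 / real p)"
        using num_roots_prime_power_le_2[OF G, of j] x p
        by (simp add: euler_weight_prime_power divide_right_mono)
    qed (use x in auto)
    finally show "(\<Sum>j\<le>J. euler_weight (p ^ j) * sqrt (num_roots f (p ^ j)) / real (p ^ j)) \<le> 1 + ?g p" .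
  qed (auto simp: G_def num_roots_mult euler_weight_mult real_sqrt_mult w0 mult_ac)
  also have "\<dots> \<le> exp (\<Sum>p\<in>G y. ?g p)"
  proof (rule prod_le_exp_sum)
    fix p assume "p \<in> G y"
    then have "real p > 1" using prime_gt_1_nat by (auto simp: G_def)
    then show "0 \<le> ?g p" by simp
  qed
  also have "(\<Sum>p\<in>G y. ?g p) \<le> (\<Sum>p\<in>G y. sqrt 2 * (1 / real p) + 8 * sqrt 2 * (1 / (real p)\<^sup>2))"
  proof (rule sum_mono)
    fix p assume "p \<in> G y"
    define t where "t = real p"
    have t: "t \<ge> 2" using \<open>p \<in> G y\<close> prime_ge_2_nat by (auto simp: G_def t_def)
    have "t / (t - 1)\<^sup>2 \<le> 1 / t + 8 * (1 / t\<^sup>2)"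
    proof -
      have "t ^ 3 \<le> (t + 8) * (t - 1)\<^sup>2"
      proof -
        have "(t + 8) * (t - 1)\<^sup>2 - t ^ 3 = 6 * t * (t - 2) + (8 - 3 * t)"
          by (simp add: power2_eq_square power3_eq_cube algebra_simps)
        moreover have "6 * t * (t - 2) + (8 - 3 * t) \<ge> 0"
        proof -
          \<comment> \<open>Expanding around t = 2 makes all coefficients positive, and t >= 2 for a
            prime.\<close>
          have "6 * t * (t - 2) + (8 - 3 * t) = 6 * (t - 2)\<^sup>2 + 9 * (t - 2) + 2" by (simp add: power2_eq_square algebra_simps)
          moreover have "0 \<le> 6 * (t - 2)\<^sup>2 + 9 * (t - 2) + 2"
            using t by (intro add_nonneg_nonneg) auto
          ultimately show ?thesis by (simp only:)
        qed
        ultimately show ?thesis by linarith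
      qed
      then show ?thesis using t by (simp add: field_simps power2_eq_square power3_eq_cube)
    qed
    then have "sqrt 2 * (t / (t - 1)\<^sup>2) \<le> sqrt 2 * (1 / t + 8 * (1 / t\<^sup>2))" by (intro mult_left_mono) auto
    moreover have "?g p = sqrt 2 * (t / (t - 1)\<^sup>2)"
      unfolding t_def[symmetric] using t by (simp add: field_simps power2_eq_square)
    ultimately have "?g p \<le> sqrt 2 * (1 / t + 8 * (1 / t\<^sup>2))" by (simp only:)
    also have "\<dots> = sqrt 2 * (1 / t) + 8 * sqrt 2 * (1 / t\<^sup>2)"
      by (simp only: distrib_left mult_ac)
    finally show "?g p \<le> sqrt 2 * (1 / real p) + 8 * sqrt 2 * (1 / (real p)\<^sup>2)"
      unfolding t_def .
  qed
  also have "\<dots> = sqrt 2 * (\<Sum>p\<in>G y. 1 / real p) + 8 * sqrt 2 * (\<Sum>p\<in>G y. 1 / (real p)\<^sup>2)"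
    by (simp add: sum.distrib sum_distrib_left)
  also have "\<dots> \<le> sqrt 2 * (ln (ln y) + K0) + 8 * sqrt 2 * 2"
  proof (intro add_mono mult_left_mono sum_good_inverse_prime_le assms sum_inverse_squares_le finite_G)
    show "0 \<notin> G y" by (auto simp: G_def)
  qed auto
  finally show ?thesis by simp
qed

end

section \<open>Hooley's decomposition\<close>

text \<open>The assumptions hold for all large y. \<open>LL\<close> and \<open>L5\<close> are used
  by the sieve, \<open>L192\<close> says ln z >= 2 as Rankin's trick requires, and \<open>L8\<close>
  lets y^(1/16) absorb the eight logarithms lost when q is large.\<close>

locale hooley_large = hooley +
  fixes y :: real
  assumes y1: "y > 1" and LL: "ln (ln y) \<ge> 1" and L5: "ln y \<le> exp (ln y / 5)"
    and L192: "ln y / (192 * ln (ln y)) \<ge> 2" and L8: "ln y ^ 8 \<le> exp (ln y / 16)"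
begin

definition L :: real where "L = ln y"

definition z :: real where "z = exp (L / (192 * ln L))"

definition R :: "nat set" where "R = {p. prime p \<and> z < real p \<and> real p \<le> y \<and> p \<notin> B}"

definition K2 :: real where "K2 = exp (K0 + 4) * 192"

lemma lnL: "ln L \<ge> 1" using LL by (simp add: L_def)

lemma L_pos: "L > 0" using y1 by (simp add: L_def)

lemma L_ge_1: "L \<ge> 1"
  using ln_le_minus_one[OF L_pos] lnL by linarith

lemma L_gt_1: "L > 1"
  using ln_le_minus_one[OF L_pos] lnL by linarith

lemma y_eq: "y = exp L" using y1 by (simp add: L_def)

lemma ln_z: "ln z = L / (192 * ln L)" by (simp add: z_def)

lemma ln_z_ge_2: "ln z \<ge> 2" using L192 by (simp add: ln_z L_def)

lemma z_pos: "z > 0" by (simp add: z_def)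

lemma ln_z_le: "ln z \<le> L"
proof -
  have "L / (192 * ln L) \<le> L / 1" using lnL L_gt_1 by (intro divide_left_mono) auto
  then show ?thesis by (simp add: ln_z)
qed

lemma z_le_y: "z \<le> y"
proof -
  have "z \<le> exp L" using ln_z_le by (simp add: ln_z z_def)
  also have "exp L = y" by (rule y_eq[symmetric])
  finally show ?thesis .
qed

lemma z_ge_2: "z \<ge> 2"
proof -
  have "exp 2 \<le> z" using ln_z_ge_2 z_pos by (metis exp_le_cancel_iff exp_ln)
  then show ?thesis using exp_ge_add_one_self[of 2] by linarith
qed

lemma y_ge_2: "y \<ge> 2" using z_ge_2 z_le_y by linarith

lemma K2_pos: "K2 > 0" by (simp add: K2_def)

text \<open>The Euler product over (z, y] is the product up to y, at most L times a constant by
  Mertens, divided by the product up to z, at least ln z. The quotient L / ln z is 192 ln L. The 4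
  in \<open>K2\<close> is twice the bound 2 for the sum of 1 / p^2.\<close>

lemma sum_rough_inverse_le:
  assumes "finite A" "A \<subseteq> smooth_over {p. prime p \<and> z < real p \<and> real p \<le> y}"
  shows "(\<Sum>d\<in>A. 1 / real d) \<le> K2 * ln L"
proof -
  let ?Q = "{p::nat. prime p \<and> z < real p \<and> real p \<le> y}"
  let ?Z = "{p::nat. prime p \<and> real p \<le> z}" and ?Y = "{p::nat. prime p \<and> real p \<le> y}"
  have fin: "finite ?Q" "finite ?Z" by (auto intro: finite_subset[OF _ finite_primes_le[of y]] finite_primes_le)
  have un: "?Y = ?Z \<union> ?Q" using z_le_y by auto
  have "(\<Sum>d\<in>A. 1 / real d) \<le> (\<Prod>p\<in>?Q. 1 / (1 - 1 / real p))"
    by (rule sum_smooth_inverse_le[OF fin(1) _ assms]) auto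
  also have "\<dots> = (\<Prod>p\<in>?Y. 1 / (1 - 1 / real p)) * (\<Prod>p\<in>?Z. 1 - 1 / real p)"
  proof -
    have "(\<Prod>p\<in>?Y. 1 / (1 - 1 / real p)) = (\<Prod>p\<in>?Z. 1 / (1 - 1 / real p)) * (\<Prod>p\<in>?Q. 1 / (1 - 1 / real p))"
      unfolding un using fin by (intro prod.union_disjoint) auto
    moreover have "(\<Prod>p\<in>?Z. 1 - 1 / real p) > 0" by (intro prod_pos) (auto dest: prime_gt_1_nat)
    ultimately show ?thesis by (simp add: prod_dividef)
  qed
  also have "\<dots> \<le> exp (ln L + K0 + 4) * (1 / ln z)"
  proof (intro mult_mono)
    show "(\<Prod>p\<in>?Z. 1 - 1 / real p) \<le> 1 / ln z"
      using z_ge_2 by (intro prod_one_minus_inverse_prime_le) auto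
    have ge2: "real p \<ge> 2" if "p \<in> ?Y" for p using that prime_ge_2_nat by auto
    have "(\<Prod>p\<in>?Y. 1 / (1 - 1 / real p)) = (\<Prod>p\<in>?Y. 1 + 1 / (real p - 1))"
    proof (intro prod.cong refl)
      fix p assume "p \<in> ?Y"
      then show "1 / (1 - 1 / real p) = 1 + 1 / (real p - 1)" using ge2[of p] by (simp add: field_simps)
    qed
    also have "\<dots> \<le> exp (\<Sum>p\<in>?Y. 1 / (real p - 1))"
    proof (rule prod_le_exp_sum)
      fix p assume "p \<in> ?Y"
      then show "0 \<le> 1 / (real p - 1)" using ge2[of p] by simp
    qed
    also have "(\<Sum>p\<in>?Y. 1 / (real p - 1)) \<le> (\<Sum>p\<in>?Y. 1 / real p + 2 * (1 / (real p)\<^sup>2))"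
    proof (rule sum_mono)
      fix p assume "p \<in> ?Y"
      then have t: "real p \<ge> 2" by (rule ge2)
      have "1 / (real p - 1) - 1 / real p = 1 / (real p * (real p - 1))" using t by (simp add: field_simps)
      also have "\<dots> \<le> 1 / (real p * (real p / 2))" using t by (intro divide_left_mono mult_left_mono) auto
      also have "\<dots> = 2 * (1 / (real p)\<^sup>2)" by (simp add: power2_eq_square)
      finally show "1 / (real p - 1) \<le> 1 / real p + 2 * (1 / (real p)\<^sup>2)" by linarith
    qed
    also have "\<dots> = (\<Sum>p\<in>?Y. 1 / real p) + 2 * (\<Sum>p\<in>?Y. 1 / (real p)\<^sup>2)"
      by (simp add: sum.distrib sum_distrib_left)
    also have "\<dots> \<le> (ln (ln y) + K0) + 2 * 2"
      using K0(2)[OF y_ge_2] sum_inverse_squares_le[OF finite_primes_le[of y]]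
      by (intro add_mono mult_left_mono) auto
    finally show "(\<Prod>p\<in>?Y. 1 / (1 - 1 / real p)) \<le> exp (ln L + K0 + 4)" by (simp add: L_def add_ac)
  qed (auto intro!: prod_nonneg dest: prime_gt_1_nat)
  also have "\<dots> = K2 * ln L"
  proof -
    have "exp (ln L + K0 + 4) = L * exp (K0 + 4)" using L_pos by (simp add: exp_add)
    then show ?thesis unfolding ln_z K2_def using L_pos by simp
  qed
  finally show ?thesis .
qed

lemma R_subset: "R \<subseteq> {p. prime p \<and> z < real p \<and> real p \<le> y}" by (auto simp: R_def)

lemma finite_bounded: "finite {v::nat. 0 < v \<and> real v \<le> X \<and> P v}"
  by (rule finite_subset[of _ "{..nat \<lfloor>X\<rfloor>}"]) (auto simp: le_nat_floor)

text \<open>Since v is coprime to N, rho(v) is at most the number of divisors of v, hence at most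
  twice the number of divisors d <= sqrt X. For fixed d the cofactor e = v / d again has no prime
  factor up to z, lies in an inverse class modulo u, and ranges up to X / d >= sqrt X, so the sieve
  applies. The sieve gives ln L / L, and the sum of 1 / d gives the second ln L.\<close>

lemma sum_num_roots_class_le:
  fixes r :: int
  assumes u: "u > 0" and X: "sqrt X / real u \<ge> exp (L / 4)"
  shows "(\<Sum>v | 0 < v \<and> real v \<le> X \<and> v \<in> smooth_over R \<and> [int v * r = 1] (mod int u). num_roots f v)
    \<le> 2 * K1 * K2 * (X / real u) * euler_weight u * ((ln L)\<^sup>2 / L)"
proof -
  define V where "V = {v. 0 < v \<and> real v \<le> X \<and> v \<in> smooth_over R \<and> [int v * r = 1] (mod int u)}"
  define D where "D = {d. 0 < d \<and> real d \<le> sqrt X \<and> d \<in> smooth_over R}"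
  have finV: "finite V" unfolding V_def by (rule finite_bounded)
  have finD: "finite D" unfolding D_def by (rule finite_bounded)
  have Xpos: "X > 0"
  proof -
    have "sqrt X / real u > 0" using X exp_gt_zero less_le_trans by blast
    then show ?thesis using u by (simp add: zero_less_divide_iff)
  qed
  have "(\<Sum>v\<in>V. num_roots f v) \<le> (\<Sum>v\<in>V. 2 * real (card {d \<in> D. d dvd v}))"
  proof (rule sum_mono)
    fix v assume "v \<in> V"
    then have v: "0 < v" "real v \<le> X" "v \<in> smooth_over R" by (auto simp: V_def)
    have "num_roots f v \<le> real (card {e. e dvd v})"
      using v by (intro num_roots_le_divisors) (auto simp: smooth_over_def R_def)
    also have "\<dots> \<le> real (2 * card {d. d dvd v \<and> d * d \<le> v})"
      using card_divisors_le[OF v(1)] by (simp only: of_nat_le_iff)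
    also have "\<dots> \<le> real (2 * card {d \<in> D. d dvd v})"
    proof -
      have "{d. d dvd v \<and> d * d \<le> v} \<subseteq> {d \<in> D. d dvd v}"
      proof
        fix d assume "d \<in> {d. d dvd v \<and> d * d \<le> v}"
        then have d: "d dvd v" "d * d \<le> v" by auto
        have "real d * real d \<le> X" using d(2) v(2) by (metis of_nat_le_iff of_nat_mult order_trans)
        then have "real d \<le> sqrt X" by (intro real_le_rsqrt) (simp add: power2_eq_square)
        then show "d \<in> {d \<in> D. d dvd v}" using d v by (auto simp: D_def intro: smooth_over_dvd dvd_pos_nat)
      qed
      then have "card {d. d dvd v \<and> d * d \<le> v} \<le> card {d \<in> D. d dvd v}"
        using finD by (intro card_mono) auto
      then show ?thesis by simp
    qed
    finally show "num_roots f v \<le> 2 * real (card {d \<in> D. d dvd v})" by simp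
  qed
  also have "\<dots> = 2 * (\<Sum>v\<in>V. \<Sum>d\<in>D. if d dvd v then 1 else 0)"
    using finD by (simp add: sum_distrib_left sum.If_cases Int_def)
  also have "\<dots> = 2 * (\<Sum>d\<in>D. real (card {v \<in> V. d dvd v}))"
    using finV by (subst sum.swap) (simp add: sum.If_cases Int_def)
  also have "\<dots> \<le> 2 * (\<Sum>d\<in>D. K1 * (X / real u) * euler_weight u * (ln L / L) * (1 / real d))"
  proof (intro mult_left_mono sum_mono)
    fix d assume "d \<in> D"
    then have d: "0 < d" "real d \<le> sqrt X" "d \<in> smooth_over R" by (auto simp: D_def)
    let ?E = "{e. 0 < e \<and> real e \<le> X / real d \<and> [int e * (int d * r) = 1] (mod int u) \<and>
        (\<forall>p. prime p \<longrightarrow> real p \<le> exp (L / (192 * ln L)) \<longrightarrow> \<not> p dvd e)}"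
    have "card {v \<in> V. d dvd v} \<le> card ?E"
    proof (rule card_inj_on_le)
      show "inj_on (\<lambda>v. v div d) {v \<in> V. d dvd v}"
        by (rule inj_onI) (metis (mono_tags, lifting) dvd_div_mult_self mem_Collect_eq)
      show "(\<lambda>v. v div d) ` {v \<in> V. d dvd v} \<subseteq> ?E"
      proof (rule image_subsetI)
        fix v assume "v \<in> {v \<in> V. d dvd v}"
        then have v: "0 < v" "real v \<le> X" "v \<in> smooth_over R" "[int v * r = 1] (mod int u)" "d dvd v"
          by (auto simp: V_def)
        then obtain e where e: "v = d * e" by (auto elim: dvdE)
        have "real e \<le> X / real d" using v(2) d(1) unfolding e by (simp add: field_simps)
        moreover have "[int e * (int d * r) = 1] (mod int u)" using v(4) unfolding e by (simp add: mult_ac)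
        moreover have "\<not> p dvd e" if "prime p" "real p \<le> exp (L / (192 * ln L))" for p
          using that v(3) unfolding e by (auto simp: smooth_over_def R_def z_def)
        moreover have "v div d = e" "e > 0" using v(1) d(1) unfolding e by auto
        ultimately show "v div d \<in> ?E" by simp
      qed
      show "finite ?E" by (rule finite_bounded)
    qed
    then have "real (card {v \<in> V. d dvd v}) \<le> real (card ?E)" by simp
    also have "\<dots> \<le> K1 * (X / real d / real u) * euler_weight u * (ln L / L)"
    proof (rule K1(2)[OF lnL _ _ u])
      show "L \<le> exp (L / 5)" using L5 by (simp add: L_def)
      show "1 \<le> L / (192 * ln L)" using ln_z_ge_2 by (simp add: ln_z)
      have "sqrt X = X / sqrt X" using Xpos by (simp add: real_div_sqrt)
      also have "\<dots> \<le> X / real d" using d Xpos by (intro divide_left_mono) auto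
      finally have "sqrt X / real u \<le> X / real d / real u" by (intro divide_right_mono) auto
      then show "exp (L / 4) \<le> X / real d / real u" using X by linarith
    qed
    also have "\<dots> = K1 * (X / real u) * euler_weight u * (ln L / L) * (1 / real d)" by simp
    finally show "real (card {v \<in> V. d dvd v}) \<le> K1 * (X / real u) * euler_weight u * (ln L / L) * (1 / real d)" .
  qed simp
  also have "\<dots> = 2 * (K1 * (X / real u) * euler_weight u * (ln L / L)) * (\<Sum>d\<in>D. 1 / real d)"
    by (simp add: sum_distrib_left)
  also have "\<dots> \<le> 2 * (K1 * (X / real u) * euler_weight u * (ln L / L)) * (K2 * ln L)"
  proof (intro mult_left_mono)
    show "(\<Sum>d\<in>D. 1 / real d) \<le> K2 * ln L"
      using finD smooth_over_mono[OF R_subset] by (intro sum_rough_inverse_le) (auto simp: D_def)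
    show "0 \<le> 2 * (K1 * (X / real u) * euler_weight u * (ln L / L))"
      using K1(1) Xpos euler_weight_ge_1[of u] L_gt_1 by (intro mult_nonneg_nonneg) auto
  qed
  also have "\<dots> = 2 * K1 * K2 * (X / real u) * euler_weight u * ((ln L)\<^sup>2 / L)"
    by (simp add: power2_eq_square)
  finally show ?thesis unfolding V_def .
qed

text \<open>The v are grouped by the inverse of q v modulo u. The bound M for the sum of rho(v) in a
  group is the same for all groups, so the root sums modulo u can be summed over the complete
  residue system; the resulting u sqrt(rho(u)) cancels the 1 / u in M.\<close>

lemma sum_rough_part_le:
  assumes q: "q \<in> smooth_over B" "real q \<le> exp (L / 8)" and u: "u \<in> smooth_over (G z)" "real u \<le> exp (L / 8)"
  shows "(\<Sum>v | 0 < v \<and> real v \<le> y / (real q * real u) \<and> v \<in> smooth_over R. norm (root_sum f h (q * u * v)))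
    \<le> num_roots f q * (2 * K1 * K2 * (y / (real q * real u)) * euler_weight u * ((ln L)\<^sup>2 / L) * sqrt (num_roots f u))"
proof -
  define X where "X = y / (real q * real u)"
  define V where "V = {v. 0 < v \<and> real v \<le> X \<and> v \<in> smooth_over R}"
  define M where "M = 2 * K1 * K2 * (X / real u) * euler_weight u * ((ln L)\<^sup>2 / L)"
  have finV: "finite V" unfolding V_def by (rule finite_bounded)
  have pos: "q > 0" "u > 0" using q u by (auto simp: smooth_over_def)
  have cop: "coprime (q * v) u" "coprime q v" "v > 0" if "v \<in> V" for v
  proof -
    have v: "v \<in> smooth_over R" "v > 0" using that by (auto simp: V_def)
    have "coprime q u" by (rule smooth_over_coprime[OF q(1) u(1)]) (auto simp: G_def)
    moreover have "coprime v u" by (rule smooth_over_coprime[OF v(1) u(1)]) (auto simp: G_def R_def)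
    ultimately show "coprime (q * v) u" by simp
    show "coprime q v" by (rule smooth_over_coprime[OF q(1) v(1)]) (auto simp: R_def)
    show "v > 0" by (rule v(2))
  qed
  have "\<exists>b<u. [int b * int (q * v) = 1] (mod int u)" if "v \<in> V" for v
  proof -
    have "coprime (int (q * v)) (int u)" using cop(1)[OF that] by (simp only: coprime_int_iff)
    then obtain x where x: "[int (q * v) * x = 1] (mod int u)" using cong_solve_coprime_int by blast
    define b where "b = nat (x mod int u)"
    have b: "int b = x mod int u" "b < u" using pos unfolding b_def by (auto simp: nat_less_iff)
    have "[int b * int (q * v) = x * int (q * v)] (mod int u)"
      unfolding b by (intro cong_mult cong_refl) (simp add: unique_euclidean_semiring_class.cong_def)
    then have "[int b * int (q * v) = 1] (mod int u)" using x by (metis cong_trans mult.commute)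
    then show ?thesis using b by blast
  qed
  then obtain b where b: "\<And>v. v \<in> V \<Longrightarrow> b v < u \<and> [int (b v) * int (q * v) = 1] (mod int u)" by metis
  have "(\<Sum>v\<in>V. norm (root_sum f h (q * u * v)))
      \<le> (\<Sum>v\<in>V. num_roots f q * (num_roots f v * norm (root_sum f (h * int (b v)) u)))"
  proof (rule sum_mono)
    fix v assume v: "v \<in> V"
    have "norm (root_sum f h (q * v * u)) \<le> num_roots f (q * v) * norm (root_sum f (h * int (b v)) u)"
      using b[OF v] pos cop(3)[OF v] by (intro norm_root_sum_mult_le) auto
    moreover have "q * v * u = q * u * v" by simp
    ultimately show "norm (root_sum f h (q * u * v)) \<le> num_roots f q * (num_roots f v * norm (root_sum f (h * int (b v)) u))"
      using num_roots_mult[OF pos(1) cop(3,2)[OF v], of f] by simp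
  qed
  also have "\<dots> = num_roots f q * (\<Sum>v\<in>V. num_roots f v * norm (root_sum f (h * int (b v)) u))"
    by (simp add: sum_distrib_left)
  also have "(\<Sum>v\<in>V. num_roots f v * norm (root_sum f (h * int (b v)) u))
      = (\<Sum>\<beta><u. \<Sum>v | v \<in> V \<and> b v = \<beta>. num_roots f v * norm (root_sum f (h * int (b v)) u))"
    by (rule sum.group[symmetric]) (use b finV in auto)
  also have "\<dots> = (\<Sum>\<beta><u. norm (root_sum f (h * int \<beta>) u) * (\<Sum>v | v \<in> V \<and> b v = \<beta>. num_roots f v))"
    by (simp add: sum_distrib_left mult.commute)
  also have "\<dots> \<le> (\<Sum>\<beta><u. norm (root_sum f (h * int \<beta>) u) * M)"
  proof (intro sum_mono mult_left_mono)
    fix \<beta>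
    have "(\<Sum>v | v \<in> V \<and> b v = \<beta>. num_roots f v)
        \<le> (\<Sum>v | 0 < v \<and> real v \<le> X \<and> v \<in> smooth_over R \<and> [int v * (int \<beta> * int q) = 1] (mod int u). num_roots f v)"
    proof (rule sum_mono2)
      show "{v \<in> V. b v = \<beta>} \<subseteq> {v. 0 < v \<and> real v \<le> X \<and> v \<in> smooth_over R \<and> [int v * (int \<beta> * int q) = 1] (mod int u)}"
      proof clarify
        fix v assume v: "v \<in> V" and \<beta>: "\<beta> = b v"
        have "[int (b v) * int (q * v) = 1] (mod int u)" using b[OF v] by blast
        moreover have "int (b v) * int (q * v) = int v * (int (b v) * int q)" by simp
        ultimately show "0 < v \<and> real v \<le> X \<and> v \<in> smooth_over R \<and> [int v * (int (b v) * int q) = 1] (mod int u)"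
          using v by (auto simp: V_def mult_ac)
      qed
    qed (auto intro: finite_bounded)
    also have "\<dots> \<le> M" unfolding M_def
    proof (rule sum_num_roots_class_le[OF pos(2)])
      \<comment> \<open>As q u <= y^(1/4), the range X is at least y^(3/4), so sqrt X / u >= y^(3/8
        - 1/8) = y^(1/4), as the sieve requires.\<close>
      have "real q * real u \<le> exp (L / 8) * exp (L / 8)" using q u by (intro mult_mono) auto
      also have "\<dots> = exp (L / 4)" by (simp flip: exp_add)
      finally have qu: "real q * real u \<le> exp (L / 4)" .
      have "exp (3 * L / 4) \<le> X"
      proof -
        have "exp (3 * L / 4) * (real q * real u) \<le> exp (3 * L / 4) * exp (L / 4)"
          using qu by (intro mult_left_mono) auto
        also have "\<dots> = exp L" by (simp flip: exp_add)
        also have "exp L = y" by (rule y_eq[symmetric])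
        finally show ?thesis unfolding X_def using pos by (simp add: pos_le_divide_eq)
      qed
      then have "sqrt (exp (3 * L / 4)) \<le> sqrt X" by simp
      moreover have "sqrt (exp (3 * L / 4)) = exp (3 * L / 8)"
        by (rule real_sqrt_unique) (auto simp: power2_eq_square simp flip: exp_add)
      ultimately have s: "exp (3 * L / 8) \<le> sqrt X" by simp
      have "exp (L / 4) * real u \<le> exp (L / 4) * exp (L / 8)" using u by (intro mult_left_mono) auto
      also have "\<dots> = exp (3 * L / 8)" by (simp flip: exp_add)
      also note s
      finally show "exp (L / 4) \<le> sqrt X / real u" using pos by (simp add: pos_le_divide_eq)
    qed
    finally show "(\<Sum>v | v \<in> V \<and> b v = \<beta>. num_roots f v) \<le> M" .
  qed simp
  also have "\<dots> = (\<Sum>\<beta><u. norm (root_sum f (h * int \<beta>) u)) * M" by (simp add: sum_distrib_right)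
  also have "\<dots> \<le> (real u * sqrt (num_roots f u)) * M"
  proof (intro mult_right_mono sum_norm_root_sum_le pos)
    show "coprime h (int u)"
    proof (rule ccontr)
      assume "\<not> coprime h (int u)"
      moreover have "gcd h (int u) = int (gcd (nat \<bar>h\<bar>) u)" by (simp flip: gcd_int_int_eq)
      ultimately have "gcd (nat \<bar>h\<bar>) u \<noteq> 1" by (auto simp only: coprime_iff_gcd_eq_1 of_nat_1)
      then obtain p where p: "prime p" "p dvd gcd (nat \<bar>h\<bar>) u" using prime_factor_nat by blast
      from p(2) have "p dvd u" "p dvd nat \<bar>h\<bar>" by (meson dvd_trans gcd_dvd1 gcd_dvd2)+
      then have "int p dvd h" by (simp only: dvd_nat_abs_iff)
      then have "p \<in> B" using p by (simp add: B_def)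
      then show False using u(1) p(1) \<open>p dvd u\<close> by (auto simp: smooth_over_def G_def)
    qed
    show "0 \<le> M" unfolding M_def X_def using K1(1) K2_pos y1 euler_weight_ge_1[of u] L_pos
      by (intro mult_nonneg_nonneg divide_nonneg_nonneg) auto
  qed
  also have "(real u * sqrt (num_roots f u)) * M
      = 2 * K1 * K2 * X * euler_weight u * ((ln L)\<^sup>2 / L) * sqrt (num_roots f u)"
    unfolding M_def using pos by simp
  finally show ?thesis unfolding V_def X_def by (simp add: mult_left_mono)
qed

section \<open>Splitting the sum over all moduli\<close>

definition Qs :: "nat set" where "Qs = {q. 0 < q \<and> real q \<le> y \<and> q \<in> smooth_over B}"
definition Us :: "nat set" where "Us = {u. 0 < u \<and> real u \<le> y \<and> u \<in> smooth_over (G z)}"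
definition Vs :: "nat set" where "Vs = {v. 0 < v \<and> real v \<le> y \<and> v \<in> smooth_over R}"

definition triples :: "(nat \<times> nat \<times> nat) set" where
  "triples = {(q, u, v). q \<in> Qs \<and> u \<in> Us \<and> v \<in> Vs \<and> real (q * u * v) \<le> y}"

lemma finite_Qs: "finite Qs" and finite_Us: "finite Us" and finite_Vs: "finite Vs"
  unfolding Qs_def Us_def Vs_def by (rule finite_bounded)+

lemma finite_triples: "finite triples"
  by (rule finite_subset[of _ "Qs \<times> Us \<times> Vs"]) (auto simp: triples_def finite_Qs finite_Us finite_Vs)

text \<open>Each k has such a factorization, so the products of the triples cover the moduli. All
  terms are norms, so further or repeated products only increase the right side.\<close>

lemma sum_norm_root_sum_triples:
  "(\<Sum>k | 0 < k \<and> real k \<le> y. norm (root_sum f h k)) \<le> (\<Sum>(q, u, v)\<in>triples. norm (root_sum f h (q * u * v)))"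
proof -
  have "{k. 0 < k \<and> real k \<le> y} \<subseteq> (\<lambda>(q, u, v). q * u * v) ` triples"
  proof
    fix k assume "k \<in> {k. 0 < k \<and> real k \<le> y}"
    then have k: "0 < k" "real k \<le> y" by auto
    have le: "real p \<le> y" if "p dvd k" for p using dvd_imp_le[OF that k(1)] k(2) by linarith
    have "k \<in> smooth_over (B \<union> (G z \<union> R))"
      using k le unfolding smooth_over_def G_def R_def by (auto simp: not_le)
    then obtain q m where qm: "k = q * m" "q \<in> smooth_over B" "m \<in> smooth_over (G z \<union> R)"
      by (rule smooth_over_split)
    from qm(3) obtain u v where uv: "m = u * v" "u \<in> smooth_over (G z)" "v \<in> smooth_over R"
      by (rule smooth_over_split)
    have "(q, u, v) \<in> triples"
      using k le qm uv unfolding triples_def Qs_def Us_def Vs_def by (auto simp: mult_ac)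
    moreover have "k = q * u * v" using qm uv by simp
    ultimately show "k \<in> (\<lambda>(q, u, v). q * u * v) ` triples" by force
  qed
  then have "(\<Sum>k | 0 < k \<and> real k \<le> y. norm (root_sum f h k)) \<le> (\<Sum>k\<in>(\<lambda>(q, u, v). q * u * v) ` triples. norm (root_sum f h k))"
    using finite_triples by (intro sum_mono2) auto
  also have "\<dots> \<le> (\<Sum>(q, u, v)\<in>triples. norm (root_sum f h (q * u * v)))"
    using sum_image_le[OF finite_triples, of "\<lambda>k. norm (root_sum f h k)" "\<lambda>(q, u, v). q * u * v"]
    by (simp add: o_def case_prod_unfold)
  finally show ?thesis .
qed

lemma norm_root_sum_triple_le:
  assumes "(q, u, v) \<in> triples"
  shows "norm (root_sum f h (q * u * v)) \<le> num_roots f q * num_roots f u * num_roots f v"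
proof -
  have s: "q \<in> smooth_over B" "u \<in> smooth_over (G z)" "v \<in> smooth_over R" "q > 0" "u > 0" "v > 0"
    using assms by (auto simp: triples_def Qs_def Us_def Vs_def)
  have "coprime q u" by (rule smooth_over_coprime[OF s(1,2)]) (auto simp: G_def)
  moreover have "coprime u v" by (rule smooth_over_coprime[OF s(2,3)]) (auto simp: G_def R_def)
  moreover have "coprime q v" by (rule smooth_over_coprime[OF s(1,3)]) (auto simp: R_def)
  ultimately have "num_roots f (q * u * v) = num_roots f q * num_roots f u * num_roots f v"
    using s by (simp add: num_roots_mult)
  then show ?thesis using norm_root_sum_le[of f h "q * u * v"] by simp
qed

definition S0 :: real where "S0 = 7 ^ 11 * \<bar>real_of_int N\<bar> * H"

lemma S0_nonneg: "S0 \<ge> 0" using H_ge_1 by (simp add: S0_def)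

lemma G_z_subset: "G z \<subseteq> G y" using z_le_y by (auto simp: G_def)

lemma sum_Vs_le: "(\<Sum>v\<in>Vs. num_roots f v / real v) \<le> exp (4 * (ln L + K0))"
proof -
  have "R \<subseteq> G y" by (auto simp: R_def G_def)
  then have "Vs \<subseteq> smooth_over (G y)"
    using smooth_over_mono[of R "G y"] unfolding Vs_def by auto
  from sum_good_le[OF finite_Vs this y_ge_2] show ?thesis by (simp add: L_def)
qed

lemma sum_Us_le: "(\<Sum>u\<in>Us. num_roots f u / real u) \<le> exp (4 * (ln L + K0))"
proof -
  have "Us \<subseteq> smooth_over (G y)"
    using smooth_over_mono[OF G_z_subset] unfolding Us_def by auto
  from sum_good_le[OF finite_Us this y_ge_2] show ?thesis by (simp add: L_def)
qed

lemma sum_product3: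
  fixes f1 f2 f3 :: "nat \<Rightarrow> real"
  shows "(\<Sum>(q, u, v)\<in>A \<times> B' \<times> C. t * f1 q * f2 u * f3 v) = t * sum f1 A * sum f2 B' * sum f3 C"
  by (simp add: sum.cartesian_product[symmetric] sum_distrib_left sum_distrib_right mult_ac)

text \<open>For q > y^(1/8) one has sqrt q y^(-1/16) >= 1, and y / (q u v) >= 1. Multiplying each
  term by both factors gives a sum that separates. The sums over u and v contribute L^4 each, and
  y^(-1/16) absorbs this L^8.\<close>

lemma sum_large_bad_part_le:
  "(\<Sum>(q, u, v) | (q, u, v) \<in> triples \<and> real q > exp (L / 8). norm (root_sum f h (q * u * v)))
    \<le> y * S0 * exp (8 * K0)"
proof -
  have "(\<Sum>(q, u, v) | (q, u, v) \<in> triples \<and> real q > exp (L / 8). norm (root_sum f h (q * u * v)))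
      \<le> (\<Sum>(q, u, v) | (q, u, v) \<in> triples \<and> real q > exp (L / 8).
        (y * exp (- (L / 16))) * (num_roots f q / sqrt (real q)) * (num_roots f u / real u) * (num_roots f v / real v))"
  proof (rule sum_mono, clarify)
    fix q u v assume t: "(q, u, v) \<in> triples" and q: "real q > exp (L / 8)"
    have pos: "real q > 0" "real u > 0" "real v > 0" and le: "real q * real u * real v \<le> y"
      using t by (auto simp: triples_def Qs_def Us_def Vs_def)
    have "exp (L / 16) \<le> sqrt (real q)"
    proof (rule real_le_rsqrt)
      have "(exp (L / 16))\<^sup>2 = exp (L / 8)" by (simp add: power2_eq_square flip: exp_add)
      then show "(exp (L / 16))\<^sup>2 \<le> real q" using q by simp
    qed
    then have "sqrt (real q) * exp (- (L / 16)) \<ge> 1" by (simp add: exp_minus field_simps)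
    then have "real q * real u * real v * 1 \<le> y * (sqrt (real q) * exp (- (L / 16)))"
      using le pos y1 by (intro mult_mono) auto
    also have "\<dots> = (y * exp (- (L / 16)) / sqrt (real q)) * real q"
      using pos by (simp add: field_simps)
    finally have "(real u * real v) * real q \<le> (y * exp (- (L / 16)) / sqrt (real q)) * real q"
      by (simp only: mult_1_right mult_ac)
    then have "real u * real v \<le> y * exp (- (L / 16)) / sqrt (real q)"
      using pos(1) by (rule mult_right_le_imp_le)
    then have 1: "1 \<le> y * exp (- (L / 16)) / sqrt (real q) / (real u * real v)"
      using mult_pos_pos[OF pos(2,3)] by (simp only: pos_le_divide_eq mult_1_left)
    have "norm (root_sum f h (q * u * v)) \<le> (num_roots f q * num_roots f u * num_roots f v) * 1"
      using norm_root_sum_triple_le[OF t] by simp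
    also have "\<dots> \<le> (num_roots f q * num_roots f u * num_roots f v) * (y * exp (- (L / 16)) / sqrt (real q) / (real u * real v))"
      using 1 by (intro mult_left_mono) auto
    also have "\<dots> = (y * exp (- (L / 16))) * (num_roots f q / sqrt (real q)) * (num_roots f u / real u) * (num_roots f v / real v)"
      by (simp add: mult_ac)
    finally show "norm (root_sum f h (q * u * v)) \<le> (y * exp (- (L / 16))) * (num_roots f q / sqrt (real q)) * (num_roots f u / real u) * (num_roots f v / real v)" .
  qed
  also have "\<dots> \<le> (\<Sum>(q, u, v)\<in>Qs \<times> Us \<times> Vs.
        (y * exp (- (L / 16))) * (num_roots f q / sqrt (real q)) * (num_roots f u / real u) * (num_roots f v / real v))"
    using y1 by (intro sum_mono2) (auto simp: triples_def finite_Qs finite_Us finite_Vs)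
  also have "\<dots> = (y * exp (- (L / 16))) * (\<Sum>q\<in>Qs. num_roots f q / sqrt (real q)) * (\<Sum>u\<in>Us. num_roots f u / real u) * (\<Sum>v\<in>Vs. num_roots f v / real v)"
    by (rule sum_product3)
  also have "\<dots> \<le> (y * exp (- (L / 16))) * S0 * exp (4 * (ln L + K0)) * exp (4 * (ln L + K0))"
  proof (intro mult_mono order_refl sum_Us_le sum_Vs_le)
    show "(\<Sum>q\<in>Qs. num_roots f q / sqrt (real q)) \<le> S0"
      unfolding S0_def by (rule sum_bad_part_le[OF finite_Qs]) (auto simp: Qs_def)
  qed (use y1 S0_nonneg in \<open>auto intro!: mult_nonneg_nonneg sum_nonneg\<close>)
  also have "\<dots> = y * S0 * (exp (- (L / 16)) * L ^ 8) * exp (8 * K0)"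
  proof -
    have "exp (4 * (ln L + K0)) * exp (4 * (ln L + K0)) = exp (8 * ln L) * exp (8 * K0)"
      by (simp flip: exp_add)
    also have "exp (8 * ln L) = L ^ 8"
      using exp_of_nat_mult[of 8 "ln L"] L_pos by simp
    finally show ?thesis by (simp add: mult_ac)
  qed
  also have "\<dots> \<le> y * S0 * 1 * exp (8 * K0)"
  proof -
    have "exp (- (L / 16)) * L ^ 8 \<le> exp (- (L / 16)) * exp (L / 16)"
      using L8 by (intro mult_left_mono) (auto simp: L_def)
    then have "exp (- (L / 16)) * L ^ 8 \<le> 1" by (simp add: exp_minus)
    then show ?thesis using y1 S0_nonneg by (intro mult_right_mono mult_left_mono) auto
  qed
  finally show ?thesis by simp
qed

text \<open>For u > y^(1/8) and \<delta> = 1 / ln z, u^\<delta> exceeds exp (\<delta> L / 8) = L^24.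
  This cancels exactly the L^20 of the twisted sum over u and the L^4 of the sum over v, so no
  logarithm remains.\<close>

lemma sum_large_smooth_part_le:
  "(\<Sum>(q, u, v) | (q, u, v) \<in> triples \<and> real u > exp (L / 8). norm (root_sum f h (q * u * v)))
    \<le> y * S0 * exp (24 * K0)"
proof -
  define \<delta> where "\<delta> = 1 / ln z"
  have \<delta>: "\<delta> > 0" "\<delta> * L / 8 = 24 * ln L"
    using ln_z_ge_2 L_pos unfolding \<delta>_def by (simp, simp add: ln_z)
  have "(\<Sum>(q, u, v) | (q, u, v) \<in> triples \<and> real u > exp (L / 8). norm (root_sum f h (q * u * v)))
      \<le> (\<Sum>(q, u, v) | (q, u, v) \<in> triples \<and> real u > exp (L / 8).
        (y * exp (- (24 * ln L))) * (num_roots f q / real q) * (num_roots f u * real u powr (\<delta> - 1)) * (num_roots f v / real v))"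
  proof (rule sum_mono, clarify)
    fix q u v assume t: "(q, u, v) \<in> triples" and u: "real u > exp (L / 8)"
    have pos: "real q > 0" "real u > 0" "real v > 0" and le: "real q * real u * real v \<le> y"
      using t by (auto simp: triples_def Qs_def Us_def Vs_def)
    have "exp (24 * ln L) = exp (L / 8) powr \<delta>" using \<delta> by (simp add: powr_def mult_ac)
    also have "\<dots> \<le> real u powr \<delta>" using u \<delta> by (intro powr_mono2) auto
    finally have "real u powr \<delta> * exp (- (24 * ln L)) \<ge> 1" by (simp add: exp_minus field_simps)
    then have "real q * real u * real v * 1 \<le> y * (real u powr \<delta> * exp (- (24 * ln L)))"
      using le pos y1 by (intro mult_mono) auto
    then have 1: "1 \<le> y * (real u powr \<delta> * exp (- (24 * ln L))) / (real q * real u * real v)"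
      using pos by (simp add: pos_le_divide_eq)
    have "norm (root_sum f h (q * u * v)) \<le> (num_roots f q * num_roots f u * num_roots f v) * 1"
      using norm_root_sum_triple_le[OF t] by simp
    also have "\<dots> \<le> (num_roots f q * num_roots f u * num_roots f v) * (y * (real u powr \<delta> * exp (- (24 * ln L))) / (real q * real u * real v))"
      using 1 by (intro mult_left_mono) auto
    also have "\<dots> = (y * exp (- (24 * ln L))) * (num_roots f q / real q) * (num_roots f u * real u powr (\<delta> - 1)) * (num_roots f v / real v)"
      using pos by (simp add: powr_diff)
    finally show "norm (root_sum f h (q * u * v)) \<le> (y * exp (- (24 * ln L))) * (num_roots f q / real q) * (num_roots f u * real u powr (\<delta> - 1)) * (num_roots f v / real v)" .
  qed
  also have "\<dots> \<le> (\<Sum>(q, u, v)\<in>Qs \<times> Us \<times> Vs.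
        (y * exp (- (24 * ln L))) * (num_roots f q / real q) * (num_roots f u * real u powr (\<delta> - 1)) * (num_roots f v / real v))"
    using y1 by (intro sum_mono2) (auto simp: triples_def finite_Qs finite_Us finite_Vs)
  also have "\<dots> = (y * exp (- (24 * ln L))) * (\<Sum>q\<in>Qs. num_roots f q / real q) * (\<Sum>u\<in>Us. num_roots f u * real u powr (\<delta> - 1)) * (\<Sum>v\<in>Vs. num_roots f v / real v)"
    by (rule sum_product3)
  also have "\<dots> \<le> (y * exp (- (24 * ln L))) * S0 * exp (20 * (ln L + K0)) * exp (4 * (ln L + K0))"
  proof (intro mult_mono order_refl sum_Vs_le)
    show "(\<Sum>q\<in>Qs. num_roots f q / real q) \<le> S0"
      unfolding S0_def by (rule sum_bad_part_inverse_le[OF finite_Qs]) (auto simp: Qs_def)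
    have "(\<Sum>u\<in>Us. num_roots f u * real u powr (\<delta> - 1)) \<le> exp (20 * (ln (ln z) + K0))"
      unfolding \<delta>_def by (rule sum_smooth_rankin_le[OF finite_Us _ ln_z_ge_2 z_pos]) (auto simp: Us_def)
    also have "\<dots> \<le> exp (20 * (ln L + K0))"
      using ln_z_le ln_z_ge_2 L_pos by (simp add: ln_le_cancel_iff)
    finally show "(\<Sum>u\<in>Us. num_roots f u * real u powr (\<delta> - 1)) \<le> exp (20 * (ln L + K0))" .
  qed (use y1 S0_nonneg in \<open>auto intro!: mult_nonneg_nonneg sum_nonneg\<close>)
  also have "\<dots> = y * S0 * (exp (- (24 * ln L)) * exp (20 * (ln L + K0)) * exp (4 * (ln L + K0)))" by simp
  also have "exp (- (24 * ln L)) * exp (20 * (ln L + K0)) * exp (4 * (ln L + K0)) = exp (24 * K0)"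
    by (simp flip: exp_add)
  finally show ?thesis .
qed

text \<open>The only part that contributes logarithms: L^(sqrt 2) from the sum over u, and (ln L)^2
  / L from the sieved sum over v.\<close>

lemma sum_main_part_le:
  "(\<Sum>(q, u, v) | (q, u, v) \<in> triples \<and> real q \<le> exp (L / 8) \<and> real u \<le> exp (L / 8). norm (root_sum f h (q * u * v)))
    \<le> y * S0 * (2 * K1 * K2 * exp (sqrt 2 * (ln L + K0) + 16 * sqrt 2) * ((ln L)\<^sup>2 / L))"
proof -
  define Q where "Q = {q \<in> Qs. real q \<le> exp (L / 8)}"
  define U where "U = {u \<in> Us. real u \<le> exp (L / 8)}"
  define V where "V = (\<lambda>q u. {v. 0 < v \<and> real v \<le> y / (real q * real u) \<and> v \<in> smooth_over R})"
  define T where "T = 2 * K1 * K2 * ((ln L)\<^sup>2 / L)"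
  have T: "T \<ge> 0" unfolding T_def using K1(1) K2_pos L_pos by simp
  have fin: "finite Q" "finite U" "finite (V q u)" for q u
    unfolding Q_def U_def V_def using finite_Qs finite_Us by (auto intro: finite_bounded)
  have "{(q, u, v). (q, u, v) \<in> triples \<and> real q \<le> exp (L / 8) \<and> real u \<le> exp (L / 8)} \<subseteq> Sigma Q (\<lambda>q. Sigma U (V q))"
  proof clarify
    fix q u v assume t: "(q, u, v) \<in> triples" "real q \<le> exp (L / 8)" "real u \<le> exp (L / 8)"
    then have "real v * (real q * real u) \<le> y" "real q * real u > 0" by (auto simp: triples_def Qs_def Us_def mult_ac)
    then have "real v \<le> y / (real q * real u)" by (simp add: pos_le_divide_eq)
    with t show "q \<in> Q \<and> (u, v) \<in> Sigma U (V q)" by (auto simp: triples_def Q_def U_def V_def Vs_def)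
  qed
  then have "(\<Sum>(q, u, v) | (q, u, v) \<in> triples \<and> real q \<le> exp (L / 8) \<and> real u \<le> exp (L / 8). norm (root_sum f h (q * u * v)))
      \<le> (\<Sum>(q, u, v)\<in>Sigma Q (\<lambda>q. Sigma U (V q)). norm (root_sum f h (q * u * v)))"
    using fin by (intro sum_mono2) auto
  also have "\<dots> = (\<Sum>q\<in>Q. \<Sum>u\<in>U. \<Sum>v\<in>V q u. norm (root_sum f h (q * u * v)))"
    using fin by (simp add: sum.Sigma)
  also have "\<dots> \<le> (\<Sum>q\<in>Q. \<Sum>u\<in>U. (T * y) * (num_roots f q / real q) * (euler_weight u * sqrt (num_roots f u) / real u))"
  proof (intro sum_mono)
    fix q u assume "q \<in> Q" "u \<in> U"
    then have "(\<Sum>v\<in>V q u. norm (root_sum f h (q * u * v)))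
        \<le> num_roots f q * (2 * K1 * K2 * (y / (real q * real u)) * euler_weight u * ((ln L)\<^sup>2 / L) * sqrt (num_roots f u))"
      unfolding V_def by (intro sum_rough_part_le) (auto simp: Q_def U_def Qs_def Us_def)
    also have "\<dots> = (T * y) * (num_roots f q / real q) * (euler_weight u * sqrt (num_roots f u) / real u)"
      unfolding T_def by (simp add: mult_ac)
    finally show "(\<Sum>v\<in>V q u. norm (root_sum f h (q * u * v)))
      \<le> (T * y) * (num_roots f q / real q) * (euler_weight u * sqrt (num_roots f u) / real u)" .
  qed
  also have "\<dots> = (T * y) * (\<Sum>q\<in>Q. num_roots f q / real q) * (\<Sum>u\<in>U. euler_weight u * sqrt (num_roots f u) / real u)"
    unfolding sum_distrib_left sum_distrib_right by (subst sum.swap) simp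
  also have "\<dots> \<le> (T * y) * S0 * exp (sqrt 2 * (ln L + K0) + 16 * sqrt 2)"
  proof (intro mult_mono order_refl)
    show "(\<Sum>q\<in>Q. num_roots f q / real q) \<le> S0"
      unfolding S0_def by (rule sum_bad_part_inverse_le[OF fin(1)]) (auto simp: Q_def Qs_def)
    have "U \<subseteq> smooth_over (G y)"
      using smooth_over_mono[OF G_z_subset] unfolding U_def Us_def by auto
    from sum_weighted_sqrt_le[OF fin(2) this y_ge_2]
    show "(\<Sum>u\<in>U. euler_weight u * sqrt (num_roots f u) / real u) \<le> exp (sqrt 2 * (ln L + K0) + 16 * sqrt 2)"
      by (simp add: L_def)
    have "0 \<le> euler_weight u" for u using euler_weight_ge_1[of u] by linarith
    then show "0 \<le> (\<Sum>u\<in>U. euler_weight u * sqrt (num_roots f u) / real u)" by (intro sum_nonneg) simp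
  qed (use T y1 S0_nonneg in \<open>auto intro!: mult_nonneg_nonneg sum_nonneg\<close>)
  also have "\<dots> = y * S0 * (2 * K1 * K2 * exp (sqrt 2 * (ln L + K0) + 16 * sqrt 2) * ((ln L)\<^sup>2 / L))"
    unfolding T_def by simp
  finally show ?thesis .
qed

definition K3 :: real where
  "K3 = 2 * K1 * K2 * exp (sqrt 2 * K0 + 16 * sqrt 2) + exp (8 * K0) + exp (24 * K0)"

lemma sum_norm_root_sum_hooley:
  "(\<Sum>k | 0 < k \<and> real k \<le> y. norm (root_sum f h k))
    \<le> K3 * S0 * (y * ln y powr (sqrt 2 - 1) * ln (ln y) powr (5 / 2))"
proof -
  let ?F = "\<lambda>(q, u, v). norm (root_sum f h (q * u * v))"
  let ?T1 = "{(q, u, v). (q, u, v) \<in> triples \<and> real q > exp (L / 8)}"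
  let ?T2 = "{(q, u, v). (q, u, v) \<in> triples \<and> real u > exp (L / 8)}"
  let ?T3 = "{(q, u, v). (q, u, v) \<in> triples \<and> real q \<le> exp (L / 8) \<and> real u \<le> exp (L / 8)}"
  define w where "w = L powr (sqrt 2 - 1) * ln L powr (5 / 2)"
  have fin: "finite ?T1" "finite ?T2" "finite ?T3" by (auto intro: finite_subset[OF _ finite_triples])
  have "(\<Sum>k | 0 < k \<and> real k \<le> y. norm (root_sum f h k)) \<le> sum ?F triples"
    by (rule sum_norm_root_sum_triples)
  also have "\<dots> \<le> sum ?F (?T3 \<union> (?T1 \<union> ?T2))"
    using fin by (intro sum_mono2) (auto simp: not_le)
  also have "\<dots> \<le> sum ?F ?T3 + (sum ?F ?T1 + sum ?F ?T2)"
  proof -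
    have le: "sum ?F (X \<union> Y) \<le> sum ?F X + sum ?F Y" if "finite X" "finite Y" for X Y
    proof -
      have "sum ?F (X \<union> Y) + sum ?F (X \<inter> Y) = sum ?F X + sum ?F Y" using that by (rule sum.union_inter)
      moreover have "sum ?F (X \<inter> Y) \<ge> 0" by (intro sum_nonneg) auto
      ultimately show ?thesis by linarith
    qed
    have "sum ?F (?T3 \<union> (?T1 \<union> ?T2)) \<le> sum ?F ?T3 + sum ?F (?T1 \<union> ?T2)" using fin by (intro le) auto
    also have "sum ?F (?T1 \<union> ?T2) \<le> sum ?F ?T1 + sum ?F ?T2" using fin by (intro le) auto
    finally show ?thesis by simp
  qed
  also have "\<dots> \<le> y * S0 * (2 * K1 * K2 * exp (sqrt 2 * (ln L + K0) + 16 * sqrt 2) * ((ln L)\<^sup>2 / L))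
      + (y * S0 * exp (8 * K0) + y * S0 * exp (24 * K0))"
    by (intro add_mono sum_main_part_le sum_large_bad_part_le sum_large_smooth_part_le)
  also have "\<dots> \<le> y * S0 * (2 * K1 * K2 * exp (sqrt 2 * K0 + 16 * sqrt 2) * w) + (y * S0 * (exp (8 * K0) * w) + y * S0 * (exp (24 * K0) * w))"
  proof -
    have A: "L powr (sqrt 2 - 1) \<ge> 1" using L_ge_1 by (intro ge_one_powr_ge_zero) auto
    \<comment> \<open>The argument produces (ln L)^2, which is at most the exponent 5/2 of the
      theorem because ln L >= 1.\<close>
    have B2: "ln L powr 2 \<le> ln L powr (5 / 2)" using lnL by (intro powr_mono) auto
    have B3: "1 \<le> ln L powr (5 / 2)" using lnL by (intro ge_one_powr_ge_zero) auto
    \<comment> \<open>This absorbs the two parts that are bounded by a constant times y S0.\<close>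
    have w1: "1 \<le> w" unfolding w_def using mult_mono[OF A B3] by simp
    have "exp (sqrt 2 * (ln L + K0) + 16 * sqrt 2) * ((ln L)\<^sup>2 / L)
        = exp (sqrt 2 * K0 + 16 * sqrt 2) * (L powr (sqrt 2 - 1) * ln L powr 2)"
    proof -
      have "exp (sqrt 2 * (ln L + K0) + 16 * sqrt 2) = exp (sqrt 2 * K0 + 16 * sqrt 2) * L powr sqrt 2"
        using L_pos by (simp add: powr_def algebra_simps flip: exp_add)
      moreover have "ln L powr 2 = (ln L)\<^sup>2" using lnL by simp
      moreover have "L powr (sqrt 2 - 1) = L powr sqrt 2 / L" using L_pos by (simp add: powr_diff)
      ultimately show ?thesis by simp
    qed
    also have "\<dots> \<le> exp (sqrt 2 * K0 + 16 * sqrt 2) * w"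
      unfolding w_def using B2 by (intro mult_left_mono) auto
    finally have C: "2 * K1 * K2 * (exp (sqrt 2 * (ln L + K0) + 16 * sqrt 2) * ((ln L)\<^sup>2 / L))
        \<le> 2 * K1 * K2 * (exp (sqrt 2 * K0 + 16 * sqrt 2) * w)"
      using K1(1) K2_pos by (intro mult_left_mono) auto
    show ?thesis
    proof (intro add_mono mult_left_mono)
      show "2 * K1 * K2 * exp (sqrt 2 * (ln L + K0) + 16 * sqrt 2) * ((ln L)\<^sup>2 / L)
        \<le> 2 * K1 * K2 * exp (sqrt 2 * K0 + 16 * sqrt 2) * w"
        using C by (simp only: mult.assoc)
    qed (use y1 S0_nonneg w1 in auto)
  qed
  also have "\<dots> = K3 * S0 * (y * w)" unfolding K3_def by (simp add: algebra_simps)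
  finally show ?thesis unfolding w_def L_def by (simp add: mult.assoc)
qed

end

section \<open>Bounded y and the conclusion\<close>

lemma norm_root_exp_sum_trivial:
  assumes "y \<ge> 0"
  shows "norm (root_exp_sum f h y) \<le> y * y"
proof -
  have "{k. 0 < k \<and> real k \<le> y} \<subseteq> {1..nat \<lfloor>y\<rfloor>}" by (auto simp: le_nat_floor)
  then have "card {k. 0 < k \<and> real k \<le> y} \<le> nat \<lfloor>y\<rfloor>"
    using card_mono[of "{1..nat \<lfloor>y\<rfloor>}" "{k. 0 < k \<and> real k \<le> y}"] by simp
  then have card: "real (card {k. 0 < k \<and> real k \<le> y}) \<le> y" using assms by linarith
  have "norm (root_exp_sum f h y) \<le> (\<Sum>k | 0 < k \<and> real k \<le> y. norm (root_sum f h k))"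
    unfolding root_exp_sum_eq by (rule norm_sum)
  also have "\<dots> \<le> (\<Sum>k | 0 < k \<and> real k \<le> y. y)"
  proof (rule sum_mono)
    fix k assume "k \<in> {k. 0 < k \<and> real k \<le> y}"
    moreover have "norm (root_sum f h k) \<le> real k"
      using norm_root_sum_le[of f h k] card_roots_mod_le[of f k] by linarith
    ultimately show "norm (root_sum f h k) \<le> y" by simp
  qed
  also have "\<dots> = real (card {k. 0 < k \<and> real k \<le> y}) * y" by simp
  also have "\<dots> \<le> y * y" using card assms by (intro mult_right_mono) auto
  finally show ?thesis .
qed

theorem theorem1p4:
  "\<exists>C :: real. C > 0 \<and>
     (\<forall>(f :: int poly) (h :: int) (y :: real).
        reducible_quadratic f \<longrightarrow> nonsquare f \<longrightarrow> h \<noteq> 0 \<longrightarrow> y \<ge> 3 \<longrightarrow>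
        norm (root_exp_sum f h y)
          \<le> C * sqrt (real_of_int (quadratic_discriminant f))
              * (\<Prod>p :: nat | prime p \<and> int p dvd h. 1 + 7 / sqrt (real p))
              * (y * (ln y) powr (sqrt 2 - 1) * (ln (ln y)) powr (5 / 2)))"
proof -
  obtain K0 where K0: "K0 \<ge> 0" "\<And>y. y \<ge> 2 \<Longrightarrow> (\<Sum>p | prime p \<and> real p \<le> y. 1 / real p) \<le> ln (ln y) + K0"
    using mertens_second_upper by blast
  from card_rough_inverse_class_le obtain K1 where K1: "K1 > 0" and
    "\<forall>L u c Y. ln L \<ge> 1 \<longrightarrow> L \<le> exp (L / 5) \<longrightarrow> L / (192 * ln L) \<ge> 1 \<longrightarrow> u > 0 \<longrightarrow> Y / real u \<ge> exp (L / 4) \<longrightarrow>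
     real (card {e. 0 < e \<and> real e \<le> Y \<and> [int e * c = 1] (mod int u) \<and>
        (\<forall>p. prime p \<longrightarrow> real p \<le> exp (L / (192 * ln L)) \<longrightarrow> \<not> p dvd e)})
      \<le> K1 * (Y / real u) * euler_weight u * (ln L / L)"
    by (elim exE conjE)
  note sieve = this(2)[rule_format]
  define M where "M = 2 * K1 * (exp (K0 + 4) * 192) * exp (sqrt 2 * K0 + 16 * sqrt 2) + exp (8 * K0) + exp (24 * K0)"
  define w where "w = (\<lambda>y::real. ln y powr (sqrt 2 - 1) * ln (ln y) powr (5 / 2))"
  have "\<forall>\<^sub>F y::real in at_top. ln (ln y) \<ge> 1" by real_asymp
  moreover have "\<forall>\<^sub>F y::real in at_top. ln y \<le> exp (ln y / 5)" by real_asymp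
  moreover have "\<forall>\<^sub>F y::real in at_top. ln y / (192 * ln (ln y)) \<ge> 2" by real_asymp
  moreover have "\<forall>\<^sub>F y::real in at_top. ln y ^ 8 \<le> exp (ln y / 16)" by real_asymp
  ultimately have "\<forall>\<^sub>F y::real in at_top. ln (ln y) \<ge> 1 \<and> ln y \<le> exp (ln y / 5) \<and>
      ln y / (192 * ln (ln y)) \<ge> 2 \<and> ln y ^ 8 \<le> exp (ln y / 16)"
    by eventually_elim blast
  then obtain y0 :: real where y0: "\<And>y. y \<ge> y0 \<Longrightarrow> ln (ln y) \<ge> 1 \<and> ln y \<le> exp (ln y / 5) \<and>
      ln y / (192 * ln (ln y)) \<ge> 2 \<and> ln y ^ 8 \<le> exp (ln y / 16)"
    unfolding eventually_at_top_linorder by blast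
  have ln3: "ln (3::real) > 1"
  proof -
    have "exp 1 < (3::real)" using e_less_272 by linarith
    then show ?thesis by (metis exp_gt_zero exp_less_cancel_iff exp_ln zero_less_numeral)
  qed
  \<comment> \<open>As ln ln 3 > 0, the right side stays away from 0 on y >= 3, so bounded y can be
    handled by enlarging the constant.\<close>
  have w3: "w 3 > 0" unfolding w_def using ln3 by simp
  have w_mono: "w 3 \<le> w y" if "y \<ge> 3" for y :: real
  proof -
    have l: "ln 3 \<le> ln y" using that by simp
    then have "ln (ln 3) \<le> ln (ln y)" using ln3 by (subst ln_le_cancel_iff) auto
    then show ?thesis unfolding w_def using l ln3
      by (intro mult_mono powr_mono2) auto
  qed
  \<comment> \<open>The first summand serves y >= y0. For 3 <= y < y0 the trivial bound y^2 is at
    most |y0| y, and dividing by w 3 <= w y gives the second; the absolute value is there because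
    the sign of y0 is unknown.\<close>
  define C where "C = 7 ^ 11 * M + \<bar>y0\<bar> / w 3"
  have M: "M > 0" unfolding M_def using K1 by (intro add_nonneg_pos) auto
  have C: "C > 0" "7 ^ 11 * M \<le> C" "\<bar>y0\<bar> / w 3 \<le> C"
    unfolding C_def using M w3 by (auto intro: add_pos_nonneg)
  have "norm (root_exp_sum f h y)
      \<le> C * sqrt (real_of_int (quadratic_discriminant f))
          * (\<Prod>p :: nat | prime p \<and> int p dvd h. 1 + 7 / sqrt (real p))
          * (y * (ln y) powr (sqrt 2 - 1) * (ln (ln y)) powr (5 / 2))"
    if f: "reducible_quadratic f" "nonsquare f" and h: "h \<noteq> 0" and y: "y \<ge> 3" for f h y
  proof -
    obtain W a b c d where fac: "W \<noteq> 0" "a \<noteq> 0" "c \<noteq> 0" "coprime a b" "coprime c d"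
      "f = smult W ([:b, a:] * [:d, c:])" using reducible_quadratic_primitive[OF f(1)] by metis
    have N: "W * (a * d - b * c) \<noteq> 0" using nonsquare_factored[OF fac(6) f(2) fac(2)] fac(1) by simp
    interpret hooley f W a b c d h K0 K1
      by unfold_locales (fact fac(6) fac(4) fac(5) N h K0 K1 sieve)+
    have D: "sqrt (real_of_int (quadratic_discriminant f)) = \<bar>real_of_int N\<bar>"
      using discriminant_factored[OF fac(6)] by (simp add: N_def)
    have N1: "\<bar>real_of_int N\<bar> \<ge> 1" using N unfolding N_def by linarith
    have yw: "y * w y \<ge> 0" using y w3 w_mono[OF y] by simp
    have NH: "\<bar>real_of_int N\<bar> * H \<ge> 1" using mult_mono[OF N1 H_ge_1] by simp
    have "norm (root_exp_sum f h y) \<le> C * (\<bar>real_of_int N\<bar> * H) * (y * w y)"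
    proof (cases "y \<ge> y0")
      case True
      interpret hooley_large f W a b c d h K0 K1 y
        by unfold_locales (use y0[OF True] y in auto)
      have "norm (root_exp_sum f h y) \<le> (\<Sum>k | 0 < k \<and> real k \<le> y. norm (root_sum f h k))"
        unfolding root_exp_sum_eq by (rule norm_sum)
      also have "\<dots> \<le> hooley_large.K3 K0 K1 * S0 * (y * w y)"
        using sum_norm_root_sum_hooley unfolding w_def by (simp only: mult.assoc)
      \<comment> \<open>The constant exported from the locale depends on \<open>K0\<close> and
        \<open>K1\<close> only, so it equals M, which was fixed before f, h and y.\<close>
      also have "hooley_large.K3 K0 K1 = M" unfolding M_def K2_def K3_def by simp
      also have "M * S0 * (y * w y) = (7 ^ 11 * M) * (\<bar>real_of_int N\<bar> * H) * (y * w y)"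
        unfolding S0_def by (simp only: mult_ac)
      also have "\<dots> \<le> C * (\<bar>real_of_int N\<bar> * H) * (y * w y)"
        using C(2) NH yw by (intro mult_right_mono) auto
      finally show ?thesis .
    next
      case False
      have "norm (root_exp_sum f h y) \<le> y * y" using y by (intro norm_root_exp_sum_trivial) simp
      also have "\<dots> \<le> \<bar>y0\<bar> * y" using False y by (intro mult_right_mono) auto
      also have "\<dots> = \<bar>y0\<bar> / w 3 * (y * w 3)" using w3 by simp
      also have "\<dots> \<le> C * (y * w y)"
        using C w3 w_mono[OF y] y by (intro mult_mono) auto
      also have "\<dots> = C * 1 * (y * w y)" by simp
      \<comment> \<open>N is a nonzero integer and H >= 1, so inserting the factor |N| H only
        enlarges the bound.\<close>
      also have "\<dots> \<le> C * (\<bar>real_of_int N\<bar> * H) * (y * w y)"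
        using C NH yw by (intro mult_right_mono mult_left_mono) auto
      finally show ?thesis .
    qed
    then show ?thesis unfolding D w_def H_def by (simp only: mult.assoc)
  qed
  with C(1) show ?thesis by blast
qed

end
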